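(* Consider the $N$-agent game with dynamics $dx_i=u_i\,dt+u_i\,dW_i$ and costs $J_i$, where $\rho>0$. Assume A1) and $r>\frac{2\sqrt{\rho+1}-(\rho+2)}{\rho^2}$. Then the set of strategies $(\hat u_1,\dots,\hat u_N)$ given by $$\hat u_i(t)=-\frac{p}{p+r}(x_i(t)-\bar x_0),\quad t\ge0,\ i=1,\dots,N,$$ is an $\varepsilon$-Nash equilibrium, i.e. for every $i$, $$J_i(\hat u_i,\hat u_{-i})-\varepsilon\le\inf_{u_i\in\mathcal{U}_c'}J_i(u_i,\hat u_{-i})\le J_i(\hat u_i,\hat u_{-i}),$$ where $\varepsilon=O\big(\epsilon_N+\frac1{\sqrt N}\big)$. Furthermore, the asymptotic optimal cost of agent $i$ is $\lim_{N\to\infty}J_i(\hat u_i,\hat u_{-i})=p\,(\mathbb{E}x_i^2(0)-\bar x_0^2)$.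
   Context: Scalar model: $x_i,u_i\in\mathbb{R}$, $dx_i(t)=u_i(t)dt+u_i(t)dW_i(t)$, $i=1,\dots,N$, with $W_1,\dots,W_N$ mutually independent standard Brownian motions. Cost: $J_i(u_i,u_{-i})=\mathbb{E}\int_0^\infty e^{-\rho t}\{|x_i(t)-x^{(N)}(t)|^2+r|u_i(t)|^2\}dt$, $x^{(N)}=\frac1N\sum_{j=1}^Nx_j$, $\rho>0$, $r\in\mathbb{R}$ (possibly negative). A1) $x_i(0)$, $i=1,\dots,N$, are mutually independent with $\mathbb{E}x_i(0)\equiv\bar x_0$, $\max_{1\le i\le N}\mathbb{E}|x_i(0)|^2<c_0$ with $c_0$ independent of $N$; $\{x_i(0)\}$ and $\{W_i\}$ are independent. $p=\frac{1-\rho r+\sqrt\Delta}{2(\rho+1)}$ with $\Delta=(\rho r)^2+2\rho r+4r+1$; it is a solution of $\rho p=1-\frac{p^2}{r+p}$ with $p+r>0$. $\mathcal{F}_t^i=\sigma(x_i(s),s\le t)$ and $\mathcal{U}_c'=\{u_i: u_i(t)\text{ is }\sigma(\bigcup_{j=1}^N\mathcal{F}_t^j)\text{-measurable},\ \mathbb{E}\int_0^\infty e^{-\rho t}|u_i(t)|^2dt<\infty\}$. $\epsilon_N\ge0$ is defined in general by $\epsilon_N^2=\int_0^\infty e^{-\rho t}\|\int_\Theta\bar x_\theta(t)dF_N(\theta)-\int_\Theta\bar x_\theta(t)dF(\theta)\|^2dt$, where $F_N$ is the empirical distribution function of agent parameters $\theta_1,\dots,\theta_N\in\Theta$, $F$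 its weak limit, and $\bar x_\theta$ the mean-field state mean for parameter $\theta$; in the present model the dynamics do not depend on $\theta$, so $\bar x_\theta=\bar x\equiv\bar x_0$ for all $\theta$.
   Formalization: The ε-Nash inequalities are asserted for all sufficiently large N (with ε uniform in i); for every N they fail, since for N=1 and r<0 the cost is r·E∫e^{-ρt}u² dt, whose infimum over admissible controls is −∞, so no finite ε exists. *)

theory Defs
  imports "HOL-Probability.Probability" "HOL-Library.Landau_Symbols"
begin

text \<open>
  A stochastic process in continuous time is a function of type \<open>real \<Rightarrow> 'w \<Rightarrow> real\<close>; only its
  values at times \<open>t \<ge> 0\<close> matter.  Agents are numbered from 1, so the population of size \<open>N\<close> is
  \<open>{1..N}\<close>, formed by the first \<open>N\<close> members of one infinite sequence of agents.
\<close>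

type_synonym 'w process = "real \<Rightarrow> 'w \<Rightarrow> real"

text \<open>The sigma-algebra generated by the random variables \<open>X i\<close>, \<open>i \<in> I\<close>.\<close>

definition gen :: "'w measure \<Rightarrow> ('i \<Rightarrow> 'w \<Rightarrow> real) \<Rightarrow> 'i set \<Rightarrow> 'w measure" where
  "gen M X I = sigma (space M) {X i -` A \<inter> space M | i A. i \<in> I \<and> A \<in> sets borel}"


section \<open>Brownian motion\<close>

definition std_brownian_motion :: "'w measure \<Rightarrow> 'w process \<Rightarrow> bool" where
  "std_brownian_motion M W \<longleftrightarrow>
     (\<forall>t\<ge>0. W t \<in> borel_measurable M) \<and>
     (AE \<omega> in M. W 0 \<omega> = 0) \<and>
     (\<forall>(\<tau> :: nat \<Rightarrow> real) n. 0 \<le> \<tau> 0 \<and> mono \<tau> \<longrightarrow>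
        prob_space.indep_vars M (\<lambda>_. borel) (\<lambda>k \<omega>. W (\<tau> (Suc k)) \<omega> - W (\<tau> k) \<omega>) {..<n}) \<and>
     (\<forall>s t. 0 \<le> s \<and> s < t \<longrightarrow>
        distributed M lborel (\<lambda>\<omega>. W t \<omega> - W s \<omega>) (\<lambda>y. ennreal (normal_density 0 (sqrt (t - s)) y))) \<and>
     (AE \<omega> in M. continuous_on {0..} (\<lambda>t. W t \<omega>))"

definition independent_brownian_motions :: "'w measure \<Rightarrow> (nat \<Rightarrow> 'w process) \<Rightarrow> bool" where
  "independent_brownian_motions M W \<longleftrightarrow>
     (\<forall>i\<ge>1. std_brownian_motion M (W i)) \<and>
     prob_space.indep_sets M (\<lambda>i. sets (gen M (W i) {0..})) {1..}"

text \<open>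
  A filtration with respect to which the Ito integrals of the \<open>N\<close>-agent system make sense: the
  initial states are known at time 0, and the Brownian motions are adapted, with the
  future increments of \<open>(W 1, \<dots>, W N)\<close> jointly independent of the past.
\<close>

definition compatible_filtration ::
  "'w measure \<Rightarrow> (nat \<Rightarrow> 'w \<Rightarrow> real) \<Rightarrow> (nat \<Rightarrow> 'w process) \<Rightarrow> nat \<Rightarrow> (real \<Rightarrow> 'w measure) \<Rightarrow> bool" where
  "compatible_filtration M x0 W N G \<longleftrightarrow>
     filtration (space M) G \<and>
     (\<forall>t. subalgebra M (G t)) \<and>
     (\<forall>i\<in>{1..N}. x0 i \<in> borel_measurable (G 0)) \<and>
     (\<forall>i\<in>{1..N}. \<forall>t\<ge>0. W i t \<in> borel_measurable (G t)) \<and>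
     (\<forall>s\<ge>0. prob_space.indep_set M (sets (G s))
        (sets (gen M (\<lambda>(i, t) \<omega>. W i t \<omega> - W i s \<omega>) ({1..N} \<times> {s..}))))"


section \<open>Ito integral\<close>

definition simple_process :: "nat \<Rightarrow> (nat \<Rightarrow> real) \<Rightarrow> (nat \<Rightarrow> 'w \<Rightarrow> real) \<Rightarrow> 'w process" where
  "simple_process n \<tau> \<xi> t \<omega> = (\<Sum>k<n. \<xi> k \<omega> * indicator {\<tau> k<..\<tau> (Suc k)} t)"

definition simple_ito_integral ::
  "'w process \<Rightarrow> real \<Rightarrow> nat \<Rightarrow> (nat \<Rightarrow> real) \<Rightarrow> (nat \<Rightarrow> 'w \<Rightarrow> real) \<Rightarrow> 'w \<Rightarrow> real" where
  "simple_ito_integral W T n \<tau> \<xi> \<omega> =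
     (\<Sum>k<n. \<xi> k \<omega> * (W (min T (\<tau> (Suc k))) \<omega> - W (min T (\<tau> k)) \<omega>))"

definition nonanticipating :: "(real \<Rightarrow> 'w measure) \<Rightarrow> nat \<Rightarrow> (nat \<Rightarrow> real) \<Rightarrow> (nat \<Rightarrow> 'w \<Rightarrow> real) \<Rightarrow> bool" where
  "nonanticipating G n \<tau> \<xi> \<longleftrightarrow>
     0 \<le> \<tau> 0 \<and> mono \<tau> \<and>
     (\<forall>k<n. \<xi> k \<in> borel_measurable (G (\<tau> k)) \<and> (\<exists>B. \<forall>\<omega>\<in>space (G (\<tau> k)). \<bar>\<xi> k \<omega>\<bar> \<le> B))"

text \<open>
  \<open>I\<close> is (a version of) the Ito integral of \<open>u\<close> over \<open>[0, T]\<close>, in the usual square-integrable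
  theory: \<open>u\<close> is the limit of simple processes in \<open>L\<^sup>2([0,T] \<times> \<Omega>)\<close>, and \<open>I\<close> is the limit of
  their integrals in \<open>L\<^sup>2(\<Omega>)\<close>.
\<close>

definition has_ito_integral ::
  "'w measure \<Rightarrow> (real \<Rightarrow> 'w measure) \<Rightarrow> 'w process \<Rightarrow> real \<Rightarrow> 'w process \<Rightarrow> ('w \<Rightarrow> real) \<Rightarrow> bool" where
  "has_ito_integral M G W T u I \<longleftrightarrow>
     I \<in> borel_measurable M \<and>
     (\<exists>(n :: nat \<Rightarrow> nat) \<tau> \<xi>.
        (\<forall>m. nonanticipating G (n m) (\<tau> m) (\<xi> m)) \<and>
        (\<lambda>m. \<integral>\<^sup>+\<omega>. (\<integral>\<^sup>+t\<in>{0..T}. ennreal ((simple_process (n m) (\<tau> m) (\<xi> m) t \<omega> - u t \<omega>)\<^sup>2) \<partial>lborel) \<partial>M)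
          \<longlonglongrightarrow> 0 \<and>
        (\<lambda>m. \<integral>\<^sup>+\<omega>. ennreal ((simple_ito_integral W T (n m) (\<tau> m) (\<xi> m) \<omega> - I \<omega>)\<^sup>2) \<partial>M)
          \<longlonglongrightarrow> 0)"


section \<open>The game\<close>

text \<open>\<open>dx(t) = u(t) dt + u(t) dW(t)\<close> with initial value \<open>\<xi>\<close>.\<close>

definition sde_solution ::
  "'w measure \<Rightarrow> (real \<Rightarrow> 'w measure) \<Rightarrow> 'w process \<Rightarrow> ('w \<Rightarrow> real) \<Rightarrow> 'w process \<Rightarrow> 'w process \<Rightarrow> bool" where
  "sde_solution M G W \<xi> x u \<longleftrightarrow>
     (\<lambda>(t, \<omega>). x t \<omega>) \<in> borel_measurable (restrict_space borel {0..} \<Otimes>\<^sub>M M) \<and>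
     (\<lambda>(t, \<omega>). u t \<omega>) \<in> borel_measurable (restrict_space borel {0..} \<Otimes>\<^sub>M M) \<and>
     (\<forall>t\<ge>0. x t \<in> borel_measurable (G t) \<and> u t \<in> borel_measurable (G t)) \<and>
     (AE \<omega> in M. continuous_on {0..} (\<lambda>t. x t \<omega>)) \<and>
     (\<forall>t\<ge>0. \<exists>I. has_ito_integral M G W t u I \<and>
        (AE \<omega> in M. x t \<omega> = \<xi> \<omega> + (LBINT s:{0..t}. u s \<omega>) + I \<omega>))"

text \<open>
  \<open>x\<close> and \<open>u\<close> are the states and controls of a run of the \<open>N\<close>-agent system.  The information
  patterns of the game are generated by the states themselves, so no filtration is fixed in
  advance; the dynamics only have to make sense for some compatible one.
\<close>

definition trajectory ::
  "'w measure \<Rightarrow> (nat \<Rightarrow> 'w \<Rightarrow> real) \<Rightarrow> (nat \<Rightarrow> 'w process) \<Rightarrow> nat \<Rightarrow>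
   (nat \<Rightarrow> 'w process) \<Rightarrow> (nat \<Rightarrow> 'w process) \<Rightarrow> bool" where
  "trajectory M x0 W N x u \<longleftrightarrow>
     (\<exists>G. compatible_filtration M x0 W N G \<and>
        (\<forall>i\<in>{1..N}. sde_solution M G (W i) (x0 i) (x i) (u i)))"

definition population_mean :: "nat \<Rightarrow> (nat \<Rightarrow> 'w process) \<Rightarrow> 'w process" where
  "population_mean N x t \<omega> = (\<Sum>j=1..N. x j t \<omega>) / real N"

definition cost ::
  "'w measure \<Rightarrow> real \<Rightarrow> real \<Rightarrow> nat \<Rightarrow> nat \<Rightarrow> (nat \<Rightarrow> 'w process) \<Rightarrow> (nat \<Rightarrow> 'w process) \<Rightarrow> real" where
  "cost M \<rho> r N i x u =
     (\<integral>\<omega>. (LBINT t:{0..}. exp (- \<rho> * t) *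
        (\<bar>x i t \<omega> - population_mean N x t \<omega>\<bar>\<^sup>2 + r * \<bar>u i t \<omega>\<bar>\<^sup>2)) \<partial>M)"

text \<open>
  The control set \<open>\<U>\<^sub>c'\<close>.  It depends on \<open>x\<close>, the states that result when the control is
  actually used, since \<open>\<F>\<^sub>t\<^sup>j = \<sigma>(x\<^sub>j(s), s \<le> t)\<close>.
\<close>

definition centralized_controls ::
  "'w measure \<Rightarrow> real \<Rightarrow> nat \<Rightarrow> (nat \<Rightarrow> 'w process) \<Rightarrow> 'w process set" where
  "centralized_controls M \<rho> N x =
     {v. (\<forall>t\<ge>0. v t \<in> borel_measurable (sigma (space M) (\<Union>j\<in>{1..N}. sets (gen M (x j) {0..t})))) \<and>
         (\<integral>\<^sup>+\<omega>. (\<integral>\<^sup>+t\<in>{0..}. ennreal (exp (- \<rho> * t) * \<bar>v t \<omega>\<bar>\<^sup>2) \<partial>lborel) \<partial>M) < \<infinity>}"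

definition riccati_p :: "real \<Rightarrow> real \<Rightarrow> real" where
  "riccati_p \<rho> r =
     (let \<Delta> = (\<rho> * r)\<^sup>2 + 2 * \<rho> * r + 4 * r + 1
      in (1 - \<rho> * r + sqrt \<Delta>) / (2 * (\<rho> + 1)))"

definition feedback :: "real \<Rightarrow> real \<Rightarrow> real \<Rightarrow> real \<Rightarrow> real" where
  "feedback \<rho> r xbar0 y = - (riccati_p \<rho> r / (riccati_p \<rho> r + r)) * (y - xbar0)"

definition uses_feedback ::
  "'w measure \<Rightarrow> real \<Rightarrow> real \<Rightarrow> real \<Rightarrow> 'w process \<Rightarrow> 'w process \<Rightarrow> bool" where
  "uses_feedback M \<rho> r xbar0 y v \<longleftrightarrow> (\<forall>t\<ge>0. \<forall>\<omega>\<in>space M. v t \<omega> = feedback \<rho> r xbar0 (y t \<omega>))"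

text \<open>
  The runs in which agent \<open>i\<close> uses an arbitrary control from \<open>\<U>\<^sub>c'\<close> while all others keep to
  the feedback law.
\<close>

definition deviations ::
  "'w measure \<Rightarrow> (nat \<Rightarrow> 'w \<Rightarrow> real) \<Rightarrow> (nat \<Rightarrow> 'w process) \<Rightarrow> real \<Rightarrow> real \<Rightarrow> real \<Rightarrow> nat \<Rightarrow> nat \<Rightarrow>
   ((nat \<Rightarrow> 'w process) \<times> (nat \<Rightarrow> 'w process)) set" where
  "deviations M x0 W \<rho> r xbar0 N i =
     {(x, u). trajectory M x0 W N x u \<and>
        (\<forall>j\<in>{1..N} - {i}. uses_feedback M \<rho> r xbar0 (x j) (u j)) \<and>
        u i \<in> centralized_controls M \<rho> N x}"

definition assumption_A1 ::
  "'w measure \<Rightarrow> (nat \<Rightarrow> 'w \<Rightarrow> real) \<Rightarrow> (nat \<Rightarrow> 'w process) \<Rightarrow> real \<Rightarrow> real \<Rightarrow> bool" where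
  "assumption_A1 M x0 W xbar0 c0 \<longleftrightarrow>
     prob_space.indep_vars M (\<lambda>_. borel) x0 {1..} \<and>
     (\<forall>i\<ge>1. integrable M (x0 i) \<and> (\<integral>\<omega>. x0 i \<omega> \<partial>M) = xbar0) \<and>
     (\<forall>i\<ge>1. integrable M (\<lambda>\<omega>. \<bar>x0 i \<omega>\<bar>\<^sup>2)) \<and>
     (\<forall>N\<ge>1. (MAX i\<in>{1..N}. \<integral>\<omega>. \<bar>x0 i \<omega>\<bar>\<^sup>2 \<partial>M) < c0) \<and>
     prob_space.indep_set M (sets (gen M x0 {1..}))
       (sets (gen M (\<lambda>(i, t). W i t) ({1..} \<times> {0..})))"


section \<open>Empirical distribution of the agent parameters\<close>

definition empirical_distribution ::
  "'p::euclidean_space set \<Rightarrow> (nat \<Rightarrow> 'p) \<Rightarrow> nat \<Rightarrow> 'p measure" where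
  "empirical_distribution \<Theta> \<theta> N = distr (uniform_count_measure {1..N}) (restrict_space borel \<Theta>) \<theta>"

definition weak_limit ::
  "'p::euclidean_space set \<Rightarrow> (nat \<Rightarrow> 'p measure) \<Rightarrow> 'p measure \<Rightarrow> bool" where
  "weak_limit \<Theta> FN F \<longleftrightarrow>
     (\<forall>\<phi> :: 'p \<Rightarrow> real. continuous_on \<Theta> \<phi> \<and> bounded (\<phi> ` \<Theta>) \<longrightarrow>
        (\<lambda>N. \<integral>q. \<phi> q \<partial>FN N) \<longlonglongrightarrow> (\<integral>q. \<phi> q \<partial>F))"

definition mean_field_error :: "real \<Rightarrow> ('p \<Rightarrow> real \<Rightarrow> real) \<Rightarrow> 'p measure \<Rightarrow> 'p measure \<Rightarrow> real" where
  "mean_field_error \<rho> xbar FN F =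
     sqrt (LBINT t:{0..}. exp (- \<rho> * t) *
       \<bar>(\<integral>q. xbar q t \<partial>FN) - (\<integral>q. xbar q t \<partial>F)\<bar>\<^sup>2)"

end

theory Submission
  imports Defs
begin

text \<open>
  Write \<open>v = x - \<bar>x\<^sub>0\<close> for a centred state.  No Ito formula is needed: the isometry and the
  orthogonality of Ito increments to the past already give, for Ito processes \<open>X\<close>, \<open>Y\<close> with
  controls \<open>U\<close>, \<open>V\<close>, the mean product rule
  \<open>E X(t)Y(t) = E X(0)Y(0) + \<integral> E(UY + XV) + [same noise] \<integral> E UV\<close> over \<open>[0,t]\<close>.
  Discounting it with \<open>X = Y = v\<close> and using the Riccati equation completes the square,
  \<open>E \<integral> e\<^bsup>-\<rho>t\<^esup> (v\<^sup>2 + r u\<^sup>2) = p E v(0)\<^sup>2 + (p + r) E \<integral> e\<^bsup>-\<rho>t\<^esup> (u + k v)\<^sup>2\<close> with \<open>k = p/(p+r)\<close>,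
  so the feedback law minimises the limiting cost.  The agents that keep to the feedback law
  are uncorrelated, hence the discounted mean square of their average \<open>m\<close> is \<open>O(1/N)\<close>, and the true
  running cost \<open>(1 - 1/N)\<^sup>2 (v - m)\<^sup>2 + r u\<^sup>2\<close> differs from the limiting one by a factor
  \<open>1 + O(1/\<surd>N)\<close> on \<open>v\<^sup>2\<close> and an additive \<open>O(1/\<surd>N)\<close>.  The factor is harmless for negative \<open>r\<close> as
  well, because \<open>\<alpha> v\<^sup>2 + r u\<^sup>2\<close> still has a nonnegative discounted integral for some \<open>\<alpha> < 1\<close>.
\<close>

section \<open>Square-integrable functions\<close>

text \<open>Three points shape the work. (1) \<open>has_ito_integral\<close> only asserts,
  separately for each horizon, that some approximating sequence exists; comparing the integral at
  two times therefore needs the fact that one sequence serves all earlier times as well, and the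
  isometry provides it. (2) On the infinite horizon a discounted boundary term would have to vanish.
  It never arises: the mean product rule is integrated against the discount by Fubini, once the
  state is known to have finite discounted energy. A Hardy inequality for the drift and the isometry
  for the noise derive this from the energy of the control. (3) An arbitrary deviation has no bound
  on its state energy, so an error of \<open>1 / sqrt N\<close> times that energy cannot be
  estimated away. It is paid for by mixing the completed square at \<open>r\<close> with the one at
  \<open>r / \<alpha>\<close>, where \<open>\<alpha> < 1\<close> exists because the condition on
  \<open>r\<close> is strict. With \<open>s = sqrt (\<rho> + 1)\<close> this condition reads
  \<open>0 < 1 + r * (s + 1)^2\<close>; it makes the discriminant positive and the closed loop
  stable under the discount.\<close>

lemmas Lint_cong = Bochner_Integration.integral_cong
lemmas Lint_add = Bochner_Integration.integral_add
lemmas Lint_sum = Bochner_Integration.integral_sum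

definition sq_int :: "'a measure \<Rightarrow> ('a \<Rightarrow> real) \<Rightarrow> bool" where
  "sq_int N f \<longleftrightarrow> f \<in> borel_measurable N \<and> integrable N (\<lambda>x. (f x)\<^sup>2)"

lemma sq_int_measurable: "sq_int N f \<Longrightarrow> f \<in> borel_measurable N"
  by (simp add: sq_int_def)

lemma sq_int_power2: "sq_int N f \<Longrightarrow> integrable N (\<lambda>x. (f x)\<^sup>2)"
  by (simp add: sq_int_def)

lemma sq_intI_nn:
  assumes "f \<in> borel_measurable N" "(\<integral>\<^sup>+x. ennreal ((f x)\<^sup>2) \<partial>N) < \<infinity>"
  shows "sq_int N f"
  using assms by (auto simp: sq_int_def intro!: integrableI_nonneg)

lemma sq_int_nn: "sq_int N f \<Longrightarrow> (\<integral>\<^sup>+x. ennreal ((f x)\<^sup>2) \<partial>N) = ennreal (\<integral>x. (f x)\<^sup>2 \<partial>N)"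
  by (auto simp: sq_int_def intro!: nn_integral_eq_integral)

lemma sq_int_mult:
  assumes "sq_int N f" "sq_int N g"
  shows "integrable N (\<lambda>x. f x * g x)"
proof (rule Bochner_Integration.integrable_bound)
  show "integrable N (\<lambda>x. (f x)\<^sup>2 + (g x)\<^sup>2)"
    using assms by (auto simp: sq_int_def)
  show "(\<lambda>x. f x * g x) \<in> borel_measurable N"
    using assms by (auto simp: sq_int_def)
  have "\<bar>a * b\<bar> \<le> a\<^sup>2 + b\<^sup>2" for a b :: real
  proof -
    have "2 * (\<bar>a\<bar> * \<bar>b\<bar>) \<le> \<bar>a\<bar>\<^sup>2 + \<bar>b\<bar>\<^sup>2"
      using sum_squares_bound[of "\<bar>a\<bar>" "\<bar>b\<bar>"] by simp
    moreover have "0 \<le> \<bar>a\<bar> * \<bar>b\<bar>" by simp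
    ultimately show ?thesis unfolding abs_mult power2_abs by linarith
  qed
  then show "AE x in N. norm (f x * g x) \<le> norm ((f x)\<^sup>2 + (g x)\<^sup>2)"
    by auto
qed

lemma sq_int_cmult: "sq_int N f \<Longrightarrow> sq_int N (\<lambda>x. c * f x)"
  by (auto simp: sq_int_def power_mult_distrib)

lemma sq_int_uminus: "sq_int N f \<Longrightarrow> sq_int N (\<lambda>x. - f x)"
  by (auto simp: sq_int_def)

lemma sq_int_add:
  assumes "sq_int N f" "sq_int N g"
  shows "sq_int N (\<lambda>x. f x + g x)"
proof -
  have "integrable N (\<lambda>x. (f x)\<^sup>2 + (g x)\<^sup>2 + 2 * (f x * g x))"
    using assms sq_int_mult[OF assms] by (auto simp: sq_int_def)
  then show ?thesis
    using assms by (auto simp: sq_int_def power2_sum mult.assoc)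
qed

lemma sq_int_diff: "sq_int N f \<Longrightarrow> sq_int N g \<Longrightarrow> sq_int N (\<lambda>x. f x - g x)"
  using sq_int_add[OF _ sq_int_uminus, of N f g] by simp

lemma sq_int_zero: "sq_int N (\<lambda>x. 0)"
  by (simp add: sq_int_def)

lemma sq_int_sum:
  "(\<And>i. i \<in> I \<Longrightarrow> sq_int N (f i)) \<Longrightarrow> sq_int N (\<lambda>x. \<Sum>i\<in>I. f i x)"
  by (induction I rule: infinite_finite_induct) (auto intro: sq_int_add sq_int_zero)

lemma (in finite_measure) sq_int_const: "sq_int M (\<lambda>x. c)"
  by (simp add: sq_int_def)

lemma (in finite_measure) sq_int_integrable: "sq_int M f \<Longrightarrow> integrable M f"
  by (auto simp: sq_int_def intro: square_integrable_imp_integrable)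

lemma sq_int_cong_AE:
  assumes "sq_int N f" "g \<in> borel_measurable N" "AE x in N. f x = g x"
  shows "sq_int N g"
proof -
  have "integrable N (\<lambda>x. (g x)\<^sup>2) \<longleftrightarrow> integrable N (\<lambda>x. (f x)\<^sup>2)"
    using assms by (intro integrable_cong_AE) (auto simp: sq_int_def)
  then show ?thesis using assms by (auto simp: sq_int_def)
qed

lemma sq_int_bounded_mult:
  assumes "sq_int N f" "g \<in> borel_measurable N" "\<And>x. x \<in> space N \<Longrightarrow> \<bar>g x\<bar> \<le> B"
  shows "sq_int N (\<lambda>x. g x * f x)"
proof -
  have "integrable N (\<lambda>x. (g x * f x)\<^sup>2)"
  proof (rule Bochner_Integration.integrable_bound)
    show "integrable N (\<lambda>x. B\<^sup>2 * (f x)\<^sup>2)"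
      using assms by (auto simp: sq_int_def)
    have "(g x)\<^sup>2 \<le> B\<^sup>2" if "x \<in> space N" for x
      using power_mono[OF assms(3)[OF that] abs_ge_zero, of 2] by simp
    then show "AE x in N. norm ((g x * f x)\<^sup>2) \<le> norm (B\<^sup>2 * (f x)\<^sup>2)"
      by (intro AE_I2) (auto simp: power_mult_distrib intro!: mult_right_mono)
  qed (use assms in \<open>auto simp: sq_int_def\<close>)
  then show ?thesis using assms by (auto simp: sq_int_def)
qed

lemma integral_sq_add:
  assumes "sq_int N f" "sq_int N g"
  shows "(\<integral>x. (a * f x + b * g x)\<^sup>2 \<partial>N) =
    a\<^sup>2 * (\<integral>x. (f x)\<^sup>2 \<partial>N) + 2 * a * b * (\<integral>x. f x * g x \<partial>N) + b\<^sup>2 * (\<integral>x. (g x)\<^sup>2 \<partial>N)"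
proof -
  have *: "(a * f x + b * g x)\<^sup>2 = a\<^sup>2 * (f x)\<^sup>2 + 2 * a * b * (f x * g x) + b\<^sup>2 * (g x)\<^sup>2" for x
    by (simp add: power2_sum power_mult_distrib algebra_simps)
  show ?thesis unfolding *
    using assms sq_int_mult[OF assms] by (simp add: sq_int_def)
qed

text \<open>The integral of \<open>(y * f + z * g)^2\<close> is a nonnegative quadratic form in
  \<open>y\<close> and \<open>z\<close>. Its value at \<open>y = b\<close>, \<open>z = - c\<close>
  is \<open>b * (a * b - c^2)\<close>; if \<open>b = 0\<close>, a nonzero \<open>c\<close> would
  allow a \<open>z\<close> that makes it \<open>- 1\<close>.\<close>

lemma integral_Cauchy_Schwarz:
  assumes "sq_int N f" "sq_int N g"
  shows "\<bar>\<integral>x. f x * g x \<partial>N\<bar> \<le> sqrt (\<integral>x. (f x)\<^sup>2 \<partial>N) * sqrt (\<integral>x. (g x)\<^sup>2 \<partial>N)"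
proof -
  define a b c where "a = (\<integral>x. (f x)\<^sup>2 \<partial>N)" and "b = (\<integral>x. (g x)\<^sup>2 \<partial>N)" and "c = (\<integral>x. f x * g x \<partial>N)"
  have *: "0 \<le> y\<^sup>2 * a + 2 * y * z * c + z\<^sup>2 * b" for y z
    using integral_sq_add[OF assms, of y z] Bochner_Integration.integral_nonneg[of N "\<lambda>x. (y * f x + z * g x)\<^sup>2"]
    by (simp add: a_def b_def c_def)
  have "b \<ge> 0" by (simp add: b_def)
  have "c\<^sup>2 \<le> a * b"
  proof (cases "b = 0")
    case True
    have "c = 0"
    proof (rule ccontr)
      assume "c \<noteq> 0"
      have "0 \<le> a + 2 * (- (a + 1) / (2 * c)) * c" using *[of 1 "- (a + 1) / (2 * c)"] True by simp
      also have "\<dots> = - 1" using \<open>c \<noteq> 0\<close> by (simp add: field_simps)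
      finally show False by simp
    qed
    with True show ?thesis by simp
  next
    case False
    have "0 \<le> b * (a * b - c\<^sup>2)" using *[of b "- c"] by (simp add: power2_eq_square algebra_simps)
    then show ?thesis using False \<open>b \<ge> 0\<close> by (simp add: zero_le_mult_iff)
  qed
  then have "sqrt (c\<^sup>2) \<le> sqrt (a * b)" by (rule real_sqrt_le_mono)
  then show ?thesis by (simp add: real_sqrt_mult a_def b_def c_def)
qed

text \<open>Continuity of the inner product of L2. Every identity proved for simple integrands
  passes to general Ito integrals through this lemma.\<close>

lemma sq_lim_mult:
  assumes f: "\<And>n. sq_int N (f n)" "sq_int N F" "(\<lambda>n. \<integral>x. (f n x - F x)\<^sup>2 \<partial>N) \<longlonglongrightarrow> 0"
    and g: "\<And>n. sq_int N (g n)" "sq_int N H" "(\<lambda>n. \<integral>x. (g n x - H x)\<^sup>2 \<partial>N) \<longlonglongrightarrow> 0"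
  shows "(\<lambda>n. \<integral>x. f n x * g n x \<partial>N) \<longlonglongrightarrow> (\<integral>x. F x * H x \<partial>N)"
proof -
  define a where "a n = sqrt (\<integral>x. (f n x - F x)\<^sup>2 \<partial>N)" for n
  define b where "b n = sqrt (\<integral>x. (g n x - H x)\<^sup>2 \<partial>N)" for n
  define A B where "A = sqrt (\<integral>x. (F x)\<^sup>2 \<partial>N)" and "B = sqrt (\<integral>x. (H x)\<^sup>2 \<partial>N)"
  have a0: "a \<longlonglongrightarrow> 0" and b0: "b \<longlonglongrightarrow> 0"
    using tendsto_real_sqrt[OF f(3)] tendsto_real_sqrt[OF g(3)] by (auto simp: a_def[abs_def] b_def[abs_def])
  have df: "sq_int N (\<lambda>x. f n x - F x)" and dg: "sq_int N (\<lambda>x. g n x - H x)" for n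
    using f g by (auto intro: sq_int_diff)
  have bd: "norm ((\<integral>x. f n x * g n x \<partial>N) - (\<integral>x. F x * H x \<partial>N)) \<le> a n * b n + A * b n + a n * B" for n
  proof -
    have "(\<integral>x. f n x * g n x \<partial>N) =
      (\<integral>x. (f n x - F x) * (g n x - H x) + F x * (g n x - H x) + (f n x - F x) * H x + F x * H x \<partial>N)"
      by (intro Lint_cong) (auto simp: algebra_simps)
    also have "\<dots> = (\<integral>x. (f n x - F x) * (g n x - H x) \<partial>N) + (\<integral>x. F x * (g n x - H x) \<partial>N)
       + (\<integral>x. (f n x - F x) * H x \<partial>N) + (\<integral>x. F x * H x \<partial>N)"
      using sq_int_mult[OF df dg] sq_int_mult[OF f(2) dg] sq_int_mult[OF df g(2)] sq_int_mult[OF f(2) g(2)]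
      by (simp add: Lint_add)
    finally have "(\<integral>x. f n x * g n x \<partial>N) - (\<integral>x. F x * H x \<partial>N) = \<dots> - (\<integral>x. F x * H x \<partial>N)" by simp
    then show ?thesis
      using integral_Cauchy_Schwarz[OF df dg, of n n] integral_Cauchy_Schwarz[OF f(2) dg, of n]
        integral_Cauchy_Schwarz[OF df g(2), of n]
      unfolding a_def b_def A_def B_def real_norm_def by linarith
  qed
  have "(\<lambda>n. a n * b n + A * b n + a n * B) \<longlonglongrightarrow> 0 * 0 + A * 0 + 0 * B"
    by (intro tendsto_intros a0 b0)
  then have "(\<lambda>n. (\<integral>x. f n x * g n x \<partial>N) - (\<integral>x. F x * H x \<partial>N)) \<longlonglongrightarrow> 0"
    using Lim_null_comparison[OF always_eventually[OF allI[OF bd]]] by simp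
  then show ?thesis by (simp add: LIM_zero_iff)
qed

text \<open>\<open>has_ito_integral\<close> speaks of convergence of extended integrals. Once one of
  them is finite, \<open>F\<close> is square integrable as \<open>f n - (f n - F)\<close>, and the
  convergence is one of real numbers.\<close>

lemma sq_lim_nn:
  assumes f: "\<And>n. sq_int N (f n)" and F: "F \<in> borel_measurable N"
    and lim: "(\<lambda>n. \<integral>\<^sup>+x. ennreal ((f n x - F x)\<^sup>2) \<partial>N) \<longlonglongrightarrow> 0"
  shows "sq_int N F" "(\<lambda>n. \<integral>x. (f n x - F x)\<^sup>2 \<partial>N) \<longlonglongrightarrow> 0"
proof -
  have [measurable]: "f n \<in> borel_measurable N" for n using f by (simp add: sq_int_def)
  note F[measurable]
  have "\<forall>\<^sub>F n in sequentially. (\<integral>\<^sup>+x. ennreal ((f n x - F x)\<^sup>2) \<partial>N) < \<infinity>"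
    using lim by (rule order_tendstoD) simp
  then obtain n where "(\<integral>\<^sup>+x. ennreal ((f n x - F x)\<^sup>2) \<partial>N) < \<infinity>"
    by (auto simp: eventually_sequentially)
  then have "sq_int N (\<lambda>x. f n x - F x)" by (intro sq_intI_nn) auto
  then have "sq_int N (\<lambda>x. f n x - (f n x - F x))" by (rule sq_int_diff[OF f])
  then show F': "sq_int N F" by (simp add: sq_int_def)
  have "(\<integral>\<^sup>+x. ennreal ((f n x - F x)\<^sup>2) \<partial>N) = ennreal (\<integral>x. (f n x - F x)\<^sup>2 \<partial>N)" for n
    using sq_int_nn[OF sq_int_diff[OF f F']] .
  with lim have "(\<lambda>n. ennreal (\<integral>x. (f n x - F x)\<^sup>2 \<partial>N)) \<longlonglongrightarrow> ennreal 0" by simp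
  then show "(\<lambda>n. \<integral>x. (f n x - F x)\<^sup>2 \<partial>N) \<longlonglongrightarrow> 0"
    by (subst (asm) tendsto_ennreal_iff) auto
qed

section \<open>Ito integrals of simple processes\<close>

lemma space_gen [simp]: "space (gen M X I) = space M"
  by (simp add: gen_def space_measure_of_conv)

lemma measurable_gen:
  assumes "i \<in> I"
  shows "X i \<in> borel_measurable (gen M X I)"
proof (rule measurableI)
  fix A :: "real set" assume "A \<in> sets borel"
  then show "X i -` A \<inter> space (gen M X I) \<in> sets (gen M X I)"
    unfolding space_gen unfolding gen_def using assms by (intro in_measure_of) auto
qed simp

text \<open>Independence is assumed of sigma-algebras, whereas the product rule for expectations
  speaks of random variables.\<close>

lemma (in prob_space) indep_set_imp_indep_var:
  assumes "indep_set (sets A) (sets B)"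
    and sp: "space A = space M" "space B = space M"
    and X: "X \<in> borel_measurable A" and Y: "Y \<in> borel_measurable B"
  shows "indep_var borel X borel Y"
proof -
  have ev: "sets A \<subseteq> events" "sets B \<subseteq> events"
    and ind: "\<And>a b. a \<in> sets A \<Longrightarrow> b \<in> sets B \<Longrightarrow> prob (a \<inter> b) = prob a * prob b"
    using assms(1) unfolding indep_sets2_eq by auto
  have "sigma_sets (space M) {X -` S \<inter> space M | S. S \<in> sets borel} \<subseteq> sets A"
    unfolding sp(1)[symmetric] using X by (intro sets.sigma_sets_subset) (auto dest: measurable_sets)
  moreover have "sigma_sets (space M) {Y -` S \<inter> space M | S. S \<in> sets borel} \<subseteq> sets B"
    unfolding sp(2)[symmetric] using Y by (intro sets.sigma_sets_subset) (auto dest: measurable_sets)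
  moreover have "random_variable borel X" "random_variable borel Y"
    using X Y ev sp by (auto simp: measurable_def)
  ultimately show ?thesis
    unfolding indep_var_eq indep_sets2_eq using ev ind by blast
qed

text \<open>The filtration belongs to a run and not to the game, so this locale is instantiated anew
  for every trajectory. The final estimates must not mention \<open>G\<close>.\<close>

locale agent_system = prob_space M for M :: "'w measure" +
  fixes x0 :: "nat \<Rightarrow> 'w \<Rightarrow> real" and W :: "nat \<Rightarrow> 'w process" and N :: nat and G :: "real \<Rightarrow> 'w measure"
  assumes compatible: "compatible_filtration M x0 W N G"
    and brownian: "independent_brownian_motions M W"
begin

lemma space_G [simp]: "space (G t) = space M"
  using compatible by (auto simp: compatible_filtration_def subalgebra_def)

lemma G_mono:
  assumes "s \<le> t" "f \<in> borel_measurable (G s)"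
  shows "f \<in> borel_measurable (G t)"
  using compatible assms filtration.sets_F_mono[of "space M" G s t]
  by (auto simp: compatible_filtration_def measurable_def)

lemma G_measurable: "f \<in> borel_measurable (G s) \<Longrightarrow> f \<in> borel_measurable M"
  using compatible by (auto simp: compatible_filtration_def subalgebra_def measurable_def)

lemma W_adapted: "i \<in> {1..N} \<Longrightarrow> 0 \<le> t \<Longrightarrow> W i t \<in> borel_measurable (G t)"
  using compatible by (auto simp: compatible_filtration_def)

lemma W_measurable: "i \<in> {1..N} \<Longrightarrow> 0 \<le> t \<Longrightarrow> W i t \<in> borel_measurable M"
  by (rule G_measurable[OF W_adapted])

lemma increment_moments:
  assumes i: "i \<in> {1..N}" and st: "0 \<le> s" "s \<le> t"
  shows "sq_int M (\<lambda>\<omega>. W i t \<omega> - W i s \<omega>)"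
    and "(\<integral>\<omega>. W i t \<omega> - W i s \<omega> \<partial>M) = 0"
    and "(\<integral>\<omega>. (W i t \<omega> - W i s \<omega>)\<^sup>2 \<partial>M) = t - s"
proof -
  have m: "(\<lambda>\<omega>. W i t \<omega> - W i s \<omega>) \<in> borel_measurable M"
    using W_measurable[OF i] st by auto
  have "sq_int M (\<lambda>\<omega>. W i t \<omega> - W i s \<omega>) \<and> (\<integral>\<omega>. W i t \<omega> - W i s \<omega> \<partial>M) = 0
    \<and> (\<integral>\<omega>. (W i t \<omega> - W i s \<omega>)\<^sup>2 \<partial>M) = t - s"
  proof (cases "s = t")
    \<comment> \<open>The normal law has a density only for positive variance, hence the separate
      case of an empty interval.\<close>
    case True
    then show ?thesis by (simp add: sq_int_zero)
  next
    case False
    then have pos: "0 < sqrt (t - s)" using st by simp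
    have D: "distributed M lborel (\<lambda>\<omega>. W i t \<omega> - W i s \<omega>) (normal_density 0 (sqrt (t - s)))"
      using brownian i st False by (auto simp: independent_brownian_motions_def std_brownian_motion_def)
    have E: "(\<integral>\<omega>. W i t \<omega> - W i s \<omega> \<partial>M) = 0"
      by (rule normal_distributed_expectation[OF pos D])
    moreover have "(\<integral>\<omega>. (W i t \<omega> - W i s \<omega>)\<^sup>2 \<partial>M) = t - s"
      using normal_distributed_variance[OF pos D] E st by simp
    moreover have "integrable lborel (\<lambda>x. normal_density 0 (sqrt (t - s)) x * x\<^sup>2)"
      using integrable_normal_moment[OF pos, of 0 2] by simp
    then have "integrable M (\<lambda>\<omega>. (W i t \<omega> - W i s \<omega>)\<^sup>2)"
      by (subst (asm) distributed_integrable[OF D]) (auto simp: normal_density_nonneg)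
    ultimately show ?thesis using m by (simp add: sq_int_def)
  qed
  then show "sq_int M (\<lambda>\<omega>. W i t \<omega> - W i s \<omega>)"
    and "(\<integral>\<omega>. W i t \<omega> - W i s \<omega> \<partial>M) = 0"
    and "(\<integral>\<omega>. (W i t \<omega> - W i s \<omega>)\<^sup>2 \<partial>M) = t - s" by auto
qed

abbreviation future :: "real \<Rightarrow> 'w measure" where
  "future s \<equiv> gen M (\<lambda>(i, t) \<omega>. W i t \<omega> - W i s \<omega>) ({1..N} \<times> {s..})"

lemma future_measurable:
  assumes "i \<in> {1..N}" "s \<le> t"
  shows "(\<lambda>\<omega>. W i t \<omega> - W i s \<omega>) \<in> borel_measurable (future s)"
  using measurable_gen[of "(i, t)" "{1..N} \<times> {s..}" "\<lambda>(i, t) \<omega>. W i t \<omega> - W i s \<omega>" M] assms by simp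

lemma future_product:
  fixes \<zeta> Y :: "'w \<Rightarrow> real"
  assumes s: "0 \<le> s" and z: "\<zeta> \<in> borel_measurable (G s)" "integrable M \<zeta>"
    and Y: "Y \<in> borel_measurable (future s)" "integrable M Y"
  shows "integrable M (\<lambda>\<omega>. \<zeta> \<omega> * Y \<omega>)"
    and "(\<integral>\<omega>. \<zeta> \<omega> * Y \<omega> \<partial>M) = (\<integral>\<omega>. \<zeta> \<omega> \<partial>M) * (\<integral>\<omega>. Y \<omega> \<partial>M)"
proof -
  have "indep_set (sets (G s)) (sets (future s))"
    using compatible s by (auto simp: compatible_filtration_def)
  then have "indep_var borel \<zeta> borel Y"
    by (rule indep_set_imp_indep_var) (use z Y in auto)
  then show "integrable M (\<lambda>\<omega>. \<zeta> \<omega> * Y \<omega>)"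
    and "(\<integral>\<omega>. \<zeta> \<omega> * Y \<omega> \<partial>M) = (\<integral>\<omega>. \<zeta> \<omega> \<partial>M) * (\<integral>\<omega>. Y \<omega> \<partial>M)"
    using indep_var_integrable[of \<zeta> Y] indep_var_lebesgue_integral[of \<zeta> Y] z Y by auto
qed

lemma increment_orthogonal:
  assumes i: "i \<in> {1..N}" and st: "0 \<le> s" "s \<le> t" and z: "\<zeta> \<in> borel_measurable (G s)" "integrable M \<zeta>"
  shows "(\<integral>\<omega>. \<zeta> \<omega> * (W i t \<omega> - W i s \<omega>) \<partial>M) = 0"
  using future_product(2)[OF st(1) z future_measurable[OF i st(2)]] increment_moments[OF i st]
  by (simp add: sq_int_integrable)

text \<open>The coefficient factors out because increments after \<open>s\<close> are independent of
  \<open>G s\<close>. For one Brownian motion the longer increment is split where the shorter one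
  ends, and the surplus is orthogonal to the shorter one. For two, the mean is a product of two zero
  means.\<close>

lemma increment_product:
  assumes i: "i \<in> {1..N}" and j: "j \<in> {1..N}" and t: "0 \<le> s" "s \<le> b" "s \<le> d"
    and z: "\<zeta> \<in> borel_measurable (G s)" "integrable M \<zeta>"
  shows "integrable M (\<lambda>\<omega>. \<zeta> \<omega> * ((W i b \<omega> - W i s \<omega>) * (W j d \<omega> - W j s \<omega>)))"
    and "(\<integral>\<omega>. \<zeta> \<omega> * ((W i b \<omega> - W i s \<omega>) * (W j d \<omega> - W j s \<omega>)) \<partial>M) =
      (if i = j then (\<integral>\<omega>. \<zeta> \<omega> \<partial>M) * (min b d - s) else 0)"
proof -
  have I: "integrable M (\<lambda>\<omega>. (W i b \<omega> - W i s \<omega>) * (W j d \<omega> - W j s \<omega>))"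
    by (rule sq_int_mult[OF increment_moments(1)[OF i] increment_moments(1)[OF j]]) (use t in auto)
  have m: "(\<lambda>\<omega>. (W i b \<omega> - W i s \<omega>) * (W j d \<omega> - W j s \<omega>)) \<in> borel_measurable (future s)"
    using future_measurable[OF i t(2)] future_measurable[OF j t(3)] by simp
  have same: "(\<integral>\<omega>. (W i b \<omega> - W i s \<omega>) * (W i d \<omega> - W i s \<omega>) \<partial>M) = b - s"
    if "s \<le> b" "b \<le> d" for b d
  proof -
    have b: "sq_int M (\<lambda>\<omega>. W i b \<omega> - W i s \<omega>)" and d: "sq_int M (\<lambda>\<omega>. W i d \<omega> - W i b \<omega>)"
      using increment_moments(1)[OF i] t that by auto
    have "(\<lambda>\<omega>. W i b \<omega> - W i s \<omega>) \<in> borel_measurable (G b)"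
      using W_adapted[OF i, of b] G_mono[OF _ W_adapted[OF i, of s], of b] t that by auto
    then have o: "(\<integral>\<omega>. (W i b \<omega> - W i s \<omega>) * (W i d \<omega> - W i b \<omega>) \<partial>M) = 0"
      using increment_orthogonal[OF i _ \<open>b \<le> d\<close>] sq_int_integrable[OF b] t that by auto
    have "(\<integral>\<omega>. (W i b \<omega> - W i s \<omega>) * (W i d \<omega> - W i s \<omega>) \<partial>M) =
      (\<integral>\<omega>. (W i b \<omega> - W i s \<omega>)\<^sup>2 + (W i b \<omega> - W i s \<omega>) * (W i d \<omega> - W i b \<omega>) \<partial>M)"
      by (intro Lint_cong) (auto simp: power2_eq_square algebra_simps)
    also have "\<dots> = b - s"
      using sq_int_power2[OF b] sq_int_mult[OF b d] o increment_moments(3)[OF i, of s b] t that by simp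
    finally show ?thesis .
  qed
  have E: "(\<integral>\<omega>. (W i b \<omega> - W i s \<omega>) * (W j d \<omega> - W j s \<omega>) \<partial>M) = (if i = j then min b d - s else 0)"
  proof (cases "i = j")
    case True
    then show ?thesis
      using same[of b d] same[of d b] t by (cases "b \<le> d") (auto simp: min_def mult.commute)
  next
    case False
    have "indep_sets (\<lambda>i. sets (gen M (W i) {0..})) {1..}"
      using brownian by (simp add: independent_brownian_motions_def)
    then have ind: "prob (\<Inter>k\<in>{i, j}. A k) = (\<Prod>k\<in>{i, j}. prob (A k))"
      if "\<forall>k\<in>{i, j}. A k \<in> sets (gen M (W k) {0..})" for A
      by (rule indep_setsD) (use i j that in auto)
    have inc: "(\<lambda>\<omega>. W k u \<omega> - W k s \<omega>) \<in> borel_measurable (gen M (W k) {0..})" if "s \<le> u" for k u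
      using measurable_gen[of u "{0..}" "W k" M] measurable_gen[of s "{0..}" "W k" M] t that by auto
    have "indep_set (sets (gen M (W i) {0..})) (sets (gen M (W j) {0..}))"
      unfolding indep_sets2_eq
    proof (intro conjI ballI)
      show "sets (gen M (W i) {0..}) \<subseteq> events" "sets (gen M (W j) {0..}) \<subseteq> events"
        using \<open>indep_sets _ _\<close> i j unfolding indep_sets_def by auto
      fix a b assume "a \<in> sets (gen M (W i) {0..})" "b \<in> sets (gen M (W j) {0..})"
      then show "prob (a \<inter> b) = prob a * prob b"
        using ind[of "\<lambda>k. if k = i then a else b"] False by (simp add: Int_commute)
    qed
    then have "indep_var borel (\<lambda>\<omega>. W i b \<omega> - W i s \<omega>) borel (\<lambda>\<omega>. W j d \<omega> - W j s \<omega>)"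
      by (rule indep_set_imp_indep_var) (use inc t in auto)
    then show ?thesis
      using increment_moments[OF i t(1,2)] increment_moments[OF j t(1,3)] False
      by (simp add: indep_var_lebesgue_integral sq_int_integrable)
  qed
  show "integrable M (\<lambda>\<omega>. \<zeta> \<omega> * ((W i b \<omega> - W i s \<omega>) * (W j d \<omega> - W j s \<omega>)))"
    by (rule future_product(1)[OF t(1) z m I])
  show "(\<integral>\<omega>. \<zeta> \<omega> * ((W i b \<omega> - W i s \<omega>) * (W j d \<omega> - W j s \<omega>)) \<partial>M) =
      (if i = j then (\<integral>\<omega>. \<zeta> \<omega> \<partial>M) * (min b d - s) else 0)"
    unfolding future_product(2)[OF t(1) z m I] E by simp
qed

text \<open>The requirement that \<open>nonanticipating\<close> makes of a single coefficient.
  Boundedness keeps products with square-integrable increments square integrable.\<close>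

definition bounded_at :: "real \<Rightarrow> ('w \<Rightarrow> real) \<Rightarrow> bool" where
  "bounded_at a \<xi> \<longleftrightarrow> \<xi> \<in> borel_measurable (G a) \<and> (\<exists>B. \<forall>\<omega>\<in>space M. \<bar>\<xi> \<omega>\<bar> \<le> B)"

lemma bounded_at_sq_int_mult:
  assumes "bounded_at a \<xi>" "sq_int M f"
  shows "sq_int M (\<lambda>\<omega>. \<xi> \<omega> * f \<omega>)"
  using assms G_measurable sq_int_bounded_mult[of M f \<xi>] by (auto simp: bounded_at_def)

lemma bounded_at_sq_int: "bounded_at a \<xi> \<Longrightarrow> sq_int M \<xi>"
  using bounded_at_sq_int_mult[OF _ sq_int_const, of a \<xi> 1] by simp

text \<open>The first increment is cut at \<open>c\<close>. Its part before \<open>c\<close> is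
  known at time \<open>c\<close> and thus orthogonal to the second increment; only the overlap
  contributes, and \<open>max 0 (min b d - c)\<close> is its length.\<close>

lemma block_product_ordered:
  assumes i: "i \<in> {1..N}" and j: "j \<in> {1..N}" and t: "0 \<le> a" "a \<le> b" "a \<le> c" "c \<le> d"
    and xi: "bounded_at a \<xi>" and eta: "bounded_at c \<eta>"
  shows "(\<integral>\<omega>. (\<xi> \<omega> * (W i b \<omega> - W i a \<omega>)) * (\<eta> \<omega> * (W j d \<omega> - W j c \<omega>)) \<partial>M) =
      (if i = j then (\<integral>\<omega>. \<xi> \<omega> * \<eta> \<omega> \<partial>M) * max 0 (min b d - c) else 0)"
proof -
  note [simp] = sq_int_integrable
  have inc: "sq_int M (\<lambda>\<omega>. W i v \<omega> - W i u \<omega>)" if "a \<le> u" "u \<le> v" for u v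
    using increment_moments(1)[OF i] t that by auto
  have xim: "\<xi> \<in> borel_measurable (G u)" if "a \<le> u" for u
    using xi that G_mono by (auto simp: bounded_at_def)
  have etam: "\<eta> \<in> borel_measurable (G c)"
    using eta by (auto simp: bounded_at_def)
  have zero: "(\<integral>\<omega>. (\<xi> \<omega> * (W i b \<omega> - W i a \<omega>)) * \<eta> \<omega> * (W j d \<omega> - W j c \<omega>) \<partial>M) = 0"
    if "b \<le> c" "a \<le> b" for b
  proof (rule increment_orthogonal[OF j])
    have "(\<lambda>\<omega>. W i b \<omega> - W i a \<omega>) \<in> borel_measurable (G c)"
      using G_mono[OF _ W_adapted[OF i, of b], of c] G_mono[OF _ W_adapted[OF i, of a], of c] t that by auto
    then show "(\<lambda>\<omega>. \<xi> \<omega> * (W i b \<omega> - W i a \<omega>) * \<eta> \<omega>) \<in> borel_measurable (G c)"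
      using xim[of c] etam t by auto
    show "integrable M (\<lambda>\<omega>. \<xi> \<omega> * (W i b \<omega> - W i a \<omega>) * \<eta> \<omega>)"
      using bounded_at_sq_int_mult[OF eta bounded_at_sq_int_mult[OF xi inc[of a b]]] that
      by (simp add: mult.commute)
  qed (use t in auto)
  show ?thesis
  proof (cases "b \<le> c")
    case True
    then show ?thesis using zero[of b] t by (simp add: mult.assoc)
  next
    case False
    have x1: "sq_int M (\<lambda>\<omega>. \<xi> \<omega> * (W i c \<omega> - W i a \<omega>))" "sq_int M (\<lambda>\<omega>. \<xi> \<omega> * (W i b \<omega> - W i c \<omega>))"
      using bounded_at_sq_int_mult[OF xi inc] t False by auto
    have x2: "sq_int M (\<lambda>\<omega>. \<eta> \<omega> * (W j d \<omega> - W j c \<omega>))"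
      using bounded_at_sq_int_mult[OF eta increment_moments(1)[OF j]] t by auto
    have z: "(\<lambda>\<omega>. \<xi> \<omega> * \<eta> \<omega>) \<in> borel_measurable (G c)" "integrable M (\<lambda>\<omega>. \<xi> \<omega> * \<eta> \<omega>)"
      using xim[of c] etam t sq_int_mult[OF bounded_at_sq_int[OF xi] bounded_at_sq_int[OF eta]] by auto
    have "(\<integral>\<omega>. (\<xi> \<omega> * (W i b \<omega> - W i a \<omega>)) * (\<eta> \<omega> * (W j d \<omega> - W j c \<omega>)) \<partial>M) =
      (\<integral>\<omega>. (\<xi> \<omega> * (W i c \<omega> - W i a \<omega>)) * (\<eta> \<omega> * (W j d \<omega> - W j c \<omega>))
        + (\<xi> \<omega> * (W i b \<omega> - W i c \<omega>)) * (\<eta> \<omega> * (W j d \<omega> - W j c \<omega>)) \<partial>M)"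
      by (intro Lint_cong) (auto simp: algebra_simps)
    also have "\<dots> = (\<integral>\<omega>. (\<xi> \<omega> * (W i c \<omega> - W i a \<omega>)) * \<eta> \<omega> * (W j d \<omega> - W j c \<omega>) \<partial>M)
      + (\<integral>\<omega>. \<xi> \<omega> * \<eta> \<omega> * ((W i b \<omega> - W i c \<omega>) * (W j d \<omega> - W j c \<omega>)) \<partial>M)"
      using Lint_add[OF sq_int_mult[OF x1(1) x2] sq_int_mult[OF x1(2) x2]]
      by (simp add: mult_ac)
    also have "\<dots> = (if i = j then (\<integral>\<omega>. \<xi> \<omega> * \<eta> \<omega> \<partial>M) * (min b d - c) else 0)"
      using zero[of c] increment_product(2)[OF i j _ _ \<open>c \<le> d\<close> z, of b] t False by simp
    finally show ?thesis using False t by simp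
  qed
qed

text \<open>The overlap is expressed as a Lebesgue measure because the time integral of a product of
  two simple integrands produces exactly this number.\<close>

lemma block_product:
  assumes i: "i \<in> {1..N}" and j: "j \<in> {1..N}" and t: "0 \<le> a" "a \<le> b" "0 \<le> c" "c \<le> d" and T: "0 \<le> T"
    and xi: "bounded_at a \<xi>" and eta: "bounded_at c \<eta>"
  shows "(\<integral>\<omega>. (\<xi> \<omega> * (W i (min T b) \<omega> - W i (min T a) \<omega>)) * (\<eta> \<omega> * (W j (min T d) \<omega> - W j (min T c) \<omega>)) \<partial>M) =
      (if i = j then (\<integral>\<omega>. \<xi> \<omega> * \<eta> \<omega> \<partial>M) * measure lborel ({0..T} \<inter> {a<..b} \<inter> {c<..d}) else 0)"
proof -
  have meas: "measure lborel ({0..T} \<inter> {a<..b} \<inter> {c<..d}) = max 0 (min T (min b d) - max a c)"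
  proof -
    have "{0..T} \<inter> {a<..b} \<inter> {c<..d} = {max a c <.. min T (min b d)}" using t by auto
    then show ?thesis by (cases "max a c \<le> min T (min b d)") (auto simp: max_def)
  qed
  \<comment> \<open>A block that starts at or after \<open>T\<close> is truncated to a zero
    increment, and its intersection with \<open>{0..T}\<close> has measure zero. Otherwise the
    symmetry between the blocks lets the earlier one come first.\<close>
  consider "T \<le> a" | "T \<le> c" | "a < T" "c < T" by linarith
  then show ?thesis
  proof cases
    case 1
    then show ?thesis using t unfolding meas by (auto simp: min_def max_def)
  next
    case 2
    then show ?thesis using t unfolding meas by (auto simp: min_def max_def)
  next
    case 3
    show ?thesis
    proof (cases "a \<le> c")
      case True
      show ?thesis
        using block_product_ordered[OF i j t(1) _ True _ xi eta, of "min T b" "min T d"] t T 3 True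
        unfolding meas by (auto simp: min_def max_def)
    next
      case False
      show ?thesis
        using block_product_ordered[OF j i t(3) _ _ _ eta xi, of "min T d" "min T b"] t T 3 False
        unfolding meas by (auto simp: min_def max_def mult.commute)
    qed
  qed
qed

end

section \<open>Time measures and the Ito isometry\<close>

text \<open>One encoding serves both time axes, Lebesgue measure on \<open>{0..T}\<close> and the
  discounted half line. The sigma-algebra stays that of the whole line, so measurability does not
  depend on the horizon.\<close>

definition weighted :: "(real \<Rightarrow> real) \<Rightarrow> real measure" where
  "weighted w = density lborel (\<lambda>t. ennreal (w t))"

abbreviation horizon :: "real \<Rightarrow> real measure" where
  "horizon T \<equiv> weighted (indicator {0..T})"

abbreviation (in prob_space) on_horizon :: "real \<Rightarrow> (real \<times> 'a) measure" where
  "on_horizon T \<equiv> horizon T \<Otimes>\<^sub>M M"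

lemma space_weighted [simp]: "space (weighted w) = UNIV"
  by (simp add: weighted_def)

lemma sets_weighted [simp, measurable_cong]: "sets (weighted w) = sets borel"
  by (simp add: weighted_def)

lemma measurable_weighted [simp]: "borel_measurable (weighted w) = borel_measurable borel"
  by (rule measurable_cong_sets) auto

lemma measurable_weighted_pair [simp]:
  "borel_measurable (weighted w \<Otimes>\<^sub>M M) = borel_measurable (borel \<Otimes>\<^sub>M M)"
  by (rule measurable_cong_sets) (auto intro: sets_pair_measure_cong)

lemma nn_integral_weighted:
  assumes "w \<in> borel_measurable borel" "f \<in> borel_measurable borel"
  shows "(\<integral>\<^sup>+t. f t \<partial>weighted w) = (\<integral>\<^sup>+t. ennreal (w t) * f t \<partial>lborel)"
  unfolding weighted_def using assms by (intro nn_integral_density) auto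

lemma integral_weighted:
  fixes f :: "real \<Rightarrow> real"
  assumes "w \<in> borel_measurable borel" "\<And>t. 0 \<le> w t" "f \<in> borel_measurable borel"
  shows "(\<integral>t. f t \<partial>weighted w) = (\<integral>t. w t * f t \<partial>lborel)"
  unfolding weighted_def using assms by (subst integral_density) auto

lemma integrable_weighted:
  fixes f :: "real \<Rightarrow> real"
  assumes "w \<in> borel_measurable borel" "\<And>t. 0 \<le> w t" "f \<in> borel_measurable borel"
  shows "integrable (weighted w) f \<longleftrightarrow> integrable lborel (\<lambda>t. w t * f t)"
  unfolding weighted_def using assms by (subst integrable_density) auto

lemma finite_measure_weighted:
  assumes "\<And>t. 0 \<le> w t" "integrable lborel w"
  shows "finite_measure (weighted w)"
proof
  have "emeasure (weighted w) (space (weighted w)) = (\<integral>\<^sup>+t. ennreal (w t) \<partial>lborel)"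
    unfolding weighted_def using assms by (subst emeasure_density) auto
  also have "\<dots> < \<infinity>" using assms by (subst nn_integral_eq_integral) auto
  finally show "emeasure (weighted w) (space (weighted w)) \<noteq> \<infinity>" by simp
qed

lemma finite_measure_horizon: "finite_measure (horizon T)"
  by (rule finite_measure_weighted) (auto intro!: integrable_real_indicator emeasure_bounded_finite)

lemma (in prob_space) finite_measure_weighted_pair:
  "finite_measure (weighted w) \<Longrightarrow> finite_measure (weighted w \<Otimes>\<^sub>M M)"
  by (intro finite_measure_pair_measure finite_measure_axioms)

lemma (in prob_space) pair_sigma_finite_weighted:
  "finite_measure (weighted w) \<Longrightarrow> pair_sigma_finite (weighted w) M"
  by (intro pair_sigma_finite.intro finite_measure.axioms sigma_finite_measure_axioms)
     (auto simp: finite_measure_def)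

section \<open>Isometry and martingale property for simple integrands\<close>

context agent_system
begin

lemma nonanticipating_block:
  assumes "nonanticipating G n \<tau> \<xi>"
  shows "0 \<le> \<tau> k" "\<tau> k \<le> \<tau> (Suc k)" "k < n \<Longrightarrow> bounded_at (\<tau> k) (\<xi> k)"
proof -
  have "0 \<le> \<tau> 0" "mono \<tau>" using assms by (auto simp: nonanticipating_def)
  then show "0 \<le> \<tau> k" "\<tau> k \<le> \<tau> (Suc k)"
    using monoD[of \<tau> 0 k] monoD[of \<tau> k "Suc k"] by auto
  show "k < n \<Longrightarrow> bounded_at (\<tau> k) (\<xi> k)"
    using assms by (auto simp: nonanticipating_def bounded_at_def)
qed

lemma block_increment_sq:
  assumes "i \<in> {1..N}" "0 \<le> T" "0 \<le> a" "a \<le> b" "bounded_at a \<xi>"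
  shows "sq_int M (\<lambda>\<omega>. \<xi> \<omega> * (W i (min T b) \<omega> - W i (min T a) \<omega>))"
  using assms by (intro bounded_at_sq_int_mult[OF assms(5)] increment_moments) auto

lemma simple_ito_sq:
  assumes "nonanticipating G n \<tau> \<xi>" "i \<in> {1..N}" "0 \<le> T"
  shows "sq_int M (simple_ito_integral (W i) T n \<tau> \<xi>)"
  unfolding simple_ito_integral_def[abs_def]
  using nonanticipating_block[OF assms(1)] assms(2,3) by (intro sq_int_sum block_increment_sq) auto

lemma block_sq:
  assumes "bounded_at a \<xi>"
  shows "sq_int (on_horizon T) (\<lambda>(t, \<omega>). \<xi> \<omega> * indicator {c<..d} t)"
proof -
  have [measurable]: "\<xi> \<in> borel_measurable M" using assms G_measurable by (auto simp: bounded_at_def)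
  obtain B where B: "\<And>\<omega>. \<omega> \<in> space M \<Longrightarrow> \<bar>\<xi> \<omega>\<bar> \<le> B" using assms by (auto simp: bounded_at_def)
  interpret F: finite_measure "horizon T \<Otimes>\<^sub>M M"
    by (intro finite_measure_weighted_pair finite_measure_horizon)
  have "sq_int (on_horizon T) (\<lambda>z. (case z of (t, \<omega>) \<Rightarrow> \<xi> \<omega> * indicator {c<..d} t) * 1)"
  proof (rule sq_int_bounded_mult[OF F.sq_int_const])
    show "\<bar>case z of (t, \<omega>) \<Rightarrow> \<xi> \<omega> * indicator {c<..d} t\<bar> \<le> max B 0"
      if "z \<in> space (on_horizon T)" for z
      using B[of "snd z"] that by (auto simp: space_pair_measure indicator_def split: prod.split)
  qed simp
  then show ?thesis by simp
qed

lemma simple_process_sq: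
  assumes "nonanticipating G n \<tau> \<xi>"
  shows "sq_int (on_horizon T) (\<lambda>(t, \<omega>). simple_process n \<tau> \<xi> t \<omega>)"
  unfolding simple_process_def case_prod_beta
  by (rule sq_int_sum)
     (use block_sq[OF nonanticipating_block(3)[OF assms], unfolded case_prod_beta] in auto)

text \<open>Both sides are bilinear in the two simple processes, so it suffices to compare single
  blocks, where \<open>block_product\<close> meets Fubini. The polarised form with two indices also
  yields the orthogonality of different noises.\<close>

lemma simple_isometry:
  assumes a: "nonanticipating G n \<tau> \<xi>" "nonanticipating G n' \<tau>' \<eta>"
    and i: "i \<in> {1..N}" "j \<in> {1..N}" and T: "0 \<le> T"
  shows "(\<integral>\<omega>. simple_ito_integral (W i) T n \<tau> \<xi> \<omega> * simple_ito_integral (W j) T n' \<tau>' \<eta> \<omega> \<partial>M) =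
    (if i = j then \<integral>z. case_prod (simple_process n \<tau> \<xi>) z *
      case_prod (simple_process n' \<tau>' \<eta>) z \<partial>on_horizon T else 0)"
proof -
  note b = nonanticipating_block[OF a(1)] and b' = nonanticipating_block[OF a(2)]
  interpret P: pair_sigma_finite "horizon T" M
    by (intro pair_sigma_finite_weighted finite_measure_horizon)
  define A where "A k \<omega> = \<xi> k \<omega> * (W i (min T (\<tau> (Suc k))) \<omega> - W i (min T (\<tau> k)) \<omega>)" for k \<omega>
  define B where "B k \<omega> = \<eta> k \<omega> * (W j (min T (\<tau>' (Suc k))) \<omega> - W j (min T (\<tau>' k)) \<omega>)" for k \<omega>
  define C where "C k = (\<lambda>(t, \<omega>). \<xi> k \<omega> * indicator {\<tau> k<..\<tau> (Suc k)} t :: real)" for k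
  define D where "D k = (\<lambda>(t, \<omega>). \<eta> k \<omega> * indicator {\<tau>' k<..\<tau>' (Suc k)} t :: real)" for k
  have sq: "sq_int M (A k)" "sq_int (on_horizon T) (C k)" if "k < n" for k
    using block_increment_sq[OF i(1) T b(1,2) b(3)[OF that]] block_sq[OF b(3)[OF that]] by (auto simp: A_def[abs_def] C_def)
  have sq': "sq_int M (B k)" "sq_int (on_horizon T) (D k)" if "k < n'" for k
    using block_increment_sq[OF i(2) T b'(1,2) b'(3)[OF that]] block_sq[OF b'(3)[OF that]] by (auto simp: B_def[abs_def] D_def)
  have CD: "(\<integral>z. C k z * D l z \<partial>on_horizon T) =
      (\<integral>\<omega>. \<xi> k \<omega> * \<eta> l \<omega> \<partial>M) * measure lborel ({0..T} \<inter> {\<tau> k<..\<tau> (Suc k)} \<inter> {\<tau>' l<..\<tau>' (Suc l)})"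
    if kl: "k < n" "l < n'" for k l
  proof -
    let ?I = "{0..T} \<inter> {\<tau> k<..\<tau> (Suc k)} \<inter> {\<tau>' l<..\<tau>' (Suc l)}"
    have inner: "(\<integral>t. C k (t, \<omega>) * D l (t, \<omega>) \<partial>horizon T) = \<xi> k \<omega> * \<eta> l \<omega> * measure lborel ?I" for \<omega>
    proof -
      have "(\<integral>t. C k (t, \<omega>) * D l (t, \<omega>) \<partial>horizon T) =
        (\<integral>t. indicator {0..T} t * (C k (t, \<omega>) * D l (t, \<omega>)) \<partial>lborel)"
        by (rule integral_weighted) (auto simp: C_def D_def)
      also have "\<dots> = (\<integral>t. \<xi> k \<omega> * \<eta> l \<omega> * indicator ?I t \<partial>lborel)"
        by (intro Lint_cong) (auto simp: C_def D_def indicator_def)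
      also have "\<dots> = \<xi> k \<omega> * \<eta> l \<omega> * measure lborel ?I"
        by simp
      finally show ?thesis .
    qed
    have "integrable (on_horizon T) (\<lambda>(t, \<omega>). C k (t, \<omega>) * D l (t, \<omega>))"
      using sq_int_mult[OF sq(2)[OF kl(1)] sq'(2)[OF kl(2)]] unfolding case_prod_beta prod.collapse .
    from P.integral_snd[OF this, unfolded case_prod_beta' prod.collapse]
    have "(\<integral>z. C k z * D l z \<partial>on_horizon T) =
      (\<integral>\<omega>. (\<integral>t. C k (t, \<omega>) * D l (t, \<omega>) \<partial>horizon T) \<partial>M)"
      by simp
    then show ?thesis by (simp add: inner)
  qed
  have AB: "(\<integral>\<omega>. A k \<omega> * B l \<omega> \<partial>M) = (if i = j then \<integral>z. C k z * D l z \<partial>on_horizon T else 0)"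
    if kl: "k < n" "l < n'" for k l
    unfolding CD[OF kl] A_def B_def
    by (rule block_product) (use i T b b' kl in auto)
  have "(\<integral>\<omega>. (\<Sum>k<n. A k \<omega>) * (\<Sum>l<n'. B l \<omega>) \<partial>M) = (\<Sum>k<n. \<Sum>l<n'. \<integral>\<omega>. A k \<omega> * B l \<omega> \<partial>M)"
    using sq sq' unfolding sum_product
    by (subst Lint_sum) (auto intro!: sum.cong Lint_sum sq_int_mult)
  also have "\<dots> = (if i = j then \<Sum>k<n. \<Sum>l<n'. \<integral>z. C k z * D l z \<partial>on_horizon T else 0)"
    using AB by auto
  also have "(\<Sum>k<n. \<Sum>l<n'. \<integral>z. C k z * D l z \<partial>on_horizon T) =
      (\<integral>z. (\<Sum>k<n. C k z) * (\<Sum>l<n'. D l z) \<partial>on_horizon T)"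
    using sq sq' unfolding sum_product
    by (subst Lint_sum)
       (auto intro!: sum.cong Lint_sum[symmetric] sq_int_mult)
  finally show ?thesis
    by (simp add: simple_ito_integral_def simple_process_def A_def B_def C_def D_def case_prod_beta)
qed

lemma simple_isometry_diff:
  assumes a: "nonanticipating G n \<tau> \<xi>" "nonanticipating G n' \<tau>' \<eta>" and i: "i \<in> {1..N}" and T: "0 \<le> T"
  shows "(\<integral>\<omega>. (simple_ito_integral (W i) T n \<tau> \<xi> \<omega> - simple_ito_integral (W i) T n' \<tau>' \<eta> \<omega>)\<^sup>2 \<partial>M) =
    (\<integral>z. (case_prod (simple_process n \<tau> \<xi>) z -
      case_prod (simple_process n' \<tau>' \<eta>) z)\<^sup>2 \<partial>on_horizon T)"
  using simple_isometry[OF a i i T] simple_isometry[OF a(1) a(1) i i T] simple_isometry[OF a(2) a(2) i i T]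
    integral_sq_add[OF simple_ito_sq[OF a(1) i T] simple_ito_sq[OF a(2) i T], of 1 "-1"]
    integral_sq_add[OF simple_process_sq[OF a(1), of T] simple_process_sq[OF a(2), of T], of 1 "-1"]
  by (simp add: power2_eq_square)

lemma simple_martingale:
  assumes a: "nonanticipating G n \<tau> \<xi>" and i: "i \<in> {1..N}" and st: "0 \<le> s" "s \<le> t"
    and h: "\<eta> \<in> borel_measurable (G s)" "sq_int M \<eta>"
  shows "(\<integral>\<omega>. \<eta> \<omega> * (simple_ito_integral (W i) t n \<tau> \<xi> \<omega> - simple_ito_integral (W i) s n \<tau> \<xi> \<omega>) \<partial>M) = 0"
proof -
  note b = nonanticipating_block[OF a]
  define A where "A k \<omega> = \<xi> k \<omega> * (W i (min t (\<tau> (Suc k))) \<omega> - W i (min t (\<tau> k)) \<omega>)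
    - \<xi> k \<omega> * (W i (min s (\<tau> (Suc k))) \<omega> - W i (min s (\<tau> k)) \<omega>)" for k \<omega>
  have sq: "sq_int M (A k)" if "k < n" for k
    unfolding A_def[abs_def] using block_increment_sq[OF i _ b(1,2) b(3)[OF that]] st by (intro sq_int_diff) auto
  have zero: "(\<integral>\<omega>. \<eta> \<omega> * A k \<omega> \<partial>M) = 0" if k: "k < n" for k
  proof -
    \<comment> \<open>\<open>{c<..d}\<close> is the part of block \<open>k\<close> inside
      \<open>{s<..t}\<close>. The outer \<open>max c\<close> in \<open>d\<close> collapses it to a
      point when the block misses the window.\<close>
    define c where "c = max s (\<tau> k)"
    define d where "d = max c (min t (\<tau> (Suc k)))"
    have A: "A k \<omega> = \<xi> k \<omega> * (W i d \<omega> - W i c \<omega>)" for \<omega>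
      using st b(1,2)[of k] by (auto simp: A_def c_def d_def min_def max_def algebra_simps)
    have "(\<integral>\<omega>. (\<eta> \<omega> * \<xi> k \<omega>) * (W i d \<omega> - W i c \<omega>) \<partial>M) = 0"
    proof (rule increment_orthogonal[OF i])
      show "0 \<le> c" "c \<le> d" using st by (auto simp: c_def d_def)
      have "\<eta> \<in> borel_measurable (G c)"
        by (rule G_mono[of s, OF _ h(1)]) (simp add: c_def)
      moreover have "\<xi> k \<in> borel_measurable (G c)"
        by (rule G_mono[of "\<tau> k"]) (use b(3)[OF k] in \<open>simp_all add: c_def bounded_at_def\<close>)
      ultimately show "(\<lambda>\<omega>. \<eta> \<omega> * \<xi> k \<omega>) \<in> borel_measurable (G c)" by simp
      show "integrable M (\<lambda>\<omega>. \<eta> \<omega> * \<xi> k \<omega>)"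
        using sq_int_mult[OF h(2) bounded_at_sq_int[OF b(3)[OF k]]] .
    qed
    then show ?thesis by (simp add: A mult.assoc)
  qed
  have "(\<integral>\<omega>. \<eta> \<omega> * (\<Sum>k<n. A k \<omega>) \<partial>M) = (\<Sum>k<n. \<integral>\<omega>. \<eta> \<omega> * A k \<omega> \<partial>M)"
    unfolding sum_distrib_left using sq h by (intro Lint_sum) (auto intro: sq_int_mult)
  then show ?thesis
    using zero by (simp add: A_def simple_ito_integral_def sum_subtractf)
qed

text \<open>Turns the iterated extended integrals of \<open>has_ito_integral\<close> into
  convergence in L2 of \<open>on_horizon T\<close> and of \<open>M\<close>. Integrand and integral
  are then square integrable as limits of square-integrable functions.\<close>

lemma ito_approximation:
  assumes I: "has_ito_integral M G (W i) T u I" and i: "i \<in> {1..N}" and T: "0 \<le> T"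
    and u: "(\<lambda>(t, \<omega>). u t \<omega>) \<in> borel_measurable (borel \<Otimes>\<^sub>M M)"
  obtains n \<tau> \<xi> where "\<And>m. nonanticipating G (n m) (\<tau> m) (\<xi> m)"
    "sq_int (on_horizon T) (\<lambda>(t, \<omega>). u t \<omega>)" "sq_int M I"
    "(\<lambda>m. \<integral>z. (case_prod (simple_process (n m) (\<tau> m) (\<xi> m)) z -
      (case z of (t, \<omega>) \<Rightarrow> u t \<omega>))\<^sup>2 \<partial>on_horizon T) \<longlonglongrightarrow> 0"
    "(\<lambda>m. \<integral>\<omega>. (simple_ito_integral (W i) T (n m) (\<tau> m) (\<xi> m) \<omega> - I \<omega>)\<^sup>2 \<partial>M) \<longlonglongrightarrow> 0"
proof -
  obtain n \<tau> \<xi> where na: "\<And>m. nonanticipating G (n m) (\<tau> m) (\<xi> m)"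
    and l1: "(\<lambda>m. \<integral>\<^sup>+\<omega>. (\<integral>\<^sup>+t\<in>{0..T}. ennreal ((simple_process (n m) (\<tau> m) (\<xi> m) t \<omega> - u t \<omega>)\<^sup>2) \<partial>lborel) \<partial>M)
          \<longlonglongrightarrow> 0"
    and l2: "(\<lambda>m. \<integral>\<^sup>+\<omega>. ennreal ((simple_ito_integral (W i) T (n m) (\<tau> m) (\<xi> m) \<omega> - I \<omega>)\<^sup>2) \<partial>M) \<longlonglongrightarrow> 0"
    using I unfolding has_ito_integral_def by blast
  have Im: "I \<in> borel_measurable M" using I by (simp add: has_ito_integral_def)
  interpret P: pair_sigma_finite "horizon T" M
    by (intro pair_sigma_finite_weighted finite_measure_horizon)
  define S where "S m = (\<lambda>z. case z of (t, \<omega>) \<Rightarrow> simple_process (n m) (\<tau> m) (\<xi> m) t \<omega>)" for m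
  define U where "U = (\<lambda>z. case z of (t, \<omega>) \<Rightarrow> u t \<omega>)"
  have Ssq: "sq_int (on_horizon T) (S m)" for m
    using simple_process_sq[OF na] by (simp add: S_def)
  have Sm [measurable]: "S m \<in> borel_measurable (borel \<Otimes>\<^sub>M M)" for m
    using sq_int_measurable[OF Ssq] by simp
  have Um [measurable]: "U \<in> borel_measurable (borel \<Otimes>\<^sub>M M)" using u by (simp add: U_def)
  have "(\<integral>\<^sup>+z. ennreal ((S m z - U z)\<^sup>2) \<partial>on_horizon T) =
    (\<integral>\<^sup>+\<omega>. (\<integral>\<^sup>+t\<in>{0..T}. ennreal ((simple_process (n m) (\<tau> m) (\<xi> m) t \<omega> - u t \<omega>)\<^sup>2) \<partial>lborel) \<partial>M)" for m
  proof -
    have "(\<integral>\<^sup>+z. ennreal ((S m z - U z)\<^sup>2) \<partial>on_horizon T) =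
      (\<integral>\<^sup>+\<omega>. (\<integral>\<^sup>+t. ennreal ((S m (t, \<omega>) - U (t, \<omega>))\<^sup>2) \<partial>horizon T) \<partial>M)"
      by (rule P.nn_integral_snd[symmetric]) simp
    also have "\<dots> = (\<integral>\<^sup>+\<omega>. (\<integral>\<^sup>+t. ennreal ((S m (t, \<omega>) - U (t, \<omega>))\<^sup>2) * indicator {0..T} t \<partial>lborel) \<partial>M)"
      by (intro nn_integral_cong, subst nn_integral_weighted)
         (auto simp: ennreal_indicator mult.commute)
    finally show ?thesis by (simp add: S_def U_def)
  qed
  with l1 have "(\<lambda>m. \<integral>\<^sup>+z. ennreal ((S m z - U z)\<^sup>2) \<partial>on_horizon T) \<longlonglongrightarrow> 0" by simp
  from sq_lim_nn[OF Ssq _ this] have 1: "sq_int (on_horizon T) U"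
    "(\<lambda>m. \<integral>z. (S m z - U z)\<^sup>2 \<partial>on_horizon T) \<longlonglongrightarrow> 0" by auto
  from sq_lim_nn[OF simple_ito_sq[OF na i T] Im l2]
  have 2: "sq_int M I"
    "(\<lambda>m. \<integral>\<omega>. (simple_ito_integral (W i) T (n m) (\<tau> m) (\<xi> m) \<omega> - I \<omega>)\<^sup>2 \<partial>M) \<longlonglongrightarrow> 0" by auto
  show thesis
    by (rule that[OF na 1(1)[unfolded U_def] 2(1) 1(2)[unfolded U_def S_def] 2(2)])
qed

end

section \<open>Discounted and finite-horizon drifts\<close>

definition weight :: "(real \<Rightarrow> real) \<Rightarrow> bool" where
  "weight w \<longleftrightarrow> (\<forall>t. 0 \<le> w t) \<and> integrable lborel w"

lemma weightD:
  assumes "weight w"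
  shows "0 \<le> w t" "integrable lborel w" "w \<in> borel_measurable borel" "finite_measure (weighted w)"
  using assms borel_measurable_integrable[of lborel w]
  by (auto simp: weight_def intro: finite_measure_weighted)

lemma weight_horizon: "weight (indicator {0..T})"
  by (auto simp: weight_def intro!: integrable_real_indicator emeasure_bounded_finite)

section \<open>Fubini and comparison for weighted time measures\<close>

context prob_space
begin

lemma weighted_pair_sigma_finite: "weight w \<Longrightarrow> pair_sigma_finite (weighted w) M"
  by (intro pair_sigma_finite_weighted weightD)

lemma nn_integral_weighted_snd:
  assumes w: "weight w" and f: "f \<in> borel_measurable (borel \<Otimes>\<^sub>M M)"
  shows "(\<integral>\<^sup>+z. f z \<partial>(weighted w \<Otimes>\<^sub>M M)) = (\<integral>\<^sup>+\<omega>. (\<integral>\<^sup>+t. f (t, \<omega>) \<partial>weighted w) \<partial>M)"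
proof -
  interpret P: pair_sigma_finite "weighted w" M by (rule weighted_pair_sigma_finite[OF w])
  show ?thesis using f by (intro P.nn_integral_snd[symmetric]) simp
qed

lemma nn_integral_weighted_cmult_snd:
  fixes w :: "real \<Rightarrow> real"
  assumes w: "weight w" and f: "f \<in> borel_measurable (borel \<Otimes>\<^sub>M M)"
  shows "(\<integral>\<^sup>+\<omega>. ennreal C * (\<integral>\<^sup>+t. f (t, \<omega>) \<partial>weighted w) \<partial>M) =
    ennreal C * (\<integral>\<^sup>+z. f z \<partial>(weighted w \<Otimes>\<^sub>M M))"
  unfolding nn_integral_weighted_snd[OF w f]
proof (rule nn_integral_cmult)
  interpret P: pair_sigma_finite "weighted w" M by (rule weighted_pair_sigma_finite[OF w])
  interpret Q: pair_sigma_finite M "weighted w" ..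
  note [measurable] = f
  show "(\<lambda>\<omega>. \<integral>\<^sup>+t. f (t, \<omega>) \<partial>weighted w) \<in> borel_measurable M" by measurable
qed

lemma nn_integral_weighted_fst:
  assumes w: "weight w" and f: "f \<in> borel_measurable (borel \<Otimes>\<^sub>M M)"
  shows "(\<integral>\<^sup>+z. f z \<partial>(weighted w \<Otimes>\<^sub>M M)) = (\<integral>\<^sup>+t. (\<integral>\<^sup>+\<omega>. f (t, \<omega>) \<partial>M) \<partial>weighted w)"
proof -
  interpret P: pair_sigma_finite "weighted w" M by (rule weighted_pair_sigma_finite[OF w])
  show ?thesis using f by (intro nn_integral_fst[symmetric]) simp
qed

lemma integral_weighted_snd:
  fixes f :: "real \<times> 'a \<Rightarrow> real"
  assumes w: "weight w" and f: "integrable (weighted w \<Otimes>\<^sub>M M) f"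
  shows "(\<integral>z. f z \<partial>(weighted w \<Otimes>\<^sub>M M)) = (\<integral>\<omega>. (\<integral>t. f (t, \<omega>) \<partial>weighted w) \<partial>M)"
    and "AE \<omega> in M. integrable (weighted w) (\<lambda>t. f (t, \<omega>))"
    and "integrable M (\<lambda>\<omega>. \<integral>t. f (t, \<omega>) \<partial>weighted w)"
proof -
  interpret P: pair_sigma_finite "weighted w" M by (rule weighted_pair_sigma_finite[OF w])
  have f': "integrable (weighted w \<Otimes>\<^sub>M M) (case_prod (\<lambda>t \<omega>. f (t, \<omega>)))" using f by simp
  show "(\<integral>z. f z \<partial>(weighted w \<Otimes>\<^sub>M M)) = (\<integral>\<omega>. (\<integral>t. f (t, \<omega>) \<partial>weighted w) \<partial>M)"
    and "AE \<omega> in M. integrable (weighted w) (\<lambda>t. f (t, \<omega>))"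
    and "integrable M (\<lambda>\<omega>. \<integral>t. f (t, \<omega>) \<partial>weighted w)"
    using P.integral_snd[OF f'] P.AE_integrable_snd[OF f'] P.integrable_snd[OF f'] by auto
qed

lemma integral_weighted_fst:
  fixes f :: "real \<times> 'a \<Rightarrow> real"
  assumes w: "weight w" and f: "integrable (weighted w \<Otimes>\<^sub>M M) f"
  shows "(\<integral>z. f z \<partial>(weighted w \<Otimes>\<^sub>M M)) = (\<integral>t. (\<integral>\<omega>. f (t, \<omega>) \<partial>M) \<partial>weighted w)"
    and "AE t in weighted w. integrable M (\<lambda>\<omega>. f (t, \<omega>))"
    and "integrable (weighted w) (\<lambda>t. \<integral>\<omega>. f (t, \<omega>) \<partial>M)"
proof -
  interpret P: pair_sigma_finite "weighted w" M by (rule weighted_pair_sigma_finite[OF w])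
  show "(\<integral>z. f z \<partial>(weighted w \<Otimes>\<^sub>M M)) = (\<integral>t. (\<integral>\<omega>. f (t, \<omega>) \<partial>M) \<partial>weighted w)"
    and "AE t in weighted w. integrable M (\<lambda>\<omega>. f (t, \<omega>))"
    and "integrable (weighted w) (\<lambda>t. \<integral>\<omega>. f (t, \<omega>) \<partial>M)"
    using P.integral_fst'[OF f] P.AE_integrable_fst'[OF f] P.integrable_fst'[OF f] by auto
qed

lemma sq_int_weighted_section:
  assumes w: "weight w" and f: "sq_int (weighted w \<Otimes>\<^sub>M M) f"
  shows "AE t in weighted w. sq_int M (\<lambda>\<omega>. f (t, \<omega>))"
    and "AE \<omega> in M. sq_int (weighted w) (\<lambda>t. f (t, \<omega>))"
proof -
  have [measurable]: "f \<in> borel_measurable (borel \<Otimes>\<^sub>M M)" using sq_int_measurable[OF f] by simp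
  show "AE t in weighted w. sq_int M (\<lambda>\<omega>. f (t, \<omega>))"
    using integral_weighted_fst(2)[OF w sq_int_power2[OF f]]
    by eventually_elim (auto simp: sq_int_def)
  show "AE \<omega> in M. sq_int (weighted w) (\<lambda>t. f (t, \<omega>))"
    using integral_weighted_snd(2)[OF w sq_int_power2[OF f]] AE_space
    by eventually_elim (auto simp: sq_int_def)
qed

lemma sq_int_weighted_const:
  assumes w: "weight w" and f: "sq_int M f"
  shows "sq_int (weighted w \<Otimes>\<^sub>M M) (\<lambda>z. f (snd z))"
proof (rule sq_intI_nn)
  have [measurable]: "f \<in> borel_measurable M" using f by (simp add: sq_int_def)
  show "(\<lambda>z. f (snd z)) \<in> borel_measurable (weighted w \<Otimes>\<^sub>M M)" by measurable
  interpret F: finite_measure "weighted w" by (rule weightD[OF w])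
  have "(\<integral>\<^sup>+z. ennreal ((f (snd z))\<^sup>2) \<partial>(weighted w \<Otimes>\<^sub>M M)) =
    (\<integral>\<^sup>+t. ennreal (\<integral>\<omega>. (f \<omega>)\<^sup>2 \<partial>M) \<partial>weighted w)"
    by (subst nn_integral_weighted_fst[OF w]) (auto simp: sq_int_nn[OF f])
  also have "\<dots> < \<infinity>" by (simp add: F.emeasure_eq_measure ennreal_mult_less_top)
  finally show "(\<integral>\<^sup>+z. ennreal ((f (snd z))\<^sup>2) \<partial>(weighted w \<Otimes>\<^sub>M M)) < \<infinity>" .
qed

lemma nn_integral_weighted_mono:
  assumes w: "weight w" "weight w'" and le: "\<And>t. w t \<le> C * w' t" and C: "0 \<le> C"
    and f: "f \<in> borel_measurable (borel \<Otimes>\<^sub>M M)"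
  shows "(\<integral>\<^sup>+z. f z \<partial>(weighted w \<Otimes>\<^sub>M M)) \<le> ennreal C * (\<integral>\<^sup>+z. f z \<partial>(weighted w' \<Otimes>\<^sub>M M))"
proof -
  note [measurable] = f weightD(3)[OF w(1)] weightD(3)[OF w(2)]
  have fs[measurable]: "(\<lambda>t. f (t, \<omega>)) \<in> borel_measurable borel" if "\<omega> \<in> space M" for \<omega>
    using that by measurable
  have "(\<integral>\<^sup>+z. f z \<partial>(weighted w \<Otimes>\<^sub>M M)) = (\<integral>\<^sup>+\<omega>. (\<integral>\<^sup>+t. f (t, \<omega>) \<partial>weighted w) \<partial>M)"
    by (rule nn_integral_weighted_snd[OF w(1) f])
  also have "\<dots> \<le> (\<integral>\<^sup>+\<omega>. ennreal C * (\<integral>\<^sup>+t. f (t, \<omega>) \<partial>weighted w') \<partial>M)"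
  proof (intro nn_integral_mono)
    fix \<omega> assume \<omega>: "\<omega> \<in> space M"
    have "(\<integral>\<^sup>+t. f (t, \<omega>) \<partial>weighted w) = (\<integral>\<^sup>+t. ennreal (w t) * f (t, \<omega>) \<partial>lborel)"
      using \<omega> by (intro nn_integral_weighted) auto
    also have "\<dots> \<le> (\<integral>\<^sup>+t. ennreal C * (ennreal (w' t) * f (t, \<omega>)) \<partial>lborel)"
      using le C weightD(1)[OF w(2)]
      by (intro nn_integral_mono)
         (auto simp: mult.assoc[symmetric] ennreal_mult[symmetric] intro!: mult_right_mono)
    also have "\<dots> = ennreal C * (\<integral>\<^sup>+t. f (t, \<omega>) \<partial>weighted w')"
      using \<omega> by (subst nn_integral_cmult) (auto simp: nn_integral_weighted)
    finally show "(\<integral>\<^sup>+t. f (t, \<omega>) \<partial>weighted w) \<le> ennreal C * (\<integral>\<^sup>+t. f (t, \<omega>) \<partial>weighted w')" .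
  qed
  also have "\<dots> = ennreal C * (\<integral>\<^sup>+z. f z \<partial>(weighted w' \<Otimes>\<^sub>M M))"
    by (rule nn_integral_weighted_cmult_snd[OF w(2) f])
  finally show ?thesis .
qed

lemma sq_int_weighted_mono:
  assumes w: "weight w" "weight w'" and le: "\<And>t. w t \<le> C * w' t" and C: "0 \<le> C"
    and f: "sq_int (weighted w' \<Otimes>\<^sub>M M) f"
  shows "sq_int (weighted w \<Otimes>\<^sub>M M) f"
    and "(\<integral>z. (f z)\<^sup>2 \<partial>(weighted w \<Otimes>\<^sub>M M)) \<le> C * (\<integral>z. (f z)\<^sup>2 \<partial>(weighted w' \<Otimes>\<^sub>M M))"
proof -
  have m: "f \<in> borel_measurable (borel \<Otimes>\<^sub>M M)" using sq_int_measurable[OF f] by simp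
  have *: "(\<integral>\<^sup>+z. ennreal ((f z)\<^sup>2) \<partial>(weighted w \<Otimes>\<^sub>M M)) \<le> ennreal C * ennreal (\<integral>z. (f z)\<^sup>2 \<partial>(weighted w' \<Otimes>\<^sub>M M))"
    using nn_integral_weighted_mono[OF w le C, of "\<lambda>z. ennreal ((f z)\<^sup>2)"] m
    by (simp add: sq_int_nn[OF f])
  also have "\<dots> < \<infinity>" by (simp add: ennreal_mult_less_top)
  finally show sq: "sq_int (weighted w \<Otimes>\<^sub>M M) f"
    using m by (intro sq_intI_nn) auto
  show "(\<integral>z. (f z)\<^sup>2 \<partial>(weighted w \<Otimes>\<^sub>M M)) \<le> C * (\<integral>z. (f z)\<^sup>2 \<partial>(weighted w' \<Otimes>\<^sub>M M))"
    using * C unfolding sq_int_nn[OF sq] by (simp add: ennreal_mult[symmetric])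
qed

lemma sq_int_horizon_mono:
  assumes "s \<le> T" "sq_int (on_horizon T) f"
  shows "sq_int (on_horizon s) f"
    and "(\<integral>z. (f z)\<^sup>2 \<partial>on_horizon s) \<le> (\<integral>z. (f z)\<^sup>2 \<partial>on_horizon T)"
  using sq_int_weighted_mono[OF weight_horizon weight_horizon _ _ assms(2), of s 1] assms(1)
  by (auto simp: indicator_def)

end

text \<open>The absolutely continuous part of a state. It is 0 on paths where the integral diverges,
  the same default as in the \<open>LBINT\<close> of \<open>sde_solution\<close>.\<close>

definition drift :: "(real \<Rightarrow> 'w \<Rightarrow> real) \<Rightarrow> real \<Rightarrow> 'w \<Rightarrow> real" where
  "drift U t \<omega> = (\<integral>s. U s \<omega> \<partial>horizon t)"

lemma integral_horizon:
  fixes f :: "real \<Rightarrow> real"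
  assumes "f \<in> borel_measurable borel"
  shows "(\<integral>s. f s \<partial>horizon t) = (\<integral>s. indicator {0..t} s * f s \<partial>lborel)"
  using assms by (intro integral_weighted) auto

lemma drift_measurable:
  assumes U: "(case_prod U) \<in> borel_measurable (borel \<Otimes>\<^sub>M M)"
  shows "(case_prod (drift U)) \<in> borel_measurable (borel \<Otimes>\<^sub>M M)"
proof -
  have "(\<lambda>z. \<integral>s. (if 0 \<le> s \<and> s \<le> fst z then (case_prod U) (s, snd z) else 0) \<partial>lborel)
    \<in> borel_measurable (borel \<Otimes>\<^sub>M M)"
    using U by measurable
  also have "?this \<longleftrightarrow> ?thesis"
  proof (rule measurable_cong)
    fix z assume z: "z \<in> space ((borel :: real measure) \<Otimes>\<^sub>M M)"
    have m: "(\<lambda>s. U s (snd z)) \<in> borel_measurable borel"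
      using measurable_compose[OF measurable_Pair2'[of "snd z" M borel] U] z
      by (auto simp: space_pair_measure)
    show "(\<integral>s. (if 0 \<le> s \<and> s \<le> fst z then (case_prod U) (s, snd z) else 0) \<partial>lborel) =
      (case z of (t, \<omega>) \<Rightarrow> drift U t \<omega>)"
      unfolding drift_def case_prod_beta integral_horizon[OF m]
      by (intro Lint_cong) (auto simp: indicator_def)
  qed
  finally show ?thesis .
qed

lemma measurable_cumulative:
  fixes f :: "real \<Rightarrow> real"
  assumes [measurable]: "f \<in> borel_measurable borel"
  shows "(\<lambda>t. \<integral>s. f s \<partial>horizon t) \<in> borel_measurable borel"
proof -
  have "(\<lambda>t. \<integral>s. f s \<partial>horizon t) = (\<lambda>t. \<integral>s. (if 0 \<le> s \<and> s \<le> t then f s else 0) \<partial>lborel)"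
    by (auto simp: integral_horizon indicator_def intro!: Lint_cong)
  then show ?thesis by simp
qed

text \<open>Cauchy-Schwarz after inserting \<open>exp (c * s / 2) * exp (- c * s / 2)\<close>. The
  choice \<open>c = 0\<close> gives the finite-horizon bound, \<open>c = \<rho> / 2\<close> the
  discounted one. If \<open>f\<close> is not integrable, the left side is 0 by convention.\<close>

lemma drift_bound:
  fixes f :: "real \<Rightarrow> real"
  assumes f [measurable]: "f \<in> borel_measurable borel"
  shows "ennreal ((\<integral>s. f s \<partial>horizon t)\<^sup>2) \<le>
    (\<integral>\<^sup>+s. ennreal (exp (c * s)) \<partial>horizon t) * (\<integral>\<^sup>+s. ennreal (exp (- c * s) * (f s)\<^sup>2) \<partial>horizon t)"
proof (cases "integrable (horizon t) f")
  case True
  have "ennreal \<bar>\<integral>s. f s \<partial>horizon t\<bar> \<le> (\<integral>\<^sup>+s. ennreal \<bar>f s\<bar> \<partial>horizon t)"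
    using integral_norm_bound_ennreal[OF True] by simp
  then have "(ennreal \<bar>\<integral>s. f s \<partial>horizon t\<bar>)\<^sup>2 \<le> (\<integral>\<^sup>+s. ennreal \<bar>f s\<bar> \<partial>horizon t)\<^sup>2"
    by (intro power_mono) auto
  also have "(\<integral>\<^sup>+s. ennreal \<bar>f s\<bar> \<partial>horizon t) =
    (\<integral>\<^sup>+s. ennreal (exp (c * s / 2)) * ennreal (exp (- c * s / 2) * \<bar>f s\<bar>) \<partial>horizon t)"
    by (intro nn_integral_cong) (simp add: ennreal_mult[symmetric] mult.assoc[symmetric] exp_add[symmetric])
  also have "\<dots>\<^sup>2 \<le> (\<integral>\<^sup>+s. (ennreal (exp (c * s / 2)))\<^sup>2 \<partial>horizon t) *
    (\<integral>\<^sup>+s. (ennreal (exp (- c * s / 2) * \<bar>f s\<bar>))\<^sup>2 \<partial>horizon t)"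
    by (intro Cauchy_Schwarz_nn_integral) auto
  also have "(\<integral>\<^sup>+s. (ennreal (exp (c * s / 2)))\<^sup>2 \<partial>horizon t) = (\<integral>\<^sup>+s. ennreal (exp (c * s)) \<partial>horizon t)"
    by (intro nn_integral_cong) (simp add: ennreal_power exp_double[symmetric])
  also have "(\<integral>\<^sup>+s. (ennreal (exp (- c * s / 2) * \<bar>f s\<bar>))\<^sup>2 \<partial>horizon t) =
    (\<integral>\<^sup>+s. ennreal (exp (- c * s) * (f s)\<^sup>2) \<partial>horizon t)"
    by (intro nn_integral_cong) (simp add: ennreal_power power_mult_distrib exp_double[symmetric])
  finally show ?thesis by (simp add: ennreal_power)
next
  case False
  then show ?thesis by (simp add: not_integrable_integral_eq)
qed

text \<open>Integration by parts in the form of Fubini: the square is cut along its diagonal, and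
  each half is integrated first in the earlier of the two times.\<close>

lemma horizon_product:
  fixes f g :: "real \<Rightarrow> real"
  assumes f: "integrable (horizon t) f" and g: "integrable (horizon t) g"
    and [measurable]: "f \<in> borel_measurable borel" "g \<in> borel_measurable borel"
  shows "(\<integral>s. f s \<partial>horizon t) * (\<integral>s. g s \<partial>horizon t) =
    (\<integral>s. f s * (\<integral>r. g r \<partial>horizon s) \<partial>horizon t) + (\<integral>s. (\<integral>r. f r \<partial>horizon s) * g s \<partial>horizon t)"
proof -
  interpret F: finite_measure "horizon t" by (rule finite_measure_horizon)
  interpret P: pair_sigma_finite "horizon t" "horizon t" ..
  have fg: "integrable (horizon t \<Otimes>\<^sub>M horizon t) (\<lambda>z. f (fst z) * g (snd z))"
    using f g by (intro P.Fubini_integrable) (auto simp: abs_mult)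
  define A where "A z = (if snd z \<le> fst z then f (fst z) * g (snd z) else 0)" for z
  define B where "B z = (if fst z < snd z then f (fst z) * g (snd z) else 0)" for z
  have [measurable]: "A \<in> borel_measurable (horizon t \<Otimes>\<^sub>M horizon t)"
    "B \<in> borel_measurable (horizon t \<Otimes>\<^sub>M horizon t)"
    unfolding A_def[abs_def] B_def[abs_def] by measurable
  have A: "integrable (horizon t \<Otimes>\<^sub>M horizon t) A" and B: "integrable (horizon t \<Otimes>\<^sub>M horizon t) B"
    by (auto intro!: Bochner_Integration.integrable_bound[OF fg] simp: A_def B_def)
  have sec: "(\<integral>r. A (s, r) \<partial>horizon t) = f s * (\<integral>r. g r \<partial>horizon s)" if "s \<in> {0..t}" for s
  proof -
    have "(\<integral>r. A (s, r) \<partial>horizon t) = (\<integral>r. indicator {0..t} r * A (s, r) \<partial>lborel)"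
      by (rule integral_horizon) (unfold A_def fst_conv snd_conv, measurable)
    also have "\<dots> = (\<integral>r. f s * (indicator {0..s} r * g r) \<partial>lborel)"
      using that by (intro Lint_cong) (auto simp: A_def indicator_def)
    finally have "(\<integral>r. A (s, r) \<partial>horizon t) = (\<integral>r. f s * (indicator {0..s} r * g r) \<partial>lborel)" .
    then show ?thesis by (simp add: integral_horizon)
  qed
  have sec': "(\<integral>s. B (s, r) \<partial>horizon t) = (\<integral>s. f s \<partial>horizon r) * g r" if "r \<in> {0..t}" for r
  proof -
    have "(\<integral>s. B (s, r) \<partial>horizon t) = (\<integral>s. (indicator {0..r} s * f s) * g r \<partial>lborel)"
    proof (subst integral_horizon)
      show [measurable]: "(\<lambda>s. B (s, r)) \<in> borel_measurable borel"
        unfolding B_def fst_conv snd_conv by measurable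
      show "(\<integral>s. indicator {0..t} s * B (s, r) \<partial>lborel) = (\<integral>s. (indicator {0..r} s * f s) * g r \<partial>lborel)"
      \<comment> \<open>\<open>B\<close> excludes the diagonal, whereas \<open>{0..r}\<close> is
        closed; the two integrands differ at most at \<open>s = r\<close>.\<close>
      proof (rule integral_cong_AE)
        show "AE s in lborel. indicator {0..t} s * B (s, r) = indicator {0..r} s * f s * g r"
          using AE_lborel_singleton[of r] by eventually_elim (use that in \<open>auto simp: B_def indicator_def\<close>)
      qed measurable
    qed
    then show ?thesis by (simp add: integral_horizon)
  qed
  note [measurable] = measurable_cumulative
  have h: "(\<integral>s. F s \<partial>horizon t) = (\<integral>s. H s \<partial>horizon t)"
    if "\<And>s. s \<in> {0..t} \<Longrightarrow> F s = H s" "F \<in> borel_measurable borel" "H \<in> borel_measurable borel"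
    for F H :: "real \<Rightarrow> real"
    using that by (auto simp: integral_horizon indicator_def intro!: Lint_cong)
  have hA: "(\<integral>s. (\<integral>r. A (s, r) \<partial>horizon t) \<partial>horizon t) = (\<integral>s. f s * (\<integral>r. g r \<partial>horizon s) \<partial>horizon t)"
    using P.integrable_fst'[OF A] by (intro h sec) (auto dest: borel_measurable_integrable)
  have hB: "(\<integral>r. (\<integral>s. B (s, r) \<partial>horizon t) \<partial>horizon t) = (\<integral>s. (\<integral>r. f r \<partial>horizon s) * g s \<partial>horizon t)"
    using P.integrable_snd[of "\<lambda>s r. B (s, r)"] B by (intro h sec') (auto dest: borel_measurable_integrable)
  have "(\<integral>s. f s \<partial>horizon t) * (\<integral>s. g s \<partial>horizon t) =
    (\<integral>z. f (fst z) * g (snd z) \<partial>(horizon t \<Otimes>\<^sub>M horizon t))"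
    using P.integral_fst'[OF fg] by simp
  also have "\<dots> = (\<integral>z. A z + B z \<partial>(horizon t \<Otimes>\<^sub>M horizon t))"
    by (intro Lint_cong) (auto simp: A_def B_def)
  also have "\<dots> = (\<integral>z. A z \<partial>(horizon t \<Otimes>\<^sub>M horizon t)) + (\<integral>z. B z \<partial>(horizon t \<Otimes>\<^sub>M horizon t))"
    by (rule Lint_add[OF A B])
  also have "\<dots> = (\<integral>s. (\<integral>r. A (s, r) \<partial>horizon t) \<partial>horizon t) + (\<integral>r. (\<integral>s. B (s, r) \<partial>horizon t) \<partial>horizon t)"
    using P.integral_fst'[OF A] P.integral_snd[of "\<lambda>s r. B (s, r)"] B by simp
  also have "\<dots> = (\<integral>s. f s * (\<integral>r. g r \<partial>horizon s) \<partial>horizon t) + (\<integral>s. (\<integral>r. f r \<partial>horizon s) * g s \<partial>horizon t)"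
    by (simp add: hA hB)
  finally show ?thesis .
qed

section \<open>Ito processes and the product formula\<close>

lemma integral_sq_diff_le:
  assumes "sq_int N f" "sq_int N g"
  shows "(\<integral>x. (f x - g x)\<^sup>2 \<partial>N) \<le> 2 * (\<integral>x. (f x)\<^sup>2 \<partial>N) + 2 * (\<integral>x. (g x)\<^sup>2 \<partial>N)"
  using integral_sq_add[OF assms, of 1 1] integral_sq_add[OF assms, of 1 "-1"]
    Bochner_Integration.integral_nonneg[of N "\<lambda>x. (f x + g x)\<^sup>2"]
  by simp

lemma AE_horizonI:
  assumes "\<And>t. 0 \<le> t \<Longrightarrow> t \<le> T \<Longrightarrow> P t"
  shows "AE t in horizon T. P t"
proof -
  have "AE t in density lborel (\<lambda>t. ennreal (indicator {0..T} t)). P t"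
    by (subst AE_density) (auto simp: assms indicator_def)
  then show ?thesis by (simp only: weighted_def)
qed

lemma (in prob_space) drift_measurable_section:
  assumes U: "(case_prod U) \<in> borel_measurable (borel \<Otimes>\<^sub>M M)"
  shows "drift U t \<in> borel_measurable M" "\<omega> \<in> space M \<Longrightarrow> (\<lambda>t. U t \<omega>) \<in> borel_measurable borel"
  using measurable_Pair2[OF drift_measurable[OF U], of t] measurable_Pair1[OF U]
  by (auto simp: space_pair_measure)

lemma (in prob_space) drift_sq:
  assumes U: "sq_int (on_horizon T) (case_prod U)" and t: "0 \<le> t" "t \<le> T"
  shows "(\<integral>\<^sup>+\<omega>. ennreal ((drift U t \<omega>)\<^sup>2) \<partial>M) \<le> ennreal (T * (\<integral>z. (case_prod U z)\<^sup>2 \<partial>on_horizon T))"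
proof -
  have m [measurable]: "(case_prod U) \<in> borel_measurable (borel \<Otimes>\<^sub>M M)"
    using sq_int_measurable[OF U] by simp
  note Ut = sq_int_horizon_mono[OF t(2) U]
  have "(\<integral>\<^sup>+s. 1 \<partial>horizon t) = ennreal t"
    using t by (subst nn_integral_weighted) (auto simp: ennreal_indicator)
  then have one: "emeasure (horizon t) UNIV = ennreal t" by simp
  have "(\<integral>\<^sup>+\<omega>. ennreal ((drift U t \<omega>)\<^sup>2) \<partial>M) \<le> (\<integral>\<^sup>+\<omega>. ennreal t * (\<integral>\<^sup>+s. ennreal ((U s \<omega>)\<^sup>2) \<partial>horizon t) \<partial>M)"
    using drift_bound[OF drift_measurable_section(2)[OF m], of _ t 0]
    by (intro nn_integral_mono) (simp add: drift_def one)
  also have "\<dots> = ennreal t * ennreal (\<integral>z. (case_prod U z)\<^sup>2 \<partial>on_horizon t)"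
    using nn_integral_weighted_cmult_snd[OF weight_horizon, of "\<lambda>z. ennreal ((case_prod U z)\<^sup>2)" t t]
    by (simp add: sq_int_nn[OF Ut(1), symmetric])
  also have "\<dots> \<le> ennreal (T * (\<integral>z. (case_prod U z)\<^sup>2 \<partial>on_horizon T))"
    using t Ut(2) by (subst ennreal_mult[symmetric]) (auto intro!: ennreal_leI mult_mono)
  finally show ?thesis .
qed

lemma (in prob_space) sq_int_horizonI:
  assumes m: "f \<in> borel_measurable (borel \<Otimes>\<^sub>M M)"
    and le: "\<And>t. 0 \<le> t \<Longrightarrow> t \<le> T \<Longrightarrow> (\<integral>\<^sup>+\<omega>. ennreal ((f (t, \<omega>))\<^sup>2) \<partial>M) \<le> ennreal C"
  shows "sq_int (on_horizon T) f"
proof (rule sq_intI_nn)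
  show "f \<in> borel_measurable (on_horizon T)" using m by simp
  note [measurable] = m
  interpret F: finite_measure "horizon T" by (rule finite_measure_horizon)
  have "(\<integral>\<^sup>+z. ennreal ((f z)\<^sup>2) \<partial>on_horizon T) = (\<integral>\<^sup>+t. (\<integral>\<^sup>+\<omega>. ennreal ((f (t, \<omega>))\<^sup>2) \<partial>M) \<partial>horizon T)"
    by (rule nn_integral_weighted_fst[OF weight_horizon]) simp
  also have "\<dots> \<le> (\<integral>\<^sup>+t. ennreal C \<partial>horizon T)"
    using le by (intro nn_integral_mono_AE AE_horizonI) auto
  also have "\<dots> < \<infinity>" by (simp add: F.emeasure_eq_measure ennreal_mult_less_top)
  finally show "(\<integral>\<^sup>+z. ennreal ((f z)\<^sup>2) \<partial>on_horizon T) < \<infinity>" .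
qed

lemma (in prob_space) drift_pairing:
  assumes U: "sq_int (on_horizon t) (case_prod U)" and Y: "sq_int M Y"
  shows "(\<integral>\<omega>. drift U t \<omega> * Y \<omega> \<partial>M) = (\<integral>z. case_prod U z * Y (snd z) \<partial>on_horizon t)"
  using integral_weighted_snd(1)[OF weight_horizon sq_int_mult[OF U sq_int_weighted_const[OF weight_horizon Y]]]
  by (simp add: drift_def)

lemma (in prob_space) drift_sq_int:
  assumes U: "sq_int (on_horizon T) (case_prod U)"
  shows "0 \<le> t \<Longrightarrow> t \<le> T \<Longrightarrow> sq_int M (drift U t)"
    and "sq_int (on_horizon T) (case_prod (drift U))"
proof -
  have m: "(case_prod U) \<in> borel_measurable (borel \<Otimes>\<^sub>M M)"
    using sq_int_measurable[OF U] by simp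
  show "sq_int M (drift U t)" if "0 \<le> t" "t \<le> T"
    using drift_sq[OF U that] drift_measurable_section(1)[OF m]
    by (intro sq_intI_nn) (auto elim: le_less_trans)
  show "sq_int (on_horizon T) (case_prod (drift U))"
    using drift_sq[OF U] drift_measurable[OF m] by (intro sq_int_horizonI) auto
qed

lemma (in prob_space) drift_product:
  assumes U: "sq_int (on_horizon t) (case_prod U)" and V: "sq_int (on_horizon t) (case_prod V)"
  shows "(\<integral>\<omega>. drift U t \<omega> * drift V t \<omega> \<partial>M) =
    (\<integral>z. case_prod U z * case_prod (drift V) z \<partial>on_horizon t) +
    (\<integral>z. case_prod (drift U) z * case_prod V z \<partial>on_horizon t)"
proof -
  have mU: "(case_prod U) \<in> borel_measurable (borel \<Otimes>\<^sub>M M)"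
    and mV: "(case_prod V) \<in> borel_measurable (borel \<Otimes>\<^sub>M M)"
    using sq_int_measurable[OF U] sq_int_measurable[OF V] by auto
  interpret H: finite_measure "horizon t" by (rule finite_measure_horizon)
  note 1 = sq_int_mult[OF U drift_sq_int(2)[OF V]] and 2 = sq_int_mult[OF drift_sq_int(2)[OF U] V]
  note s1 = integral_weighted_snd[OF weight_horizon 1] and s2 = integral_weighted_snd[OF weight_horizon 2]
  have "AE \<omega> in M. drift U t \<omega> * drift V t \<omega> =
    (\<integral>s. U s \<omega> * drift V s \<omega> \<partial>horizon t) + (\<integral>s. drift U s \<omega> * V s \<omega> \<partial>horizon t)"
    using sq_int_weighted_section(2)[OF weight_horizon U] sq_int_weighted_section(2)[OF weight_horizon V] AE_space
  proof eventually_elim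
    case (elim \<omega>)
    then show ?case
      unfolding drift_def using drift_measurable_section(2)[OF mU] drift_measurable_section(2)[OF mV]
      by (intro horizon_product) (auto dest: H.sq_int_integrable)
  qed
  then have "(\<integral>\<omega>. drift U t \<omega> * drift V t \<omega> \<partial>M) =
    (\<integral>\<omega>. (\<integral>s. U s \<omega> * drift V s \<omega> \<partial>horizon t) + (\<integral>s. drift U s \<omega> * V s \<omega> \<partial>horizon t) \<partial>M)"
    using drift_measurable_section(1)[OF mU] drift_measurable_section(1)[OF mV]
      borel_measurable_integrable[OF s1(3)] borel_measurable_integrable[OF s2(3)]
    by (intro integral_cong_AE) auto
  then show ?thesis
    using s1 s2 by simp
qed

section \<open>Ito processes and their martingale parts\<close>

context agent_system
begin

text \<open>The stochastic integral is taken to be the residual of the state after initial value and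
  drift. The decomposition of \<open>X\<close> is then an identity at every point of the sample
  space, and exceptional null sets disappear from the later algebra.\<close>

definition ito_process :: "nat \<Rightarrow> ('w \<Rightarrow> real) \<Rightarrow> 'w process \<Rightarrow> 'w process \<Rightarrow> bool" where
  "ito_process i \<xi> X U \<longleftrightarrow> i \<in> {1..N} \<and> \<xi> \<in> borel_measurable (G 0) \<and> sq_int M \<xi> \<and>
     (case_prod X) \<in> borel_measurable (borel \<Otimes>\<^sub>M M) \<and>
     (case_prod U) \<in> borel_measurable (borel \<Otimes>\<^sub>M M) \<and>
     (\<forall>t\<ge>0. U t \<in> borel_measurable (G t)) \<and>
     (\<forall>t\<ge>0. has_ito_integral M G (W i) t U (\<lambda>\<omega>. X t \<omega> - \<xi> \<omega> - drift U t \<omega>))"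

abbreviation noise :: "('w \<Rightarrow> real) \<Rightarrow> 'w process \<Rightarrow> 'w process \<Rightarrow> 'w process" where
  "noise \<xi> X U t \<omega> \<equiv> X t \<omega> - \<xi> \<omega> - drift U t \<omega>"

lemma ito_processD:
  assumes "ito_process i \<xi> X U"
  shows "i \<in> {1..N}" "\<xi> \<in> borel_measurable (G 0)" "sq_int M \<xi>"
    "(case_prod X) \<in> borel_measurable (borel \<Otimes>\<^sub>M M)"
    "(case_prod U) \<in> borel_measurable (borel \<Otimes>\<^sub>M M)"
    "0 \<le> t \<Longrightarrow> U t \<in> borel_measurable (G t)"
    "0 \<le> t \<Longrightarrow> has_ito_integral M G (W i) t U (noise \<xi> X U t)"
  using assms by (auto simp: ito_process_def)

lemma ito_process_sq:
  assumes p: "ito_process i \<xi> X U" and T: "0 \<le> T"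
  shows "sq_int (on_horizon T) (case_prod U)" "sq_int M (noise \<xi> X U T)"
  using ito_approximation[OF ito_processD(7)[OF p T] ito_processD(1)[OF p] T ito_processD(5)[OF p]]
  by blast+

text \<open>The integral at time \<open>s\<close> is given through a sequence of its own, unrelated
  to the one that approximates \<open>U\<close> up to \<open>T\<close>. Both approximate the same
  integrand on \<open>{0..s}\<close>, so the isometry forces their simple integrals
  together.\<close>

lemma noise_consistent:
  assumes p: "ito_process i \<xi> X U" and st: "0 \<le> s" "s \<le> T"
    and na: "\<And>m. nonanticipating G (n m) (\<tau> m) (\<zeta> m)"
    and lim: "(\<lambda>m. \<integral>z. (case_prod (simple_process (n m) (\<tau> m) (\<zeta> m)) z -
      case_prod U z)\<^sup>2 \<partial>on_horizon T) \<longlonglongrightarrow> 0"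
  shows "(\<lambda>m. \<integral>\<omega>. (simple_ito_integral (W i) s (n m) (\<tau> m) (\<zeta> m) \<omega> - noise \<xi> X U s \<omega>)\<^sup>2 \<partial>M) \<longlonglongrightarrow> 0"
proof -
  note i = ito_processD(1)[OF p]
  have T: "0 \<le> T" using st by simp
  obtain n' \<tau>' \<zeta>' where na': "\<And>m. nonanticipating G (n' m) (\<tau>' m) (\<zeta>' m)"
    and lim1: "(\<lambda>m. \<integral>z. (case_prod (simple_process (n' m) (\<tau>' m) (\<zeta>' m)) z -
      case_prod U z)\<^sup>2 \<partial>on_horizon s) \<longlonglongrightarrow> 0"
    and lim2: "(\<lambda>m. \<integral>\<omega>. (simple_ito_integral (W i) s (n' m) (\<tau>' m) (\<zeta>' m) \<omega> - noise \<xi> X U s \<omega>)\<^sup>2 \<partial>M) \<longlonglongrightarrow> 0"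
    by (rule ito_approximation[OF ito_processD(7)[OF p st(1)] i st(1) ito_processD(5)[OF p]]) (rule that; assumption)
  define S where "S m = (\<lambda>z. case z of (t, \<omega>) \<Rightarrow> simple_process (n m) (\<tau> m) (\<zeta> m) t \<omega>)" for m
  define S' where "S' m = (\<lambda>z. case z of (t, \<omega>) \<Rightarrow> simple_process (n' m) (\<tau>' m) (\<zeta>' m) t \<omega>)" for m
  define V where "V = (\<lambda>z. case z of (t, \<omega>) \<Rightarrow> U t \<omega>)"
  define I where "I m = simple_ito_integral (W i) s (n m) (\<tau> m) (\<zeta> m)" for m
  define I' where "I' m = simple_ito_integral (W i) s (n' m) (\<tau>' m) (\<zeta>' m)" for m
  define Z where "Z = noise \<xi> X U s"
  have Ssq: "sq_int (on_horizon t) (S m)" "sq_int (on_horizon t) (S' m)" for t m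
    using simple_process_sq[OF na] simple_process_sq[OF na'] by (auto simp: S_def S'_def)
  have Vsq: "sq_int (on_horizon s) V" "sq_int (on_horizon T) V"
    using ito_process_sq(1)[OF p] st by (auto simp: V_def)
  have Isq: "sq_int M (I m)" "sq_int M (I' m)" for m
    using simple_ito_sq[OF na i st(1)] simple_ito_sq[OF na' i st(1)] by (auto simp: I_def I'_def)
  have Zsq: "sq_int M Z" using ito_process_sq(2)[OF p st(1)] by (simp add: Z_def)
  \<comment> \<open>The bound \<open>2 * a^2 + 2 * b^2\<close> for a squared difference is used
    twice: to pass from \<open>I\<close> to \<open>Z\<close> through \<open>I'\<close>, and from
    \<open>S\<close> to \<open>S'\<close> through \<open>V\<close>. The 4 is the product of the two
    factors.\<close>
  define d where "d m = 4 * (\<integral>z. (S m z - V z)\<^sup>2 \<partial>on_horizon T)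
    + 4 * (\<integral>z. (S' m z - V z)\<^sup>2 \<partial>on_horizon s) + 2 * (\<integral>\<omega>. (I' m \<omega> - Z \<omega>)\<^sup>2 \<partial>M)" for m
  have le: "(\<integral>\<omega>. (I m \<omega> - Z \<omega>)\<^sup>2 \<partial>M) \<le> d m" for m
  proof -
    have "(\<integral>\<omega>. (I m \<omega> - Z \<omega>)\<^sup>2 \<partial>M) \<le> 2 * (\<integral>\<omega>. (I m \<omega> - I' m \<omega>)\<^sup>2 \<partial>M) + 2 * (\<integral>\<omega>. (Z \<omega> - I' m \<omega>)\<^sup>2 \<partial>M)"
      using integral_sq_diff_le[OF sq_int_diff[OF Isq(1)[of m] Isq(2)[of m]] sq_int_diff[OF Zsq Isq(2)[of m]]] by simp
    also have "(\<integral>\<omega>. (I m \<omega> - I' m \<omega>)\<^sup>2 \<partial>M) = (\<integral>z. (S m z - S' m z)\<^sup>2 \<partial>on_horizon s)"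
      using simple_isometry_diff[OF na na' i st(1)] by (simp add: I_def I'_def S_def S'_def)
    also have "\<dots> \<le> 2 * (\<integral>z. (S m z - V z)\<^sup>2 \<partial>on_horizon s) + 2 * (\<integral>z. (S' m z - V z)\<^sup>2 \<partial>on_horizon s)"
      using integral_sq_diff_le[OF sq_int_diff[OF Ssq(1)[of s m] Vsq(1)] sq_int_diff[OF Ssq(2)[of s m] Vsq(1)]] by simp
    also have "(\<integral>z. (S m z - V z)\<^sup>2 \<partial>on_horizon s) \<le> (\<integral>z. (S m z - V z)\<^sup>2 \<partial>on_horizon T)"
      by (rule sq_int_horizon_mono(2)[OF st(2) sq_int_diff[OF Ssq(1) Vsq(2)]])
    finally show ?thesis by (simp add: d_def power2_commute[of "Z _"])
  qed
  have "d \<longlonglongrightarrow> 4 * 0 + 4 * 0 + 2 * 0"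
    unfolding d_def[abs_def] S_def S'_def V_def I'_def Z_def
    by (intro tendsto_add tendsto_mult tendsto_const lim lim1 lim2)
  then have d: "d \<longlonglongrightarrow> 0" by simp
  have "(\<lambda>m. \<integral>\<omega>. (I m \<omega> - Z \<omega>)\<^sup>2 \<partial>M) \<longlonglongrightarrow> 0"
    by (rule real_tendsto_sandwich[OF always_eventually always_eventually tendsto_const d]) (simp_all add: le)
  then show ?thesis by (simp add: I_def Z_def)
qed

text \<open>By \<open>noise_consistent\<close> one sequence computes the noise at both times, and
  for simple integrals the claim is \<open>simple_martingale\<close>.\<close>

lemma noise_martingale:
  assumes p: "ito_process i \<xi> X U" and st: "0 \<le> s" "s \<le> t"
    and h: "\<eta> \<in> borel_measurable (G s)" "sq_int M \<eta>"
  shows "(\<integral>\<omega>. \<eta> \<omega> * noise \<xi> X U t \<omega> \<partial>M) = (\<integral>\<omega>. \<eta> \<omega> * noise \<xi> X U s \<omega> \<partial>M)"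
proof -
  note i = ito_processD(1)[OF p]
  have t: "0 \<le> t" using st by simp
  obtain n \<tau> \<zeta> where na: "\<And>m. nonanticipating G (n m) (\<tau> m) (\<zeta> m)"
    and lim: "(\<lambda>m. \<integral>z. (case_prod (simple_process (n m) (\<tau> m) (\<zeta> m)) z -
      case_prod U z)\<^sup>2 \<partial>on_horizon t) \<longlonglongrightarrow> 0"
    by (rule ito_approximation[OF ito_processD(7)[OF p t] i t ito_processD(5)[OF p]]) (rule that; assumption)
  have L: "(\<lambda>m. \<integral>\<omega>. \<eta> \<omega> * simple_ito_integral (W i) v (n m) (\<tau> m) (\<zeta> m) \<omega> \<partial>M)
      \<longlonglongrightarrow> (\<integral>\<omega>. \<eta> \<omega> * noise \<xi> X U v \<omega> \<partial>M)" if v: "0 \<le> v" "v \<le> t" for v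
    by (rule sq_lim_mult[where f = "\<lambda>_. \<eta>", OF h(2) h(2) _ simple_ito_sq[OF na i v(1)]
          ito_process_sq(2)[OF p v(1)] noise_consistent[OF p v na lim]]) simp
  have "(\<integral>\<omega>. \<eta> \<omega> * simple_ito_integral (W i) t (n m) (\<tau> m) (\<zeta> m) \<omega> \<partial>M) =
    (\<integral>\<omega>. \<eta> \<omega> * simple_ito_integral (W i) s (n m) (\<tau> m) (\<zeta> m) \<omega> \<partial>M)" for m
    using simple_martingale[OF na i st h, of m] sq_int_mult[OF h(2) simple_ito_sq[OF na i]] st
    by (simp add: right_diff_distrib)
  with L[OF t order.refl] L[OF st] show ?thesis
    using LIMSEQ_unique by simp
qed

text \<open>Simple integrals up to time 0 vanish, so the noise at 0 has zero second moment; the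
  martingale property carries the orthogonality to time \<open>t\<close>.\<close>

lemma noise_initial:
  assumes p: "ito_process i \<xi> X U" and t: "0 \<le> t" and h: "\<eta> \<in> borel_measurable (G 0)" "sq_int M \<eta>"
  shows "(\<integral>\<omega>. \<eta> \<omega> * noise \<xi> X U t \<omega> \<partial>M) = 0"
proof -
  note i = ito_processD(1)[OF p]
  obtain n \<tau> \<zeta> where na: "\<And>m. nonanticipating G (n m) (\<tau> m) (\<zeta> m)"
    and lim: "(\<lambda>m. \<integral>\<omega>. (simple_ito_integral (W i) 0 (n m) (\<tau> m) (\<zeta> m) \<omega> - noise \<xi> X U 0 \<omega>)\<^sup>2 \<partial>M) \<longlonglongrightarrow> 0"
    by (rule ito_approximation[OF ito_processD(7)[OF p order.refl] i order.refl ito_processD(5)[OF p]]) (rule that; assumption)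
  have "simple_ito_integral (W i) 0 (n m) (\<tau> m) (\<zeta> m) \<omega> = 0" for m \<omega>
    using nonanticipating_block(1)[OF na] by (simp add: simple_ito_integral_def min_absorb1)
  with lim have "(\<integral>\<omega>. (0 - noise \<xi> X U 0 \<omega>)\<^sup>2 \<partial>M) = 0"
    by (simp only: LIMSEQ_const_iff)
  then have "(\<integral>\<omega>. (noise \<xi> X U 0 \<omega>)\<^sup>2 \<partial>M) = 0"
    by (simp only: diff_0 power2_minus)
  then have "(\<integral>\<omega>. \<eta> \<omega> * noise \<xi> X U 0 \<omega> \<partial>M) = 0"
    using integral_Cauchy_Schwarz[OF h(2) ito_process_sq(2)[OF p order.refl]] by simp
  then show ?thesis using noise_martingale[OF p order.refl t h] by simp
qed

text \<open>The approximating sequences of the two processes may be unrelated, since the isometry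
  for simple integrands is already bilinear.\<close>

lemma noise_product:
  assumes p: "ito_process i \<xi> X U" and q: "ito_process j \<eta> Y V" and t: "0 \<le> t"
  shows "(\<integral>\<omega>. noise \<xi> X U t \<omega> * noise \<eta> Y V t \<omega> \<partial>M) =
    (if i = j then \<integral>z. case_prod U z * case_prod V z \<partial>on_horizon t else 0)"
proof -
  note i = ito_processD(1)[OF p] and j = ito_processD(1)[OF q]
  obtain n \<tau> \<zeta> where na: "\<And>m. nonanticipating G (n m) (\<tau> m) (\<zeta> m)"
    and lim: "(\<lambda>m. \<integral>z. (case_prod (simple_process (n m) (\<tau> m) (\<zeta> m)) z -
      case_prod U z)\<^sup>2 \<partial>on_horizon t) \<longlonglongrightarrow> 0"
      "(\<lambda>m. \<integral>\<omega>. (simple_ito_integral (W i) t (n m) (\<tau> m) (\<zeta> m) \<omega> - noise \<xi> X U t \<omega>)\<^sup>2 \<partial>M) \<longlonglongrightarrow> 0"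
    by (rule ito_approximation[OF ito_processD(7)[OF p t] i t ito_processD(5)[OF p]]) (rule that; assumption)
  obtain n' \<tau>' \<zeta>' where na': "\<And>m. nonanticipating G (n' m) (\<tau>' m) (\<zeta>' m)"
    and lim': "(\<lambda>m. \<integral>z. (case_prod (simple_process (n' m) (\<tau>' m) (\<zeta>' m)) z -
      case_prod V z)\<^sup>2 \<partial>on_horizon t) \<longlonglongrightarrow> 0"
      "(\<lambda>m. \<integral>\<omega>. (simple_ito_integral (W j) t (n' m) (\<tau>' m) (\<zeta>' m) \<omega> - noise \<eta> Y V t \<omega>)\<^sup>2 \<partial>M) \<longlonglongrightarrow> 0"
    by (rule ito_approximation[OF ito_processD(7)[OF q t] j t ito_processD(5)[OF q]]) (rule that; assumption)
  have L1: "(\<lambda>m. \<integral>\<omega>. simple_ito_integral (W i) t (n m) (\<tau> m) (\<zeta> m) \<omega> *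
      simple_ito_integral (W j) t (n' m) (\<tau>' m) (\<zeta>' m) \<omega> \<partial>M)
      \<longlonglongrightarrow> (\<integral>\<omega>. noise \<xi> X U t \<omega> * noise \<eta> Y V t \<omega> \<partial>M)"
    by (rule sq_lim_mult[OF simple_ito_sq[OF na i t] ito_process_sq(2)[OF p t] lim(2)
          simple_ito_sq[OF na' j t] ito_process_sq(2)[OF q t] lim'(2)])
  have L2: "(\<lambda>m. \<integral>z. case_prod (simple_process (n m) (\<tau> m) (\<zeta> m)) z *
      case_prod (simple_process (n' m) (\<tau>' m) (\<zeta>' m)) z \<partial>on_horizon t)
      \<longlonglongrightarrow> (\<integral>z. case_prod U z * case_prod V z \<partial>on_horizon t)"
    by (rule sq_lim_mult[OF simple_process_sq[OF na] ito_process_sq(1)[OF p t] lim(1)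
          simple_process_sq[OF na'] ito_process_sq(1)[OF q t] lim'(1)])
  show ?thesis
  proof (cases "i = j")
    case True
    with L1[unfolded simple_isometry[OF na na' i j t]] show ?thesis
      using LIMSEQ_unique[OF _ L2] by simp
  next
    case False
    with L1[unfolded simple_isometry[OF na na' i j t]] show ?thesis
      by (simp add: LIMSEQ_const_iff)
  qed
qed

end

text \<open>Processes are frozen before time 0, so that time ranges over the whole line.\<close>

lemma measurable_extend_time:
  fixes u :: "real \<Rightarrow> 'w \<Rightarrow> real"
  assumes "(\<lambda>(t, \<omega>). u t \<omega>) \<in> borel_measurable (restrict_space borel {0..} \<Otimes>\<^sub>M M)"
  shows "(\<lambda>(t, \<omega>). u (max 0 t) \<omega>) \<in> borel_measurable (borel \<Otimes>\<^sub>M M)"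
proof -
  have "(\<lambda>z. (max 0 (fst z), snd z)) \<in> (borel :: real measure) \<Otimes>\<^sub>M M \<rightarrow>\<^sub>M restrict_space borel {0..} \<Otimes>\<^sub>M M"
    by (intro measurable_Pair measurable_restrict_space2) auto
  from measurable_compose[OF this assms] show ?thesis by (simp add: case_prod_beta')
qed

section \<open>From solutions of the state equation to the product rule in the mean\<close>

context agent_system
begin

text \<open>Centring by \<open>c\<close> cancels in the residual. The residual agrees with the given
  integral \<open>I\<close> only almost everywhere, so the sequence approximating \<open>I\<close>
  is reused for it.\<close>

lemma sde_ito_process:
  assumes sde: "sde_solution M G (W i) (x0 i) x u" and i: "i \<in> {1..N}" and x0: "sq_int M (x0 i)"
  shows "ito_process i (\<lambda>\<omega>. x0 i \<omega> - c) (\<lambda>t \<omega>. x (max 0 t) \<omega> - c) (\<lambda>t. u (max 0 t))"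
  unfolding ito_process_def
proof (intro conjI allI impI)
  show "i \<in> {1..N}" by fact
  have "x0 i \<in> borel_measurable (G 0)" using compatible i by (auto simp: compatible_filtration_def)
  then show "(\<lambda>\<omega>. x0 i \<omega> - c) \<in> borel_measurable (G 0)" by simp
  show sx: "sq_int M (\<lambda>\<omega>. x0 i \<omega> - c)" by (intro sq_int_diff x0 sq_int_const)
  have mx: "(\<lambda>(t, \<omega>). x (max 0 t) \<omega>) \<in> borel_measurable (borel \<Otimes>\<^sub>M M)"
    using sde by (intro measurable_extend_time) (simp add: sde_solution_def)
  have "(\<lambda>z. (\<lambda>(t, \<omega>). x (max 0 t) \<omega>) z - c) \<in> borel_measurable (borel \<Otimes>\<^sub>M M)"
    using mx by simp
  then show "(\<lambda>(t, \<omega>). x (max 0 t) \<omega> - c) \<in> borel_measurable (borel \<Otimes>\<^sub>M M)"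
    by (simp add: case_prod_beta)
  show mu: "(\<lambda>(t, \<omega>). u (max 0 t) \<omega>) \<in> borel_measurable (borel \<Otimes>\<^sub>M M)"
    using sde by (intro measurable_extend_time) (simp add: sde_solution_def)
  fix t :: real assume t: "0 \<le> t"
  show "u (max 0 t) \<in> borel_measurable (G t)" using sde t by (simp add: sde_solution_def)
  obtain I where I: "has_ito_integral M G (W i) t u I"
    and xt: "AE \<omega> in M. x t \<omega> = x0 i \<omega> + (LBINT s:{0..t}. u s \<omega>) + I \<omega>"
    using sde t unfolding sde_solution_def by blast
  have Im: "I \<in> borel_measurable M" using I by (simp add: has_ito_integral_def)
  let ?J = "\<lambda>\<omega>. x (max 0 t) \<omega> - c - (x0 i \<omega> - c) - drift (\<lambda>t. u (max 0 t)) t \<omega>"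
  have "drift (\<lambda>t. u (max 0 t)) t \<omega> = (LBINT s:{0..t}. u s \<omega>)" if "\<omega> \<in> space M" for \<omega>
    unfolding drift_def set_lebesgue_integral_def integral_horizon[OF drift_measurable_section(2)[OF mu that]]
    by (intro Lint_cong) (auto simp: indicator_def)
  with xt have J: "AE \<omega> in M. ?J \<omega> = I \<omega>"
    using AE_space t by (auto elim!: eventually_elim2)
  have "sq_int M (x0 i)" by fact
  then have Jm: "?J \<in> borel_measurable M"
    using drift_measurable_section(1)[OF mu, of t] measurable_Pair2[OF mx, of t]
    by (auto simp: sq_int_def)
  obtain n \<tau> \<xi> where "\<And>m. nonanticipating G (n m) (\<tau> m) (\<xi> m)"
    and l1: "(\<lambda>m. \<integral>\<^sup>+\<omega>. (\<integral>\<^sup>+s\<in>{0..t}. ennreal ((simple_process (n m) (\<tau> m) (\<xi> m) s \<omega> - u s \<omega>)\<^sup>2) \<partial>lborel) \<partial>M)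
          \<longlonglongrightarrow> 0"
    and l2: "(\<lambda>m. \<integral>\<^sup>+\<omega>. ennreal ((simple_ito_integral (W i) t (n m) (\<tau> m) (\<xi> m) \<omega> - I \<omega>)\<^sup>2) \<partial>M) \<longlonglongrightarrow> 0"
    using I unfolding has_ito_integral_def by blast
  moreover have "(\<integral>\<^sup>+\<omega>. (\<integral>\<^sup>+s\<in>{0..t}. ennreal ((simple_process (n m) (\<tau> m) (\<xi> m) s \<omega> - u s \<omega>)\<^sup>2) \<partial>lborel) \<partial>M) =
     (\<integral>\<^sup>+\<omega>. (\<integral>\<^sup>+s\<in>{0..t}. ennreal ((simple_process (n m) (\<tau> m) (\<xi> m) s \<omega> - u (max 0 s) \<omega>)\<^sup>2) \<partial>lborel) \<partial>M)" for m
    by (intro nn_integral_cong) (auto simp: indicator_def)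
  moreover have "(\<integral>\<^sup>+\<omega>. ennreal ((simple_ito_integral (W i) t (n m) (\<tau> m) (\<xi> m) \<omega> - I \<omega>)\<^sup>2) \<partial>M) =
     (\<integral>\<^sup>+\<omega>. ennreal ((simple_ito_integral (W i) t (n m) (\<tau> m) (\<xi> m) \<omega> - ?J \<omega>)\<^sup>2) \<partial>M)" for m
    using J by (intro nn_integral_cong_AE) (auto elim!: eventually_mono)
  ultimately show "has_ito_integral M G (W i) t (\<lambda>t. u (max 0 t)) ?J"
    unfolding has_ito_integral_def using Jm
    by (intro conjI exI[of _ n] exI[of _ \<tau>] exI[of _ \<xi>]) auto
qed

lemma noise_measurable:
  assumes p: "ito_process i \<xi> X U"
  shows "(\<lambda>(t, \<omega>). noise \<xi> X U t \<omega>) \<in> borel_measurable (borel \<Otimes>\<^sub>M M)"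
proof -
  have [measurable]: "\<xi> \<in> borel_measurable M" using ito_processD(3)[OF p] by (simp add: sq_int_def)
  have "(\<lambda>z. case_prod X z - \<xi> (snd z) - case_prod (drift U) z) \<in> borel_measurable (borel \<Otimes>\<^sub>M M)"
    using ito_processD(4)[OF p] drift_measurable[OF ito_processD(5)[OF p]] by measurable
  then show ?thesis by (simp add: case_prod_beta)
qed

lemma noise_sq_horizon:
  assumes p: "ito_process i \<xi> X U" and T: "0 \<le> T"
  shows "sq_int (on_horizon T) (\<lambda>(t, \<omega>). noise \<xi> X U t \<omega>)"
proof (rule sq_int_horizonI[OF noise_measurable[OF p]])
  fix t assume t: "0 \<le> t" "t \<le> T"
  have "(\<integral>\<omega>. (noise \<xi> X U t \<omega>)\<^sup>2 \<partial>M) = (\<integral>z. (case_prod U z)\<^sup>2 \<partial>on_horizon t)"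
    using noise_product[OF p p t(1)] by (simp add: power2_eq_square)
  also have "\<dots> \<le> (\<integral>z. (case_prod U z)\<^sup>2 \<partial>on_horizon T)"
    by (rule sq_int_horizon_mono(2)[OF t(2) ito_process_sq(1)[OF p T]])
  finally show "(\<integral>\<^sup>+\<omega>. ennreal (((\<lambda>(t, \<omega>). noise \<xi> X U t \<omega>) (t, \<omega>))\<^sup>2) \<partial>M) \<le>
      ennreal (\<integral>z. (case_prod U z)\<^sup>2 \<partial>on_horizon T)"
    using sq_int_nn[OF ito_process_sq(2)[OF p t(1)]] by (simp add: ennreal_leI)
qed

lemma state_sq:
  assumes p: "ito_process i \<xi> X U" and T: "0 \<le> T"
  shows "sq_int M (X T)" "sq_int (on_horizon T) (case_prod X)"
proof -
  note U = ito_process_sq(1)[OF p T]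
  have "sq_int M (\<lambda>\<omega>. noise \<xi> X U T \<omega> + (\<xi> \<omega> + drift U T \<omega>))"
    by (intro sq_int_add ito_process_sq(2)[OF p T] ito_processD(3)[OF p] drift_sq_int(1)[OF U T order.refl])
  then show "sq_int M (X T)" by (simp add: sq_int_def)
  have "sq_int (on_horizon T) (\<lambda>z. (\<lambda>(t, \<omega>). noise \<xi> X U t \<omega>) z + (\<xi> (snd z) + case_prod (drift U) z))"
    by (intro sq_int_add noise_sq_horizon[OF p T] sq_int_weighted_const weight_horizon ito_processD(3)[OF p] drift_sq_int(2)[OF U])
  then show "sq_int (on_horizon T) (case_prod X)"
    by (simp add: case_prod_beta')
qed

text \<open>The martingale part may be evaluated at the time of the control it is paired with.\<close>

lemma martingale_part_pairing:
  assumes p: "ito_process i \<xi> X U" and q: "ito_process j \<eta> Y V" and t: "0 \<le> t"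
  shows "(\<integral>\<omega>. drift U t \<omega> * (\<eta> \<omega> + noise \<eta> Y V t \<omega>) \<partial>M) =
    (\<integral>z. case_prod U z * (\<lambda>(t, \<omega>). Y t \<omega> - drift V t \<omega>) z \<partial>on_horizon t)"
proof -
  note U = ito_process_sq(1)[OF p t] and V = ito_process_sq(1)[OF q t]
  have Z: "sq_int M (\<lambda>\<omega>. \<eta> \<omega> + noise \<eta> Y V t \<omega>)"
    by (intro sq_int_add ito_processD(3)[OF q] ito_process_sq(2)[OF q t])
  have Z': "sq_int (on_horizon t) (\<lambda>(t, \<omega>). Y t \<omega> - drift V t \<omega>)"
    using sq_int_diff[OF state_sq(2)[OF q t] drift_sq_int(2)[OF V]] by (simp add: case_prod_beta')
  note i1 = integral_weighted_fst[OF weight_horizon sq_int_mult[OF U sq_int_weighted_const[OF weight_horizon Z]]]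
  note i2 = integral_weighted_fst[OF weight_horizon sq_int_mult[OF U Z']]
  have "(\<integral>\<omega>. drift U t \<omega> * (\<eta> \<omega> + noise \<eta> Y V t \<omega>) \<partial>M) =
    (\<integral>s. (\<integral>\<omega>. U s \<omega> * (\<eta> \<omega> + noise \<eta> Y V t \<omega>) \<partial>M) \<partial>horizon t)"
    using drift_pairing[OF U Z] i1(1) by simp
  \<comment> \<open>For almost every \<open>s\<close> the variable \<open>U s\<close> is square
    integrable, and it is known at time \<open>s\<close>; the martingale property then moves the
    noise from \<open>t\<close> back to \<open>s\<close>, where \<open>\<eta>\<close> plus noise is
    \<open>Y s - drift V s\<close>.\<close>
  also have "\<dots> = (\<integral>s. (\<integral>\<omega>. U s \<omega> * (Y s \<omega> - drift V s \<omega>) \<partial>M) \<partial>horizon t)"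
  proof (rule integral_cong_AE)
    show "(\<lambda>s. \<integral>\<omega>. U s \<omega> * (\<eta> \<omega> + noise \<eta> Y V t \<omega>) \<partial>M) \<in> borel_measurable (horizon t)"
      using borel_measurable_integrable[OF i1(3)] by simp
    show "(\<lambda>s. \<integral>\<omega>. U s \<omega> * (Y s \<omega> - drift V s \<omega>) \<partial>M) \<in> borel_measurable (horizon t)"
      using borel_measurable_integrable[OF i2(3)] by simp
    have "AE s in horizon t. 0 \<le> s \<and> s \<le> t" by (rule AE_horizonI) simp
    then show "AE s in horizon t. (\<integral>\<omega>. U s \<omega> * (\<eta> \<omega> + noise \<eta> Y V t \<omega>) \<partial>M) =
        (\<integral>\<omega>. U s \<omega> * (Y s \<omega> - drift V s \<omega>) \<partial>M)"
      using sq_int_weighted_section(1)[OF weight_horizon U]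
    proof eventually_elim
      case (elim s)
      then have s: "0 \<le> s" "s \<le> t" and us: "sq_int M (U s)" by auto
      have e: "(\<integral>\<omega>. U s \<omega> * (\<eta> \<omega> + noise \<eta> Y V v \<omega>) \<partial>M) =
          (\<integral>\<omega>. U s \<omega> * \<eta> \<omega> \<partial>M) + (\<integral>\<omega>. U s \<omega> * noise \<eta> Y V v \<omega> \<partial>M)" if "0 \<le> v" for v
        using Lint_add[OF sq_int_mult[OF us ito_processD(3)[OF q]]
            sq_int_mult[OF us ito_process_sq(2)[OF q that]]]
        by (simp only: distrib_left)
      have "(\<integral>\<omega>. U s \<omega> * (\<eta> \<omega> + noise \<eta> Y V t \<omega>) \<partial>M) = (\<integral>\<omega>. U s \<omega> * (\<eta> \<omega> + noise \<eta> Y V s \<omega>) \<partial>M)"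
        unfolding e[OF t] e[OF s(1)] noise_martingale[OF q s ito_processD(6)[OF p s(1)] us] ..
      then show ?case by simp
    qed
  qed
  also have "\<dots> = (\<integral>z. case_prod U z * (\<lambda>(t, \<omega>). Y t \<omega> - drift V t \<omega>) z \<partial>on_horizon t)"
    using i2(1) by simp
  finally show ?thesis .
qed

text \<open>Each state is split into drift and martingale part. The mixed terms give the expected
  integrals with the full states, minus corrections containing a \<open>drift\<close>; these cancel
  exactly against the drift-drift term. The last summand is the mean of the bracket of the two
  noises.\<close>

lemma product_formula:
  assumes p: "ito_process i \<xi> X U" and q: "ito_process j \<eta> Y V" and t: "0 \<le> t"
  shows "(\<integral>\<omega>. X t \<omega> * Y t \<omega> \<partial>M) = (\<integral>\<omega>. \<xi> \<omega> * \<eta> \<omega> \<partial>M)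
    + (\<integral>z. case_prod U z * case_prod Y z \<partial>on_horizon t)
    + (\<integral>z. case_prod X z * case_prod V z \<partial>on_horizon t)
    + (if i = j then \<integral>z. case_prod U z * case_prod V z \<partial>on_horizon t else 0)"
proof -
  note U = ito_process_sq(1)[OF p t] and V = ito_process_sq(1)[OF q t]
  define A where "A = drift U t"
  define B where "B = drift V t"
  define P where "P \<omega> = \<xi> \<omega> + noise \<xi> X U t \<omega>" for \<omega>
  define Q where "Q \<omega> = \<eta> \<omega> + noise \<eta> Y V t \<omega>" for \<omega>
  have sq: "sq_int M A" "sq_int M B" "sq_int M P" "sq_int M Q"
    unfolding A_def B_def P_def[abs_def] Q_def[abs_def]
    by (intro sq_int_add drift_sq_int(1)[OF U t order.refl] drift_sq_int(1)[OF V t order.refl]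
      ito_processD(3)[OF p] ito_processD(3)[OF q] ito_process_sq(2)[OF p t] ito_process_sq(2)[OF q t])+
  have "(\<integral>\<omega>. X t \<omega> * Y t \<omega> \<partial>M) = (\<integral>\<omega>. A \<omega> * B \<omega> + A \<omega> * Q \<omega> + B \<omega> * P \<omega> + P \<omega> * Q \<omega> \<partial>M)"
    by (intro Lint_cong) (auto simp: A_def B_def P_def Q_def algebra_simps)
  also have "\<dots> = (\<integral>\<omega>. A \<omega> * B \<omega> \<partial>M) + (\<integral>\<omega>. A \<omega> * Q \<omega> \<partial>M) + (\<integral>\<omega>. B \<omega> * P \<omega> \<partial>M) + (\<integral>\<omega>. P \<omega> * Q \<omega> \<partial>M)"
    using sq_int_mult[OF sq(1,2)] sq_int_mult[OF sq(1,4)] sq_int_mult[OF sq(2,3)] sq_int_mult[OF sq(3,4)] by simp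
  also have "(\<integral>\<omega>. P \<omega> * Q \<omega> \<partial>M) = (\<integral>\<omega>. \<xi> \<omega> * \<eta> \<omega> \<partial>M)
    + (if i = j then \<integral>z. case_prod U z * case_prod V z \<partial>on_horizon t else 0)"
  proof -
    define Z where "Z \<omega> = noise \<xi> X U t \<omega>" for \<omega>
    define Z' where "Z' \<omega> = noise \<eta> Y V t \<omega>" for \<omega>
    have sZ: "sq_int M Z" "sq_int M Z'"
      using ito_process_sq(2)[OF p t] ito_process_sq(2)[OF q t] by (simp_all add: Z_def[abs_def] Z'_def[abs_def])
    note sx = ito_processD(3)[OF p] ito_processD(3)[OF q]
    have z: "(\<integral>\<omega>. \<xi> \<omega> * Z' \<omega> \<partial>M) = 0" "(\<integral>\<omega>. \<eta> \<omega> * Z \<omega> \<partial>M) = 0"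
      using noise_initial[OF q t ito_processD(2)[OF p] sx(1)] noise_initial[OF p t ito_processD(2)[OF q] sx(2)]
      by (auto simp: Z_def Z'_def)
    have "(\<integral>\<omega>. P \<omega> * Q \<omega> \<partial>M) = (\<integral>\<omega>. \<xi> \<omega> * \<eta> \<omega> + \<xi> \<omega> * Z' \<omega> + \<eta> \<omega> * Z \<omega> + Z \<omega> * Z' \<omega> \<partial>M)"
      by (intro Lint_cong) (auto simp: P_def Q_def Z_def Z'_def algebra_simps)
    also have "\<dots> = (\<integral>\<omega>. \<xi> \<omega> * \<eta> \<omega> \<partial>M) + (\<integral>\<omega>. Z \<omega> * Z' \<omega> \<partial>M)"
      using sq_int_mult[OF sx] sq_int_mult[OF sx(1) sZ(2)] sq_int_mult[OF sx(2) sZ(1)] sq_int_mult[OF sZ] z by simp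
    finally show ?thesis using noise_product[OF p q t] by (simp add: Z_def Z'_def)
  qed
  also have "(\<integral>\<omega>. A \<omega> * Q \<omega> \<partial>M) =
    (\<integral>z. case_prod U z * (case_prod Y z - case_prod (drift V) z) \<partial>on_horizon t)"
    using martingale_part_pairing[OF p q t] by (simp add: A_def Q_def case_prod_beta')
  also have "\<dots> = (\<integral>z. case_prod U z * case_prod Y z \<partial>on_horizon t)
      - (\<integral>z. case_prod U z * case_prod (drift V) z \<partial>on_horizon t)"
    using Bochner_Integration.integral_diff[OF sq_int_mult[OF U state_sq(2)[OF q t]]
        sq_int_mult[OF U drift_sq_int(2)[OF V]]]
    by (simp only: right_diff_distrib)
  also have "(\<integral>\<omega>. B \<omega> * P \<omega> \<partial>M) =
    (\<integral>z. (case_prod X z - case_prod (drift U) z) * case_prod V z \<partial>on_horizon t)"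
    using martingale_part_pairing[OF q p t] by (simp add: B_def P_def case_prod_beta' mult.commute)
  also have "\<dots> = (\<integral>z. case_prod X z * case_prod V z \<partial>on_horizon t)
      - (\<integral>z. case_prod (drift U) z * case_prod V z \<partial>on_horizon t)"
    using Bochner_Integration.integral_diff[OF sq_int_mult[OF state_sq(2)[OF p t] V]
        sq_int_mult[OF drift_sq_int(2)[OF U] V]]
    by (simp only: left_diff_distrib)
  also have "(\<integral>\<omega>. A \<omega> * B \<omega> \<partial>M) =
    (\<integral>z. case_prod U z * case_prod (drift V) z \<partial>on_horizon t) +
    (\<integral>z. case_prod (drift U) z * case_prod V z \<partial>on_horizon t)"
    unfolding A_def B_def by (rule drift_product[OF U V])
  finally show ?thesis by simp
qed

end

section \<open>Discounting\<close>

abbreviation discount :: "real \<Rightarrow> real \<Rightarrow> real" where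
  "discount \<rho> \<equiv> \<lambda>t. indicator {0..} t * exp (- \<rho> * t)"

abbreviation discounted :: "real \<Rightarrow> real measure" where
  "discounted \<rho> \<equiv> weighted (discount \<rho>)"

abbreviation (in prob_space) on_discount :: "real \<Rightarrow> (real \<times> 'a) measure" where
  "on_discount \<rho> \<equiv> discounted \<rho> \<Otimes>\<^sub>M M"

lemma nn_integral_exp_tail:
  assumes "0 < \<rho>"
  shows "(\<integral>\<^sup>+t. ennreal (indicator {s..} t * exp (- \<rho> * t)) \<partial>lborel) = ennreal (exp (- \<rho> * s) / \<rho>)"
proof -
  have "(\<integral>\<^sup>+t. ennreal (exp (- \<rho> * t)) * indicator {s..} t \<partial>lborel) = ennreal (0 - (- (exp (- \<rho> * s) / \<rho>)))"
  proof (rule nn_integral_FTC_atLeast)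
    show "((\<lambda>t. - (exp (- \<rho> * t) / \<rho>)) has_real_derivative exp (- \<rho> * t)) (at t)" for t
      using assms by (auto intro!: derivative_eq_intros)
    have "((\<lambda>t. exp (- \<rho> * t)) \<longlongrightarrow> 0) at_top"
      using assms by real_asymp
    then have "((\<lambda>t. - (exp (- \<rho> * t) / \<rho>)) \<longlongrightarrow> - (0 / \<rho>)) at_top"
      by (intro tendsto_minus tendsto_divide tendsto_const) (use assms in auto)
    then show "((\<lambda>t. - (exp (- \<rho> * t) / \<rho>)) \<longlongrightarrow> 0) at_top" by simp
  qed auto
  moreover have "ennreal (indicator {s..} t * exp (- \<rho> * t)) = ennreal (exp (- \<rho> * t)) * indicator {s..} t" for t
    by (auto simp: indicator_def)
  ultimately show ?thesis by simp
qed

lemma weight_discount: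
  assumes "0 < \<rho>"
  shows "weight (discount \<rho>)"
proof -
  have "integrable lborel (discount \<rho>)"
    using nn_integral_exp_tail[OF assms, of 0] by (intro integrableI_nonneg) auto
  then show ?thesis by (auto simp: weight_def)
qed

lemma integral_discount_tail:
  fixes \<rho> s :: real
  assumes "0 < \<rho>"
  shows "(\<integral>t. indicator {s..} t * exp (- \<rho> * t) \<partial>lborel) = exp (- \<rho> * s) / \<rho>"
  using nn_integral_exp_tail[OF assms, of s] assms
  by (intro integral_eq_nn_integral[THEN trans]) auto

lemma AE_discountI:
  assumes "\<And>t. 0 \<le> t \<Longrightarrow> P t"
  shows "AE t in discounted \<rho>. P t"
  unfolding weighted_def by (subst AE_density) (auto simp: assms indicator_def)

text \<open>After exchanging the integrals, time \<open>s\<close> is weighted by the discount tail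
  from \<open>s\<close> on, which is \<open>exp (- \<rho> * s) / \<rho>\<close>.\<close>

lemma nn_integral_discount_cumulative:
  assumes \<rho>: "0 < \<rho>" and [measurable]: "\<phi> \<in> borel_measurable borel"
  shows "(\<integral>\<^sup>+t. (\<integral>\<^sup>+s. \<phi> s \<partial>horizon t) \<partial>discounted \<rho>) = ennreal (1 / \<rho>) * (\<integral>\<^sup>+s. \<phi> s \<partial>discounted \<rho>)"
proof -
  interpret D: finite_measure "discounted \<rho>" by (rule weightD[OF weight_discount[OF \<rho>]])
  interpret P: pair_sigma_finite "discounted \<rho>" lborel ..
  define f where "f z = (if 0 \<le> snd z \<and> snd z \<le> fst z then \<phi> (snd z) else 0)" for z
  have [measurable]: "f \<in> borel_measurable (discounted \<rho> \<Otimes>\<^sub>M lborel)"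
    unfolding f_def[abs_def] by measurable
  have "(\<integral>\<^sup>+t. (\<integral>\<^sup>+s. \<phi> s \<partial>horizon t) \<partial>discounted \<rho>) =
    (\<integral>\<^sup>+t. (\<integral>\<^sup>+s. f (t, s) \<partial>lborel) \<partial>discounted \<rho>)"
    by (intro nn_integral_cong, subst nn_integral_weighted) (auto simp: f_def indicator_def intro!: nn_integral_cong)
  also have "\<dots> = (\<integral>\<^sup>+s. (\<integral>\<^sup>+t. f (t, s) \<partial>discounted \<rho>) \<partial>lborel)"
    by (rule P.Fubini[symmetric]) simp
  also have "\<dots> = (\<integral>\<^sup>+s. ennreal (1 / \<rho>) * (ennreal (discount \<rho> s) * \<phi> s) \<partial>lborel)"
  proof (rule nn_integral_cong)
    fix s :: real
    show "(\<integral>\<^sup>+t. f (t, s) \<partial>discounted \<rho>) = ennreal (1 / \<rho>) * (ennreal (discount \<rho> s) * \<phi> s)"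
    proof (cases "0 \<le> s")
      case True
      have "(\<integral>\<^sup>+t. f (t, s) \<partial>discounted \<rho>) = (\<integral>\<^sup>+t. ennreal (indicator {s..} t * exp (- \<rho> * t)) * \<phi> s \<partial>lborel)"
        using True unfolding f_def fst_conv snd_conv
        by (subst nn_integral_weighted) (auto simp: indicator_def intro!: nn_integral_cong)
      also have "\<dots> = ennreal (exp (- \<rho> * s) / \<rho>) * \<phi> s"
        by (subst nn_integral_multc) (simp_all only: nn_integral_exp_tail[OF \<rho>], measurable)
      finally show ?thesis using True \<rho> by (simp add: ennreal_mult[symmetric] mult.assoc[symmetric])
    next
      case False
      then show ?thesis by (simp add: f_def)
    qed
  qed
  also have "\<dots> = ennreal (1 / \<rho>) * (\<integral>\<^sup>+s. \<phi> s \<partial>discounted \<rho>)"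
    by (subst nn_integral_cmult) (auto simp: nn_integral_weighted)
  finally show ?thesis .
qed

text \<open>The nonnegative version, applied to the absolute value of \<open>\<phi>\<close>,
  provides the integrability that the signed exchange needs.\<close>

lemma integral_discount_cumulative:
  fixes \<phi> :: "real \<Rightarrow> real"
  assumes \<rho>: "0 < \<rho>" and [measurable]: "\<phi> \<in> borel_measurable borel"
    and \<phi>: "integrable (discounted \<rho>) \<phi>"
  shows "integrable (discounted \<rho>) (\<lambda>t. \<integral>s. \<phi> s \<partial>horizon t)"
    and "(\<integral>t. (\<integral>s. \<phi> s \<partial>horizon t) \<partial>discounted \<rho>) = (\<integral>s. \<phi> s \<partial>discounted \<rho>) / \<rho>"
proof -
  interpret D: finite_measure "discounted \<rho>" by (rule weightD[OF weight_discount[OF \<rho>]])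
  interpret P: pair_sigma_finite "discounted \<rho>" lborel ..
  define f where "f z = (if 0 \<le> snd z \<and> snd z \<le> fst z then \<phi> (snd z) else 0)" for z
  have [measurable]: "f \<in> borel_measurable (discounted \<rho> \<Otimes>\<^sub>M lborel)"
    unfolding f_def[abs_def] by measurable
  have inner: "(\<integral>s. \<phi> s \<partial>horizon t) = (\<integral>s. f (t, s) \<partial>lborel)" for t
    by (subst integral_horizon) (auto simp: f_def indicator_def intro!: Lint_cong)
  have "(\<integral>\<^sup>+z. ennreal (norm (f z)) \<partial>(discounted \<rho> \<Otimes>\<^sub>M lborel)) =
    (\<integral>\<^sup>+t. (\<integral>\<^sup>+s. ennreal (norm (f (t, s))) \<partial>lborel) \<partial>discounted \<rho>)"
    by (rule lborel.nn_integral_fst[symmetric]) simp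
  also have "\<dots> = (\<integral>\<^sup>+t. (\<integral>\<^sup>+s. ennreal \<bar>\<phi> s\<bar> \<partial>horizon t) \<partial>discounted \<rho>)"
    by (intro nn_integral_cong, subst nn_integral_weighted) (auto simp: f_def indicator_def intro!: nn_integral_cong)
  also have "\<dots> = ennreal (1 / \<rho>) * (\<integral>\<^sup>+s. ennreal \<bar>\<phi> s\<bar> \<partial>discounted \<rho>)"
    by (rule nn_integral_discount_cumulative[OF \<rho>]) simp
  also have "\<dots> < \<infinity>"
    using \<phi> by (auto simp: integrable_iff_bounded ennreal_mult_less_top)
  finally have f: "integrable (discounted \<rho> \<Otimes>\<^sub>M lborel) f"
    by (intro integrableI_bounded) auto
  show "integrable (discounted \<rho>) (\<lambda>t. \<integral>s. \<phi> s \<partial>horizon t)"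
    unfolding inner by (rule P.integrable_fst'[OF f])
  have sec: "(\<integral>t. f (t, s) \<partial>discounted \<rho>) = (discount \<rho> s * \<phi> s) / \<rho>" for s
  proof (cases "0 \<le> s")
    case True
    have "(\<integral>t. f (t, s) \<partial>discounted \<rho>) = (\<integral>t. discount \<rho> t * f (t, s) \<partial>lborel)"
      by (rule integral_weighted) (auto simp: f_def)
    also have "\<dots> = (\<integral>t. (indicator {s..} t * exp (- \<rho> * t)) * \<phi> s \<partial>lborel)"
      using True by (intro Lint_cong) (auto simp: f_def indicator_def)
    also have "\<dots> = exp (- \<rho> * s) / \<rho> * \<phi> s"
      using integral_discount_tail[OF \<rho>, of s] by simp
    finally show ?thesis using True by simp
  next
    case False
    then show ?thesis by (simp add: f_def)
  qed
  have "(\<integral>t. (\<integral>s. \<phi> s \<partial>horizon t) \<partial>discounted \<rho>) = (\<integral>z. f z \<partial>(discounted \<rho> \<Otimes>\<^sub>M lborel))"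
    unfolding inner by (rule P.integral_fst'[OF f])
  also have "\<dots> = (\<integral>s. (\<integral>t. f (t, s) \<partial>discounted \<rho>) \<partial>lborel)"
    using P.integral_snd[of "\<lambda>t s. f (t, s)"] f by simp
  also have "\<dots> = (\<integral>s. \<phi> s \<partial>discounted \<rho>) / \<rho>"
    unfolding sec by (subst integral_weighted) auto
  finally show "(\<integral>t. (\<integral>s. \<phi> s \<partial>horizon t) \<partial>discounted \<rho>) = (\<integral>s. \<phi> s \<partial>discounted \<rho>) / \<rho>" .
qed

text \<open>\<open>drift_bound\<close> is used with half the discount rate,
  \<open>c = \<rho> / 2\<close>. One half of the discount absorbs \<open>exp (c * t) / c\<close>,
  the bound for the first factor. The other half discounts the cumulative second factor and costs
  another \<open>1 / c\<close>. Together this is \<open>1 / c^2 = 4 / \<rho>^2\<close>.\<close>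

lemma discounted_Hardy:
  fixes f :: "real \<Rightarrow> real"
  assumes \<rho>: "0 < \<rho>" and f [measurable]: "f \<in> borel_measurable borel"
  shows "(\<integral>\<^sup>+t. ennreal ((\<integral>s. f s \<partial>horizon t)\<^sup>2) \<partial>discounted \<rho>) \<le>
    ennreal (4 / \<rho>\<^sup>2) * (\<integral>\<^sup>+s. ennreal ((f s)\<^sup>2) \<partial>discounted \<rho>)"
proof -
  define c where "c = \<rho> / 2"
  have c: "0 < c" using \<rho> by (simp add: c_def)
  have split: "ennreal (discount \<rho> t) * ennreal (exp (c * t)) = ennreal (discount c t)" for t
    by (simp add: ennreal_mult[symmetric] c_def mult.assoc exp_add[symmetric])
  have split': "ennreal (discount c s) * ennreal (exp (- c * s) * x) = ennreal (discount \<rho> s) * ennreal x"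
    if "0 \<le> x" for s x
  proof -
    have "exp (- c * s) * exp (- c * s) = exp (- \<rho> * s)"
      by (simp add: c_def exp_add[symmetric])
    then have "discount c s * (exp (- c * s) * x) = discount \<rho> s * x"
      by (simp add: mult.assoc[symmetric] mult.commute[of _ "indicator _ _"])
    then show ?thesis using that by (simp add: ennreal_mult[symmetric] del: mult_eq_0_iff)
  qed
  have E: "(\<integral>\<^sup>+s. ennreal (exp (c * s)) \<partial>horizon t) \<le> ennreal (1 / c) * ennreal (exp (c * t))" for t
  proof (cases "0 \<le> t")
    case True
    have "(\<integral>\<^sup>+s. ennreal (exp (c * s)) \<partial>horizon t) = (\<integral>\<^sup>+s. ennreal (exp (c * s)) * indicator {0..t} s \<partial>lborel)"
      by (subst nn_integral_weighted) (auto simp: ennreal_indicator mult.commute)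
    also have "\<dots> = ennreal (exp (c * t) / c - exp (c * 0) / c)"
      by (rule nn_integral_FTC_Icc) (use True c in \<open>auto intro!: derivative_eq_intros\<close>)
    also have "\<dots> \<le> ennreal (exp (c * t) / c)" using c by (intro ennreal_leI) auto
    finally show ?thesis using c by (simp add: ennreal_mult[symmetric])
  next
    case False
    then show ?thesis by (subst nn_integral_weighted) auto
  qed
  have pr: "(\<lambda>t. \<integral>\<^sup>+s. ennreal (exp (- c * s) * (f s)\<^sup>2) \<partial>horizon t) \<in> borel_measurable borel"
  proof -
    have "(\<lambda>t. \<integral>\<^sup>+s. ennreal (exp (- c * s) * (f s)\<^sup>2) \<partial>horizon t) =
      (\<lambda>t. \<integral>\<^sup>+s. (if 0 \<le> s \<and> s \<le> t then ennreal (exp (- c * s) * (f s)\<^sup>2) else 0) \<partial>lborel)"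
      by (rule ext, subst nn_integral_weighted) (auto simp: indicator_def intro!: nn_integral_cong)
    then show ?thesis by simp
  qed
  note [measurable] = pr measurable_cumulative[OF f]
  have "(\<integral>\<^sup>+t. ennreal ((\<integral>s. f s \<partial>horizon t)\<^sup>2) \<partial>discounted \<rho>) =
    (\<integral>\<^sup>+t. ennreal (discount \<rho> t) * ennreal ((\<integral>s. f s \<partial>horizon t)\<^sup>2) \<partial>lborel)"
    by (rule nn_integral_weighted) auto
  also have "\<dots> \<le> (\<integral>\<^sup>+t. ennreal (1 / c) *
     (ennreal (discount c t) * (\<integral>\<^sup>+s. ennreal (exp (- c * s) * (f s)\<^sup>2) \<partial>horizon t)) \<partial>lborel)"
  proof (rule nn_integral_mono)
    fix t
    have "ennreal ((\<integral>s. f s \<partial>horizon t)\<^sup>2) \<le>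
      (ennreal (1 / c) * ennreal (exp (c * t))) * (\<integral>\<^sup>+s. ennreal (exp (- c * s) * (f s)\<^sup>2) \<partial>horizon t)"
      by (rule order_trans[OF drift_bound[OF f, of t c]]) (intro mult_right_mono E, simp)
    then have "ennreal (discount \<rho> t) * ennreal ((\<integral>s. f s \<partial>horizon t)\<^sup>2) \<le> ennreal (discount \<rho> t) *
      ((ennreal (1 / c) * ennreal (exp (c * t))) * (\<integral>\<^sup>+s. ennreal (exp (- c * s) * (f s)\<^sup>2) \<partial>horizon t))"
      by (rule mult_left_mono) simp
    also have "\<dots> = ennreal (1 / c) * ((ennreal (discount \<rho> t) * ennreal (exp (c * t))) *
       (\<integral>\<^sup>+s. ennreal (exp (- c * s) * (f s)\<^sup>2) \<partial>horizon t))"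
      by (simp only: mult_ac)
    finally show "ennreal (discount \<rho> t) * ennreal ((\<integral>s. f s \<partial>horizon t)\<^sup>2) \<le> ennreal (1 / c) *
      (ennreal (discount c t) * (\<integral>\<^sup>+s. ennreal (exp (- c * s) * (f s)\<^sup>2) \<partial>horizon t))"
      by (simp only: split)
  qed
  also have "\<dots> = ennreal (1 / c) * (\<integral>\<^sup>+t. ennreal (discount c t) *
      (\<integral>\<^sup>+s. ennreal (exp (- c * s) * (f s)\<^sup>2) \<partial>horizon t) \<partial>lborel)"
    using pr by (intro nn_integral_cmult) simp
  also have "(\<integral>\<^sup>+t. ennreal (discount c t) * (\<integral>\<^sup>+s. ennreal (exp (- c * s) * (f s)\<^sup>2) \<partial>horizon t) \<partial>lborel) =
      (\<integral>\<^sup>+t. (\<integral>\<^sup>+s. ennreal (exp (- c * s) * (f s)\<^sup>2) \<partial>horizon t) \<partial>discounted c)"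
    using pr by (intro nn_integral_weighted[symmetric]) auto
  also have "\<dots> = ennreal (1 / c) * (\<integral>\<^sup>+s. ennreal (exp (- c * s) * (f s)\<^sup>2) \<partial>discounted c)"
    using nn_integral_discount_cumulative[OF c, of "\<lambda>s. ennreal (exp (- c * s) * (f s)\<^sup>2)"] by simp
  also have "(\<integral>\<^sup>+s. ennreal (exp (- c * s) * (f s)\<^sup>2) \<partial>discounted c) = (\<integral>\<^sup>+s. ennreal ((f s)\<^sup>2) \<partial>discounted \<rho>)"
    by (subst (1 2) nn_integral_weighted) (auto intro!: nn_integral_cong simp: split'[simplified])
  also have "ennreal (1 / c) * (ennreal (1 / c) * x) = ennreal (4 / \<rho>\<^sup>2) * x" for x
    using c \<rho> by (simp add: mult.assoc[symmetric] ennreal_mult[symmetric] c_def power2_eq_square)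
  finally show ?thesis .
qed

text \<open>No continuity of \<open>g\<close> is assumed: the equation supplies it, as an indefinite
  integral is continuous. The right-hand side is then differentiable, and its product with
  \<open>exp (- c * t)\<close> is constant.\<close>

lemma linear_integral_equation:
  fixes g :: "real \<Rightarrow> real"
  assumes int: "\<And>t. 0 \<le> t \<Longrightarrow> integrable (horizon t) g" and m: "g \<in> borel_measurable borel"
    and eq: "\<And>t. 0 \<le> t \<Longrightarrow> g t = a + c * (\<integral>s. g s \<partial>horizon t)" and T: "0 \<le> T"
  shows "g T = a * exp (c * T)"
proof -
  have si: "set_integrable lborel {0..t} g" if "0 \<le> t" for t
    using int[OF that] m by (simp add: integrable_weighted set_integrable_def)
  have hk: "(\<integral>s. g s \<partial>horizon t) = integral {0..t} g" if "0 \<le> t" for t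
    using set_borel_integral_eq_integral(2)[OF si[OF that]] m
    by (simp add: integral_horizon set_lebesgue_integral_def)
  have eq': "g t = a + c * integral {0..t} g" if "0 \<le> t" for t
    using eq[OF that] hk[OF that] by simp
  have "continuous_on {0..T} (\<lambda>t. a + c * integral {0..t} g)"
    by (intro continuous_intros indefinite_integral_continuous_1 set_borel_integral_eq_integral(1)[OF si[OF T]])
  then have cont: "continuous_on {0..T} g"
    using eq' by (subst continuous_on_cong[OF refl, of _ g "\<lambda>t. a + c * integral {0..t} g"]) auto
  have "\<exists>k. \<forall>t\<in>{0..T}. (a + c * integral {0..t} g) * exp (- c * t) = k"
  proof (rule has_field_derivative_zero_constant)
    fix t assume t: "t \<in> {0..T}"
    have "((\<lambda>t. (a + c * integral {0..t} g) * exp (- c * t)) has_real_derivative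
      (c * g t) * exp (- c * t) + (exp (- c * t) * (- c)) * (a + c * integral {0..t} g)) (at t within {0..T})"
      by (auto intro!: derivative_eq_intros integral_has_real_derivative[OF cont t])
    then show "((\<lambda>t. (a + c * integral {0..t} g) * exp (- c * t)) has_real_derivative 0) (at t within {0..T})"
      using eq'[of t] t by simp
  qed auto
  then obtain k where k: "\<And>t. t \<in> {0..T} \<Longrightarrow> (a + c * integral {0..t} g) * exp (- c * t) = k" by blast
  have "g T * exp (- c * T) = a" using k[of T] k[of 0] eq' T by simp
  then have "g T * (exp (- c * T) * exp (c * T)) = a * exp (c * T)" by (simp only: mult.assoc[symmetric])
  then show ?thesis by (simp add: exp_add[symmetric])
qed

section \<open>Discounted second moments of Ito processes\<close>

context agent_system
begin

text \<open>The drift is controlled path by path through \<open>discounted_Hardy\<close>. The second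
  moment of the noise is the cumulative energy of the control, by the isometry, and discounting it
  costs only \<open>1 / \<rho>\<close>.\<close>

lemma state_discounted:
  assumes p: "ito_process i \<xi> X U" and \<rho>: "0 < \<rho>"
    and U: "sq_int (on_discount \<rho>) (case_prod U)"
  shows "sq_int (on_discount \<rho>) (case_prod X)"
proof -
  note w = weight_discount[OF \<rho>]
  have mU [measurable]: "(case_prod U) \<in> borel_measurable (borel \<Otimes>\<^sub>M M)"
    by (rule ito_processD(5)[OF p])
  have mU2 [measurable]: "(\<lambda>z. ennreal ((case_prod U z)\<^sup>2)) \<in> borel_measurable (borel \<Otimes>\<^sub>M M)"
    by measurable
  have fin: "(\<integral>\<^sup>+z. ennreal ((case_prod U z)\<^sup>2) \<partial>on_discount \<rho>) < \<infinity>"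
    unfolding sq_int_nn[OF U] by simp
  have D: "sq_int (on_discount \<rho>) (case_prod (drift U))"
  proof (rule sq_intI_nn)
    note [measurable] = drift_measurable[OF mU]
    show "(case_prod (drift U)) \<in> borel_measurable (on_discount \<rho>)" by simp
    have "(\<integral>\<^sup>+z. ennreal ((case_prod (drift U) z)\<^sup>2) \<partial>on_discount \<rho>) =
      (\<integral>\<^sup>+\<omega>. (\<integral>\<^sup>+t. ennreal ((drift U t \<omega>)\<^sup>2) \<partial>discounted \<rho>) \<partial>M)"
      by (subst nn_integral_weighted_snd[OF w]) auto
    also have "\<dots> \<le> (\<integral>\<^sup>+\<omega>. ennreal (4 / \<rho>\<^sup>2) * (\<integral>\<^sup>+t. ennreal ((U t \<omega>)\<^sup>2) \<partial>discounted \<rho>) \<partial>M)"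
      unfolding drift_def by (intro nn_integral_mono discounted_Hardy[OF \<rho>] drift_measurable_section(2)[OF mU])
    also have "\<dots> = ennreal (4 / \<rho>\<^sup>2) * (\<integral>\<^sup>+z. ennreal ((case_prod U z)\<^sup>2) \<partial>on_discount \<rho>)"
      using nn_integral_weighted_cmult_snd[OF w mU2] by simp
    also have "\<dots> < \<infinity>" using fin by (simp add: ennreal_mult_less_top)
    finally show "(\<integral>\<^sup>+z. ennreal ((case_prod (drift U) z)\<^sup>2) \<partial>on_discount \<rho>) < \<infinity>" .
  qed
  have Z: "sq_int (on_discount \<rho>) (\<lambda>(t, \<omega>). noise \<xi> X U t \<omega>)"
  proof (rule sq_intI_nn)
    note [measurable] = noise_measurable[OF p]
    show "(\<lambda>(t, \<omega>). noise \<xi> X U t \<omega>) \<in> borel_measurable (on_discount \<rho>)" by simp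
    define \<phi> where "\<phi> s = (\<integral>\<^sup>+\<omega>. ennreal ((U s \<omega>)\<^sup>2) \<partial>M)" for s
    have m\<phi>: "\<phi> \<in> borel_measurable borel"
      unfolding \<phi>_def[abs_def] by measurable
    have "(\<integral>\<^sup>+z. ennreal (((\<lambda>(t, \<omega>). noise \<xi> X U t \<omega>) z)\<^sup>2) \<partial>on_discount \<rho>) =
      (\<integral>\<^sup>+t. (\<integral>\<^sup>+\<omega>. ennreal ((noise \<xi> X U t \<omega>)\<^sup>2) \<partial>M) \<partial>discounted \<rho>)"
      by (subst nn_integral_weighted_fst[OF w]) auto
    also have "\<dots> = (\<integral>\<^sup>+t. (\<integral>\<^sup>+s. \<phi> s \<partial>horizon t) \<partial>discounted \<rho>)"
    proof (intro nn_integral_cong_AE AE_discountI)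
      fix t :: real assume t: "0 \<le> t"
      have "(\<integral>\<^sup>+\<omega>. ennreal ((noise \<xi> X U t \<omega>)\<^sup>2) \<partial>M) = ennreal (\<integral>z. (case_prod U z)\<^sup>2 \<partial>on_horizon t)"
        using noise_product[OF p p t] unfolding sq_int_nn[OF ito_process_sq(2)[OF p t]]
        by (simp add: power2_eq_square)
      also have "\<dots> = (\<integral>\<^sup>+z. ennreal ((case_prod U z)\<^sup>2) \<partial>on_horizon t)"
        by (rule sq_int_nn[OF ito_process_sq(1)[OF p t], symmetric])
      also have "\<dots> = (\<integral>\<^sup>+s. \<phi> s \<partial>horizon t)"
        by (subst nn_integral_weighted_fst[OF weight_horizon mU2]) (simp add: \<phi>_def[abs_def])
      finally show "(\<integral>\<^sup>+\<omega>. ennreal ((noise \<xi> X U t \<omega>)\<^sup>2) \<partial>M) = (\<integral>\<^sup>+s. \<phi> s \<partial>horizon t)" .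
    qed
    also have "\<dots> = ennreal (1 / \<rho>) * (\<integral>\<^sup>+s. \<phi> s \<partial>discounted \<rho>)"
      by (rule nn_integral_discount_cumulative[OF \<rho> m\<phi>])
    also have "\<dots> = ennreal (1 / \<rho>) * (\<integral>\<^sup>+z. ennreal ((case_prod U z)\<^sup>2) \<partial>on_discount \<rho>)"
      by (subst nn_integral_weighted_fst[OF w mU2]) (simp add: \<phi>_def[abs_def])
    also have "\<dots> < \<infinity>" using fin by (simp add: ennreal_mult_less_top)
    finally show "(\<integral>\<^sup>+z. ennreal (((\<lambda>(t, \<omega>). noise \<xi> X U t \<omega>) z)\<^sup>2) \<partial>on_discount \<rho>) < \<infinity>" .
  qed
  have "sq_int (on_discount \<rho>)
    (\<lambda>z. (\<lambda>(t, \<omega>). noise \<xi> X U t \<omega>) z + (\<xi> (snd z) + case_prod (drift U) z))"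
    by (intro sq_int_add Z sq_int_weighted_const w ito_processD(3)[OF p] D)
  then show ?thesis by (simp add: case_prod_beta')
qed

text \<open>The product rule with \<open>X = Y\<close> writes the second moment of
  \<open>X t\<close> as a constant plus a cumulative integral. Integrating this over the discount
  divides both by \<open>\<rho>\<close>, and no limit at infinity is taken.\<close>

lemma discounted_identity:
  assumes p: "ito_process i \<xi> X U" and \<rho>: "0 < \<rho>"
    and U: "sq_int (on_discount \<rho>) (case_prod U)"
  shows "\<rho> * (\<integral>z. (case_prod X z)\<^sup>2 \<partial>on_discount \<rho>) = (\<integral>\<omega>. (\<xi> \<omega>)\<^sup>2 \<partial>M)
    + 2 * (\<integral>z. case_prod U z * case_prod X z \<partial>on_discount \<rho>)
    + (\<integral>z. (case_prod U z)\<^sup>2 \<partial>on_discount \<rho>)"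
proof -
  note w = weight_discount[OF \<rho>]
  interpret D: finite_measure "discounted \<rho>" by (rule weightD[OF w])
  note X = state_discounted[OF p \<rho> U]
  define h where "h z = 2 * (case_prod U z * case_prod X z) + (case_prod U z)\<^sup>2" for z
  have split: "integrable (weighted v \<Otimes>\<^sub>M M) h"
    "(\<integral>z. h z \<partial>(weighted v \<Otimes>\<^sub>M M)) = 2 * (\<integral>z. case_prod U z * case_prod X z \<partial>(weighted v \<Otimes>\<^sub>M M))
      + (\<integral>z. (case_prod U z)\<^sup>2 \<partial>(weighted v \<Otimes>\<^sub>M M))"
    if s: "sq_int (weighted v \<Otimes>\<^sub>M M) (case_prod U)" "sq_int (weighted v \<Otimes>\<^sub>M M) (case_prod X)" for v
    using sq_int_mult[OF s] sq_int_power2[OF s(1)] unfolding h_def[abs_def]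
    by (auto intro!: Bochner_Integration.integrable_add Lint_add[THEN trans])
  have mh: "h \<in> borel_measurable (borel \<Otimes>\<^sub>M M)"
    using borel_measurable_integrable[OF split(1)[OF U X]] by simp
  define \<phi> where "\<phi> s = (\<integral>\<omega>. h (s, \<omega>) \<partial>M)" for s
  have m\<phi>: "\<phi> \<in> borel_measurable borel" unfolding \<phi>_def[abs_def] using mh by measurable
  have i\<phi>: "integrable (discounted \<rho>) \<phi>"
    using integral_weighted_fst(3)[OF w split(1)[OF U X]] by (simp add: \<phi>_def[abs_def])
  have ft: "(\<integral>\<omega>. (X t \<omega>)\<^sup>2 \<partial>M) = (\<integral>\<omega>. (\<xi> \<omega>)\<^sup>2 \<partial>M) + (\<integral>s. \<phi> s \<partial>horizon t)" if t: "0 \<le> t" for t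
    using product_formula[OF p p t] integral_weighted_fst(1)[OF weight_horizon split(1)[OF ito_process_sq(1)[OF p t] state_sq(2)[OF p t]]]
    unfolding split(2)[OF ito_process_sq(1)[OF p t] state_sq(2)[OF p t]] \<phi>_def
    by (simp add: power2_eq_square mult.commute[of "case _ of (t, \<omega>) \<Rightarrow> X t \<omega>"])
  have one: "(\<integral>t. c \<partial>discounted \<rho>) = c / \<rho>" for c :: real
    using integral_discount_tail[OF \<rho>, of 0] by (subst integral_weighted) auto
  have "(\<integral>z. (case_prod X z)\<^sup>2 \<partial>on_discount \<rho>) =
    (\<integral>t. (\<integral>\<omega>. (X t \<omega>)\<^sup>2 \<partial>M) \<partial>discounted \<rho>)"
    using integral_weighted_fst(1)[OF w sq_int_power2[OF X]] by simp
  also have "\<dots> = (\<integral>t. (\<integral>\<omega>. (\<xi> \<omega>)\<^sup>2 \<partial>M) + (\<integral>s. \<phi> s \<partial>horizon t) \<partial>discounted \<rho>)"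
  proof (rule integral_cong_AE)
    show "(\<lambda>t. \<integral>\<omega>. (X t \<omega>)\<^sup>2 \<partial>M) \<in> borel_measurable (discounted \<rho>)"
      using borel_measurable_integrable[OF integral_weighted_fst(3)[OF w sq_int_power2[OF X]]] by simp
    show "(\<lambda>t. (\<integral>\<omega>. (\<xi> \<omega>)\<^sup>2 \<partial>M) + (\<integral>s. \<phi> s \<partial>horizon t)) \<in> borel_measurable (discounted \<rho>)"
      using borel_measurable_integrable[OF integral_discount_cumulative(1)[OF \<rho> m\<phi> i\<phi>]] by simp
    show "AE t in discounted \<rho>. (\<integral>\<omega>. (X t \<omega>)\<^sup>2 \<partial>M) = (\<integral>\<omega>. (\<xi> \<omega>)\<^sup>2 \<partial>M) + (\<integral>s. \<phi> s \<partial>horizon t)"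
      by (rule AE_discountI) (rule ft)
  qed
  also have "\<dots> = (\<integral>\<omega>. (\<xi> \<omega>)\<^sup>2 \<partial>M) / \<rho> + (\<integral>s. \<phi> s \<partial>discounted \<rho>) / \<rho>"
    by (subst Lint_add)
       (simp_all only: one integral_discount_cumulative[OF \<rho> m\<phi> i\<phi>] D.integrable_const)
  also have "(\<integral>s. \<phi> s \<partial>discounted \<rho>) = (\<integral>z. h z \<partial>on_discount \<rho>)"
    using integral_weighted_fst(1)[OF w split(1)[OF U X]] by (simp add: \<phi>_def)
  finally show ?thesis
    unfolding split(2)[OF U X] using \<rho> by (simp add: field_simps)
qed

text \<open>Under linear feedback the product rule closes into a linear integral equation for the
  mixed moment. The two drifts contribute \<open>- 2 * k\<close> to its rate, a common noise
  \<open>k^2\<close>.\<close>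

lemma feedback_moment:
  assumes p: "ito_process i \<xi> X U" and q: "ito_process j \<eta> Y V" and t: "0 \<le> t"
    and U: "\<And>t \<omega>. \<omega> \<in> space M \<Longrightarrow> U t \<omega> = - k * X t \<omega>" and V: "\<And>t \<omega>. \<omega> \<in> space M \<Longrightarrow> V t \<omega> = - k * Y t \<omega>"
  shows "(\<integral>\<omega>. X t \<omega> * Y t \<omega> \<partial>M) = (\<integral>\<omega>. \<xi> \<omega> * \<eta> \<omega> \<partial>M) * exp ((if i = j then k\<^sup>2 - 2 * k else - 2 * k) * t)"
proof -
  define c where "c = (if i = j then k\<^sup>2 - 2 * k else - 2 * k)"
  define F where "F z = case_prod X z * case_prod Y z" for z
  define g where "g t = (\<integral>\<omega>. X t \<omega> * Y t \<omega> \<partial>M)" for t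
  have F: "integrable (on_horizon t) F" if "0 \<le> t" for t
    using sq_int_mult[OF state_sq(2)[OF p that] state_sq(2)[OF q that]] by (simp add: F_def[abs_def])
  note i = integral_weighted_fst[OF weight_horizon F]
  have mF: "F \<in> borel_measurable (borel \<Otimes>\<^sub>M M)"
    using ito_processD(4)[OF p] ito_processD(4)[OF q] unfolding F_def[abs_def] by measurable
  have gF: "g t = (\<integral>\<omega>. F (t, \<omega>) \<partial>M)" for t by (simp add: g_def F_def)
  have "g t = (\<integral>\<omega>. \<xi> \<omega> * \<eta> \<omega> \<partial>M) * exp (c * t)"
  proof (rule linear_integral_equation[OF _ _ _ t])
    show "g \<in> borel_measurable borel" unfolding gF[abs_def] using mF by measurable
    fix t :: real assume t: "0 \<le> t"
    show "integrable (horizon t) g" using i(3)[OF t] by (simp add: gF[abs_def])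
    have "(\<integral>z. case_prod U z * case_prod Y z \<partial>on_horizon t) = (\<integral>z. - k * F z \<partial>on_horizon t)"
      by (intro Lint_cong) (auto simp: F_def U space_pair_measure)
    moreover have "(\<integral>z. case_prod X z * case_prod V z \<partial>on_horizon t) = (\<integral>z. - k * F z \<partial>on_horizon t)"
      by (intro Lint_cong) (auto simp: F_def V space_pair_measure)
    moreover have "(\<integral>z. case_prod U z * case_prod V z \<partial>on_horizon t) = (\<integral>z. k\<^sup>2 * F z \<partial>on_horizon t)"
      by (intro Lint_cong) (auto simp: F_def U V space_pair_measure power2_eq_square)
    ultimately have "g t = (\<integral>\<omega>. \<xi> \<omega> * \<eta> \<omega> \<partial>M) + c * (\<integral>z. F z \<partial>on_horizon t)"
      using product_formula[OF p q t] by (auto simp: g_def c_def algebra_simps)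
    then show "g t = (\<integral>\<omega>. \<xi> \<omega> * \<eta> \<omega> \<partial>M) + c * (\<integral>s. g s \<partial>horizon t)"
      using i(1)[OF t] by (simp add: gF)
  qed
  then show ?thesis by (simp add: g_def c_def)
qed

text \<open>The second moment behaves like \<open>exp ((k^2 - 2 * k) * t)\<close>, and the
  hypothesis on \<open>k\<close> says that the discount beats it. In contrast to
  \<open>state_discounted\<close>, finite energy of the control is a conclusion here.\<close>

lemma feedback_discounted:
  assumes p: "ito_process i \<xi> X U" and \<rho>: "0 < \<rho>" and k: "k\<^sup>2 - 2 * k < \<rho>"
    and U: "\<And>t \<omega>. \<omega> \<in> space M \<Longrightarrow> U t \<omega> = - k * X t \<omega>"
  shows "sq_int (on_discount \<rho>) (case_prod X)"
    and "(\<integral>z. (case_prod X z)\<^sup>2 \<partial>on_discount \<rho>) = (\<integral>\<omega>. (\<xi> \<omega>)\<^sup>2 \<partial>M) / (\<rho> - (k\<^sup>2 - 2 * k))"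
    and "sq_int (on_discount \<rho>) (case_prod U)"
proof -
  define c where "c = k\<^sup>2 - 2 * k"
  define a where "a = (\<integral>\<omega>. (\<xi> \<omega>)\<^sup>2 \<partial>M)"
  have rc: "0 < \<rho> - c" using k by (simp add: c_def)
  note w = weight_discount[OF \<rho>]
  have a: "0 \<le> a" by (simp add: a_def)
  have EX: "(\<integral>\<omega>. (X t \<omega>)\<^sup>2 \<partial>M) = a * exp (c * t)" if "0 \<le> t" for t
    using feedback_moment[OF p p that U U] by (simp add: a_def c_def power2_eq_square)
  have [measurable]: "(case_prod X) \<in> borel_measurable (borel \<Otimes>\<^sub>M M)" by (rule ito_processD(4)[OF p])
  have "(\<integral>\<^sup>+z. ennreal ((case_prod X z)\<^sup>2) \<partial>on_discount \<rho>) =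
    (\<integral>\<^sup>+t. (\<integral>\<^sup>+\<omega>. ennreal ((X t \<omega>)\<^sup>2) \<partial>M) \<partial>discounted \<rho>)"
    by (subst nn_integral_weighted_fst[OF w]) auto
  also have "\<dots> = (\<integral>\<^sup>+t. ennreal (a * exp (c * t)) \<partial>discounted \<rho>)"
    by (intro nn_integral_cong_AE AE_discountI) (simp add: sq_int_nn[OF state_sq(1)[OF p]] EX)
  also have "\<dots> = (\<integral>\<^sup>+t. ennreal a * ennreal (indicator {0..} t * exp (- (\<rho> - c) * t)) \<partial>lborel)"
  proof (subst nn_integral_weighted, goal_cases)
    case 3
    have "exp (- \<rho> * t) * exp (c * t) = exp (- (\<rho> - c) * t)" for t
      by (simp add: exp_add[symmetric] algebra_simps)
    then have "indicator {0..} t * exp (- \<rho> * t) * (a * exp (c * t)) = a * (indicator {0..} t * exp (- (\<rho> - c) * t))" for t :: real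
      by (metis mult.assoc mult.commute)
    then show ?case using a by (intro nn_integral_cong) (simp add: ennreal_mult[symmetric])
  qed auto
  also have "\<dots> = ennreal a * ennreal (exp (- (\<rho> - c) * 0) / (\<rho> - c))"
    by (subst nn_integral_cmult) (simp_all only: nn_integral_exp_tail[OF rc], measurable)
  also have "\<dots> = ennreal (a / (\<rho> - c))" using a rc by (simp add: ennreal_mult[symmetric])
  finally have nn: "(\<integral>\<^sup>+z. ennreal ((case_prod X z)\<^sup>2) \<partial>on_discount \<rho>) = ennreal (a / (\<rho> - c))" .
  then show X: "sq_int (on_discount \<rho>) (case_prod X)"
    by (intro sq_intI_nn) auto
  show "(\<integral>z. (case_prod X z)\<^sup>2 \<partial>on_discount \<rho>) = (\<integral>\<omega>. (\<xi> \<omega>)\<^sup>2 \<partial>M) / (\<rho> - (k\<^sup>2 - 2 * k))"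
    using nn a rc unfolding sq_int_nn[OF X] by (simp add: a_def c_def)
  have "sq_int (on_discount \<rho>) (\<lambda>z. - k * case_prod X z)"
    by (rule sq_int_cmult[OF X])
  then show "sq_int (on_discount \<rho>) (case_prod U)"
  proof (rule sq_int_cong_AE)
    show "(case_prod U) \<in> borel_measurable (on_discount \<rho>)"
      using ito_processD(5)[OF p] by simp
    show "AE z in discounted \<rho> \<Otimes>\<^sub>M M. - k * case_prod X z = case_prod U z"
      using U by (intro AE_I2) (auto simp: space_pair_measure)
  qed
qed

lemma feedback_uncorrelated:
  assumes p: "ito_process i \<xi> X U" and q: "ito_process j \<eta> Y V" and \<rho>: "0 < \<rho>"
    and k: "k\<^sup>2 - 2 * k < \<rho>"
    and U: "\<And>t \<omega>. \<omega> \<in> space M \<Longrightarrow> U t \<omega> = - k * X t \<omega>" and V: "\<And>t \<omega>. \<omega> \<in> space M \<Longrightarrow> V t \<omega> = - k * Y t \<omega>"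
    and zero: "(\<integral>\<omega>. \<xi> \<omega> * \<eta> \<omega> \<partial>M) = 0"
  shows "(\<integral>z. case_prod X z * case_prod Y z \<partial>on_discount \<rho>) = 0"
proof -
  note i = integral_weighted_fst[OF weight_discount[OF \<rho>]
      sq_int_mult[OF feedback_discounted(1)[OF p \<rho> k U] feedback_discounted(1)[OF q \<rho> k V]]]
  have "(\<integral>z. case_prod X z * case_prod Y z \<partial>on_discount \<rho>) =
    (\<integral>t. (\<integral>\<omega>. X t \<omega> * Y t \<omega> \<partial>M) \<partial>discounted \<rho>)"
    using i(1) by simp
  also have "\<dots> = (\<integral>t. 0 \<partial>discounted \<rho>)"
  proof (rule integral_cong_AE)
    show "AE t in discounted \<rho>. (\<integral>\<omega>. X t \<omega> * Y t \<omega> \<partial>M) = 0"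
      by (rule AE_discountI) (simp add: feedback_moment[OF p q _ U V] zero)
  qed (use borel_measurable_integrable[OF i(3)] in simp_all)
  finally show ?thesis by simp
qed

end

section \<open>The Riccati equation\<close>

text \<open>A predicate of \<open>r\<close>, because the condition is needed at \<open>r\<close> and
  also at \<open>r / \<alpha>\<close>.\<close>

definition solvable :: "real \<Rightarrow> real \<Rightarrow> bool" where
  "solvable \<rho> r \<longleftrightarrow> 0 < \<rho> \<and> r > (2 * sqrt (\<rho> + 1) - (\<rho> + 2)) / \<rho>\<^sup>2"

definition gain :: "real \<Rightarrow> real \<Rightarrow> real" where
  "gain \<rho> r = riccati_p \<rho> r / (riccati_p \<rho> r + r)"

text \<open>With \<open>s = sqrt (\<rho> + 1)\<close> the threshold for \<open>r\<close> simplifies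
  to \<open>- 1 / (s + 1)^2\<close>, since its numerator is \<open>- (s - 1)^2\<close> and
  \<open>\<rho> = (s - 1) * (s + 1)\<close>.\<close>

lemma solvable_sqrt:
  assumes "solvable \<rho> r"
  obtains s where "1 < s" "\<rho> = s\<^sup>2 - 1" "0 < 1 + r * (s + 1)\<^sup>2"
proof
  define s where "s = sqrt (\<rho> + 1)"
  have \<rho>: "0 < \<rho>" using assms by (simp add: solvable_def)
  show s1: "1 < s" using \<rho> by (simp add: s_def)
  show s2: "\<rho> = s\<^sup>2 - 1" using \<rho> by (simp add: s_def)
  have "(2 * s - (\<rho> + 2)) / \<rho>\<^sup>2 < r" using assms by (simp add: solvable_def s_def)
  then have "2 * s - (\<rho> + 2) < r * \<rho>\<^sup>2" using \<rho> by (simp add: pos_divide_less_eq)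
  moreover have "2 * s - (\<rho> + 2) = - ((s - 1)\<^sup>2)" by (simp add: s2 power2_eq_square algebra_simps)
  moreover have "\<rho>\<^sup>2 = (s - 1)\<^sup>2 * (s + 1)\<^sup>2" by (simp add: s2 power2_eq_square algebra_simps)
  ultimately have "0 < (s - 1)\<^sup>2 * (1 + r * (s + 1)\<^sup>2)" by (simp add: algebra_simps)
  then show "0 < 1 + r * (s + 1)\<^sup>2" by (simp add: zero_less_mult_iff not_less[symmetric])
qed

lemma riccati:
  assumes "solvable \<rho> r"
  defines "p \<equiv> riccati_p \<rho> r"
  shows riccati_pos: "0 < p" and riccati_add_pos: "0 < p + r"
    and riccati_equation: "(1 - \<rho> * p) * (p + r) = p\<^sup>2"
    and riccati_stable: "(gain \<rho> r)\<^sup>2 - 2 * gain \<rho> r < \<rho>"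
proof -
  obtain s where s: "1 < s" "\<rho> = s\<^sup>2 - 1" "0 < 1 + r * (s + 1)\<^sup>2"
    using solvable_sqrt[OF assms(1)] by blast
  have \<rho>: "0 < \<rho>" using assms(1) by (simp add: solvable_def)
  define \<Delta> where "\<Delta> = (\<rho> * r)\<^sup>2 + 2 * \<rho> * r + 4 * r + 1"
  \<comment> \<open>The first factor is positive by the threshold condition. For negative
    \<open>r\<close> the second is at least as large, because
    \<open>(s - 1)^2 \<le> (s + 1)^2\<close>.\<close>
  have fac: "\<Delta> = (1 + r * (s + 1)\<^sup>2) * (1 + r * (s - 1)\<^sup>2)"
    by (simp add: \<Delta>_def s(2) power2_eq_square algebra_simps)
  have le: "(s - 1)\<^sup>2 \<le> (s + 1)\<^sup>2" using s(1) by (intro power_mono) auto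
  have f2: "0 < 1 + r * (s - 1)\<^sup>2"
  proof (cases "0 \<le> r")
    case False
    then have "r * (s + 1)\<^sup>2 \<le> r * (s - 1)\<^sup>2" using le by (intro mult_left_mono_neg) auto
    then show ?thesis using s(3) by linarith
  qed (auto intro: add_pos_nonneg)
  have \<Delta>: "0 < \<Delta>" unfolding fac using s(3) f2 by simp
  define d where "d = sqrt \<Delta>"
  have d: "0 < d" "d\<^sup>2 = \<Delta>" using \<Delta> by (auto simp: d_def)
  have p: "p = (1 - \<rho> * r + d) / (2 * (\<rho> + 1))" by (simp add: p_def riccati_p_def d_def \<Delta>_def Let_def)
  have p2: "2 * (\<rho> + 1) * p = 1 - \<rho> * r + d" using \<rho> by (simp add: p)
  have pr2: "2 * (\<rho> + 1) * (p + r) = 1 + (\<rho> + 2) * r + d" using p2 by (simp add: algebra_simps)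
  \<comment> \<open>For \<open>r \<ge> 0\<close> this rests on
    \<open>\<Delta> - (1 - \<rho> * r)^2 = 4 * r * (\<rho> + 1)\<close>. For negative
    \<open>r\<close> every summand is positive.\<close>
  have num: "0 < 1 - \<rho> * r + d"
  proof (cases "0 \<le> r")
    case True
    have "(1 - \<rho> * r)\<^sup>2 \<le> \<Delta>" using True \<rho> by (simp add: \<Delta>_def power2_eq_square algebra_simps)
    then have ab: "\<bar>1 - \<rho> * r\<bar> \<le> d" unfolding d_def by (metis real_sqrt_abs real_sqrt_le_iff)
    show ?thesis
    proof (cases "\<rho> * r \<le> 1")
      case True then show ?thesis using d(1) by linarith
    next
      case False
      then have "0 < r" using \<open>0 \<le> r\<close> by (cases "r = 0") auto
      then have "(1 - \<rho> * r)\<^sup>2 < \<Delta>" using \<rho> by (simp add: \<Delta>_def power2_eq_square algebra_simps add_pos_pos)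
      then have "\<bar>1 - \<rho> * r\<bar> < d" unfolding d_def by (metis real_sqrt_abs real_sqrt_less_iff)
      then show ?thesis by linarith
    qed
  next
    case False
    then have "\<rho> * r < 0" using \<rho> by (simp add: mult_pos_neg)
    then show ?thesis using d by linarith
  qed
  show pos: "0 < p" unfolding p using num \<rho> by simp
  \<comment> \<open>For negative \<open>r\<close> this follows from the threshold, since
    \<open>\<rho> + 2 = s^2 + 1 \<le> (s + 1)^2\<close>.\<close>
  have "0 < 1 + (\<rho> + 2) * r"
  proof (cases "0 \<le> r")
    case False
    have "(\<rho> + 2) \<le> (s + 1)\<^sup>2" using s(1) by (simp add: s(2) power2_eq_square algebra_simps)
    then have "r * (s + 1)\<^sup>2 \<le> r * (\<rho> + 2)" using False by (intro mult_left_mono_neg) auto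
    then show ?thesis using s(3) by (simp add: mult.commute)
  qed (use \<rho> in \<open>auto intro: add_pos_nonneg\<close>)
  then have "0 < 2 * (\<rho> + 1) * (p + r)" unfolding pr2 using d(1) by linarith
  then show pr: "0 < p + r" using \<rho> by (simp add: zero_less_mult_iff)
  have quad: "(\<rho> + 1) * p\<^sup>2 = (1 - \<rho> * r) * p + r"
  proof -
    have "(2 * (\<rho> + 1) * p - (1 - \<rho> * r))\<^sup>2 = \<Delta>" using p2 d(2) by simp
    then have "4 * (\<rho> + 1) * ((\<rho> + 1) * p\<^sup>2 - (1 - \<rho> * r) * p - r) = 0"
      by (simp add: \<Delta>_def power2_eq_square algebra_simps)
    then show ?thesis using \<rho> by simp
  qed
  show eq: "(1 - \<rho> * p) * (p + r) = p\<^sup>2"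
    using quad by (simp add: power2_eq_square algebra_simps)
  \<comment> \<open>Stability means that the gain \<open>k\<close> satisfies
    \<open>(k - 1)^2 < s^2\<close>. The critical side \<open>k < 1 + s\<close> is equivalent to
    \<open>0 < s * p + (1 + s) * r\<close>, and this identity reduces it to the threshold
    condition.\<close>
  have "2 * s * (s * p + (1 + s) * r) = 1 + r * (s + 1)\<^sup>2 + d"
  proof -
    have "2 * s\<^sup>2 * p = 1 - (s\<^sup>2 - 1) * r + d" using p2 by (simp add: s(2))
    then show ?thesis by (simp add: power2_eq_square algebra_simps)
  qed
  then have "0 < 2 * s * (s * p + (1 + s) * r)" using s(3) d(1) by simp
  then have "0 < s * p + (1 + s) * r" using s(1) by (simp add: zero_less_mult_iff)
  then have "p < (1 + s) * (p + r)" by (simp add: algebra_simps)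
  then have g: "gain \<rho> r < 1 + s" unfolding gain_def p_def[symmetric] using pr by (simp add: pos_divide_less_eq)
  have g0: "0 < gain \<rho> r" unfolding gain_def p_def[symmetric] using pos pr by simp
  have "\<bar>gain \<rho> r - 1\<bar> < s" using g g0 s(1) by linarith
  then have "(gain \<rho> r - 1)\<^sup>2 < s\<^sup>2" by (metis abs_ge_zero power2_abs power_strict_mono zero_less_numeral)
  then show "(gain \<rho> r)\<^sup>2 - 2 * gain \<rho> r < \<rho>" by (simp add: s(2) power2_eq_square algebra_simps)
qed

text \<open>The convexity margin: for \<open>\<alpha>\<close> slightly below 1 the form \<open>\<alpha> x\<^sup>2 + r u\<^sup>2\<close> is still
  nonnegative along the dynamics, even when \<open>r\<close> is negative.\<close>

lemma solvable_margin:
  assumes "solvable \<rho> r"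
  obtains \<alpha> where "0 < \<alpha>" "\<alpha> < 1" "solvable \<rho> (r / \<alpha>)"
proof -
  have "((\<lambda>\<alpha>. r / \<alpha>) \<longlongrightarrow> r / 1) (at_left 1)"
    by (intro tendsto_intros) auto
  then have "\<forall>\<^sub>F \<alpha> in at_left 1. r / \<alpha> > (2 * sqrt (\<rho> + 1) - (\<rho> + 2)) / \<rho>\<^sup>2"
    using assms by (intro order_tendstoD(1)) (auto simp: solvable_def)
  moreover have "\<forall>\<^sub>F \<alpha> in at_left (1::real). 0 < \<alpha> \<and> \<alpha> < 1"
    by (auto simp: eventually_at_left_field intro!: exI[of _ "0::real"])
  ultimately have "\<forall>\<^sub>F \<alpha> in at_left (1::real). 0 < \<alpha> \<and> \<alpha> < 1 \<and> solvable \<rho> (r / \<alpha>)"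
    by eventually_elim (use assms in \<open>simp add: solvable_def\<close>)
  then have "\<exists>\<alpha>. 0 < \<alpha> \<and> \<alpha> < 1 \<and> solvable \<rho> (r / \<alpha>)"
    by (rule eventually_happens'[OF trivial_limit_at_left_real])
  then show thesis using that by blast
qed

context agent_system
begin

text \<open>Expanding the square with weight \<open>P + r\<close> leaves a cross term with
  coefficient \<open>2 * P\<close>, because \<open>(P + r) * k = P\<close>.
  \<open>discounted_identity\<close> trades this cross term for state energy, and the Riccati
  equation makes the total coefficient of the state energy equal to 1.\<close>

lemma completed_square:
  assumes p: "ito_process i \<xi> X U" and s: "solvable \<rho> r"
    and U: "sq_int (on_discount \<rho>) (case_prod U)"
  shows "(\<integral>z. (case_prod X z)\<^sup>2 \<partial>on_discount \<rho>)
      + r * (\<integral>z. (case_prod U z)\<^sup>2 \<partial>on_discount \<rho>) =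
    riccati_p \<rho> r * (\<integral>\<omega>. (\<xi> \<omega>)\<^sup>2 \<partial>M) + (riccati_p \<rho> r + r) *
      (\<integral>z. (case_prod U z + gain \<rho> r * case_prod X z)\<^sup>2 \<partial>on_discount \<rho>)"
proof -
  have \<rho>: "0 < \<rho>" using s by (simp add: solvable_def)
  define P where "P = riccati_p \<rho> r"
  define k where "k = gain \<rho> r"
  note X = state_discounted[OF p \<rho> U]
  define Vv where "Vv = (\<integral>z. (case_prod X z)\<^sup>2 \<partial>on_discount \<rho>)"
  define Vu where "Vu = (\<integral>z. (case_prod U z)\<^sup>2 \<partial>on_discount \<rho>)"
  define Vc where "Vc = (\<integral>z. case_prod U z * case_prod X z \<partial>on_discount \<rho>)"
  define a where "a = (\<integral>\<omega>. (\<xi> \<omega>)\<^sup>2 \<partial>M)"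
  have Q: "(\<integral>z. (case_prod U z + k * case_prod X z)\<^sup>2 \<partial>on_discount \<rho>) =
    Vu + 2 * k * Vc + k\<^sup>2 * Vv"
    using integral_sq_add[OF U X, of 1 k] by (simp add: Vv_def Vu_def Vc_def)
  have I: "\<rho> * Vv = a + 2 * Vc + Vu"
    using discounted_identity[OF p \<rho> U] by (simp add: Vv_def Vu_def Vc_def a_def)
  have pr: "0 < P + r" using riccati_add_pos[OF s] by (simp add: P_def)
  have k1: "(P + r) * k = P" using pr by (simp add: k_def gain_def P_def)
  \<comment> \<open>Multiplied by \<open>P + r\<close>, the claim
    \<open>(P + r) * k^2 = 1 - \<rho> * P\<close> becomes the Riccati equation.\<close>
  have "((P + r) * k\<^sup>2) * (P + r) = ((P + r) * k)\<^sup>2"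
    by (simp only: power2_eq_square mult_ac)
  also have "\<dots> = (1 - \<rho> * P) * (P + r)"
    unfolding k1 using riccati_equation[OF s] by (simp add: P_def)
  finally have k2: "(P + r) * k\<^sup>2 = 1 - \<rho> * P"
    using pr by simp
  have "P * a + (P + r) * (Vu + 2 * k * Vc + k\<^sup>2 * Vv) =
    P * a + (P + r) * Vu + 2 * ((P + r) * k) * Vc + ((P + r) * k\<^sup>2) * Vv"
    by (simp add: algebra_simps)
  also have "\<dots> = P * (a + 2 * Vc + Vu) + r * Vu + Vv - P * (\<rho> * Vv)"
    unfolding k1 k2 by (simp add: algebra_simps)
  also have "\<dots> = Vv + r * Vu" by (simp add: I)
  finally show ?thesis
    unfolding P_def[symmetric] k_def[symmetric] Q Vv_def[symmetric] Vu_def[symmetric] a_def[symmetric] by simp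
qed

end

section \<open>The cost of a unilateral deviation\<close>

context agent_system
begin

lemma control_energy:
  assumes m: "(\<lambda>(t, \<omega>). u (max 0 t) \<omega>) \<in> borel_measurable (borel \<Otimes>\<^sub>M M)" and \<rho>: "0 < \<rho>"
  shows "(\<integral>\<^sup>+z. ennreal (((\<lambda>(t, \<omega>). u (max 0 t) \<omega>) z)\<^sup>2) \<partial>on_discount \<rho>) =
    (\<integral>\<^sup>+\<omega>. (\<integral>\<^sup>+t\<in>{0..}. ennreal (exp (- \<rho> * t) * \<bar>u t \<omega>\<bar>\<^sup>2) \<partial>lborel) \<partial>M)"
proof -
  have m2: "(\<lambda>z. ennreal (((\<lambda>(t, \<omega>). u (max 0 t) \<omega>) z)\<^sup>2)) \<in> borel_measurable (borel \<Otimes>\<^sub>M M)"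
    using m by measurable
  have "(\<integral>\<^sup>+t. ennreal ((u (max 0 t) \<omega>)\<^sup>2) \<partial>discounted \<rho>) =
      (\<integral>\<^sup>+t\<in>{0..}. ennreal (exp (- \<rho> * t) * \<bar>u t \<omega>\<bar>\<^sup>2) \<partial>lborel)" if "\<omega> \<in> space M" for \<omega>
    using drift_measurable_section(2)[OF m that]
    by (subst nn_integral_weighted) (auto intro!: nn_integral_cong simp: ennreal_mult indicator_def)
  then show ?thesis
    by (subst nn_integral_weighted_snd[OF weight_discount[OF \<rho>] m2]) (auto intro!: nn_integral_cong)
qed

lemma uses_feedback_extend:
  assumes "uses_feedback M \<rho> r c (x j) (u j)" "\<omega> \<in> space M"
  shows "u j (max 0 t) \<omega> = - gain \<rho> r * (x j (max 0 t) \<omega> - c)"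
  using assms by (auto simp: uses_feedback_def feedback_def gain_def)

text \<open>Supplies the integrability half of the admissibility of the feedback law.\<close>

lemma feedback_control_finite:
  assumes s: "solvable \<rho> r" and i: "i \<in> {1..N}" and x0: "sq_int M (x0 i)"
    and sde: "sde_solution M G (W i) (x0 i) (x i) (u i)" and fb: "uses_feedback M \<rho> r c (x i) (u i)"
  shows "(\<integral>\<^sup>+\<omega>. (\<integral>\<^sup>+t\<in>{0..}. ennreal (exp (- \<rho> * t) * \<bar>u i t \<omega>\<bar>\<^sup>2) \<partial>lborel) \<partial>M) < \<infinity>"
proof -
  have \<rho>: "0 < \<rho>" using s by (simp add: solvable_def)
  note p = sde_ito_process[OF sde i x0, of c]
  have "sq_int (on_discount \<rho>) (\<lambda>(t, \<omega>). u i (max 0 t) \<omega>)"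
    by (rule feedback_discounted(3)[OF p \<rho> riccati_stable[OF s]]) (rule uses_feedback_extend[of \<rho> r c x i u, OF fb])
  from sq_int_nn[OF this] show ?thesis
    unfolding control_energy[OF ito_processD(5)[OF p] \<rho>] by simp
qed

text \<open>Reduces the game to inequalities between four numbers: the discounted energies
  \<open>Vx\<close>, \<open>Vu\<close>, \<open>Vm\<close> of the centred state, the control and the
  average of the other agents, and the cross term \<open>Vc\<close> of state and average. None of
  them depends on \<open>r'\<close>, so the completed square bounds them for every solvable
  \<open>r'\<close> at once.\<close>

lemma cost_decomposition:
  assumes s: "solvable \<rho> r" and N: "2 \<le> N" and i: "i \<in> {1..N}"
    and sde: "\<And>j. j \<in> {1..N} \<Longrightarrow> sde_solution M G (W j) (x0 j) (x j) (u j)"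
    and fb: "\<And>j. j \<in> {1..N} \<Longrightarrow> j \<noteq> i \<Longrightarrow> uses_feedback M \<rho> r c (x j) (u j)"
    and fin: "(\<integral>\<^sup>+\<omega>. (\<integral>\<^sup>+t\<in>{0..}. ennreal (exp (- \<rho> * t) * \<bar>u i t \<omega>\<bar>\<^sup>2) \<partial>lborel) \<partial>M) < \<infinity>"
    and x0: "\<And>j. j \<in> {1..N} \<Longrightarrow> sq_int M (x0 j)"
    and var: "\<And>j. j \<in> {1..N} \<Longrightarrow> (\<integral>\<omega>. (x0 j \<omega> - c)\<^sup>2 \<partial>M) \<le> c0"
    and unc: "\<And>j l. j \<in> {1..N} \<Longrightarrow> l \<in> {1..N} \<Longrightarrow> j \<noteq> l \<Longrightarrow> (\<integral>\<omega>. (x0 j \<omega> - c) * (x0 l \<omega> - c) \<partial>M) = 0"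
  defines "a \<equiv> \<integral>\<omega>. (x0 i \<omega> - c)\<^sup>2 \<partial>M" and "d \<equiv> \<rho> - ((gain \<rho> r)\<^sup>2 - 2 * gain \<rho> r)"
  obtains Vx Vu Vm Vc where
    "cost M \<rho> r N i x u = (1 - 1 / real N)\<^sup>2 * (Vx - 2 * Vc + Vm) + r * Vu"
    "0 \<le> Vx" "0 \<le> Vu" "0 \<le> Vm" "Vm \<le> 2 * c0 / (d * real N)" "\<bar>Vc\<bar> \<le> sqrt Vx * sqrt Vm"
    "\<And>r'. solvable \<rho> r' \<Longrightarrow> riccati_p \<rho> r' * a \<le> Vx + r' * Vu"
    "uses_feedback M \<rho> r c (x i) (u i) \<Longrightarrow> Vx + r * Vu = riccati_p \<rho> r * a \<and> Vx = a / d"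
proof -
  have \<rho>: "0 < \<rho>" using s by (simp add: solvable_def)
  note w = weight_discount[OF \<rho>]
  define L where "L = discounted \<rho> \<Otimes>\<^sub>M M"
  define J where "J = {1..N} - {i}"
  define X where "X j = (\<lambda>t \<omega>. x j (max 0 t) \<omega> - c)" for j
  define U where "U j = (\<lambda>t. u j (max 0 t))" for j
  have p: "ito_process j (\<lambda>\<omega>. x0 j \<omega> - c) (X j) (U j)" if "j \<in> {1..N}" for j
    unfolding X_def U_def by (rule sde_ito_process[OF sde[OF that] that x0[OF that]])
  have d: "0 < d" using riccati_stable[OF s] by (simp add: d_def)
  define k where "k = gain \<rho> r"
  have k: "k\<^sup>2 - 2 * k < \<rho>" using riccati_stable[OF s] by (simp add: k_def)
  have UX: "U j t \<omega> = - k * X j t \<omega>" if "\<omega> \<in> space M" "j \<in> {1..N}" "uses_feedback M \<rho> r c (x j) (u j)" for j t \<omega>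
    using uses_feedback_extend[of \<rho> r c x j u, OF that(3,1), of t] by (simp add: U_def X_def k_def)
  have Usq: "sq_int L (case_prod (U i))"
    unfolding L_def
  proof (rule sq_intI_nn)
    note m = ito_processD(5)[OF p[OF i]]
    show "(case_prod (U i)) \<in> borel_measurable (on_discount \<rho>)" using m by simp
    show "(\<integral>\<^sup>+z. ennreal ((case_prod (U i) z)\<^sup>2) \<partial>on_discount \<rho>) < \<infinity>"
      unfolding U_def control_energy[OF m[unfolded U_def] \<rho>] by (rule fin)
  qed
  have Xi: "sq_int L (case_prod (X i))"
    using state_discounted[OF p[OF i] \<rho> Usq[unfolded L_def]] by (simp add: L_def)
  have Xj: "sq_int L (case_prod (X j))"
    "(\<integral>z. (case_prod (X j) z)\<^sup>2 \<partial>L) = (\<integral>\<omega>. (x0 j \<omega> - c)\<^sup>2 \<partial>M) / d"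
    if j: "j \<in> {1..N}" "uses_feedback M \<rho> r c (x j) (u j)" for j
    using feedback_discounted(1,2)[OF p[OF j(1)] \<rho> k UX[OF _ j]] by (simp_all add: L_def d_def k_def)
  have Xjl: "(\<integral>z. case_prod (X j) z * case_prod (X l) z \<partial>L) = 0" if "j \<in> J" "l \<in> J" "j \<noteq> l" for j l
    unfolding L_def using that
    by (intro feedback_uncorrelated[OF p p \<rho> k UX UX unc]) (auto simp: J_def fb)
  have J: "j \<in> {1..N}" "uses_feedback M \<rho> r c (x j) (u j)" if "j \<in> J" for j
    using that fb by (auto simp: J_def)
  have cJ: "card J = N - 1" "finite J" using i by (auto simp: J_def)
  \<comment> \<open>Agent \<open>i\<close> is left out of the average, since its control is
    arbitrary. Its own weight in the population mean turns the deviation from that mean into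
    \<open>(1 - 1 / N) * (X i - m)\<close>.\<close>
  define m where "m z = (1 / real (N - 1)) * (\<Sum>j\<in>J. case_prod (X j) z)" for z
  have msq: "sq_int L m"
    unfolding m_def[abs_def] by (intro sq_int_cmult sq_int_sum Xj(1)) (auto simp: J_def fb)
  define Vx where "Vx = (\<integral>z. (case_prod (X i) z)\<^sup>2 \<partial>L)"
  define Vu where "Vu = (\<integral>z. (case_prod (U i) z)\<^sup>2 \<partial>L)"
  define Vm where "Vm = (\<integral>z. (m z)\<^sup>2 \<partial>L)"
  define Vc where "Vc = (\<integral>z. case_prod (X i) z * m z \<partial>L)"
  have nonneg: "0 \<le> Vx" "0 \<le> Vu" "0 \<le> Vm" by (auto simp: Vx_def Vu_def Vm_def)
  have CS: "\<bar>Vc\<bar> \<le> sqrt Vx * sqrt Vm"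
    using integral_Cauchy_Schwarz[OF Xi msq] by (simp add: Vc_def Vx_def Vm_def)
  have "Vm \<le> 2 * c0 / (d * real N)"
  proof -
    have "(\<integral>z. (\<Sum>j\<in>J. case_prod (X j) z)\<^sup>2 \<partial>L) =
      (\<Sum>j\<in>J. \<Sum>l\<in>J. \<integral>z. case_prod (X j) z * case_prod (X l) z \<partial>L)"
      unfolding power2_eq_square sum_product
      using sq_int_mult[OF Xj(1)[OF J] Xj(1)[OF J]]
      by (subst Lint_sum)
         (auto intro!: sum.cong Lint_sum Bochner_Integration.integrable_sum)
    also have "\<dots> = (\<Sum>j\<in>J. \<Sum>l\<in>J. if j = l then \<integral>z. (case_prod (X j) z)\<^sup>2 \<partial>L else 0)"
      using Xjl by (intro sum.cong refl) (auto simp: power2_eq_square)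
    also have "\<dots> = (\<Sum>j\<in>J. \<integral>z. (case_prod (X j) z)\<^sup>2 \<partial>L)"
      using cJ by (simp add: sum.delta)
    also have "\<dots> \<le> (\<Sum>j\<in>J. c0 / d)"
      using Xj(2)[OF J] var[OF J(1)] d by (intro sum_mono) (simp add: divide_right_mono)
    finally have le: "(\<integral>z. (\<Sum>j\<in>J. case_prod (X j) z)\<^sup>2 \<partial>L) \<le> real (N - 1) * (c0 / d)"
      using cJ by simp
    have c0: "0 \<le> c0"
      by (rule order_trans[OF _ var[OF i]]) simp
    have "Vm = (1 / real (N - 1))\<^sup>2 * (\<integral>z. (\<Sum>j\<in>J. case_prod (X j) z)\<^sup>2 \<partial>L)"
      unfolding Vm_def m_def power_mult_distrib by simp
    also have "\<dots> \<le> (1 / real (N - 1))\<^sup>2 * (real (N - 1) * (c0 / d))"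
      by (intro mult_left_mono le) simp
    also have "\<dots> = c0 / d * (1 / real (N - 1))" using N by (simp add: power2_eq_square)
    \<comment> \<open>For \<open>N \<ge> 2\<close> one has \<open>1 / (N - 1) \<le> 2 / N\<close>;
      this is where the factor 2 arises.\<close>
    also have "\<dots> \<le> c0 / d * (2 / real N)"
      using N c0 d by (intro mult_left_mono) (auto simp: field_simps of_nat_diff)
    finally show ?thesis by (simp add: mult.commute)
  qed
  moreover have "cost M \<rho> r N i x u = (1 - 1 / real N)\<^sup>2 * (Vx - 2 * Vc + Vm) + r * Vu"
  proof -
    define q where "q = (1 - 1 / real N)\<^sup>2"
    define H where "H z = q * (case_prod (X i) z - m z)\<^sup>2 + r * (case_prod (U i) z)\<^sup>2" for z
    note Dsq = sq_int_diff[OF Xi msq]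
    have iH: "integrable L H"
      unfolding H_def[abs_def] using sq_int_power2[OF Dsq] sq_int_power2[OF Usq] by simp
    have mH: "(\<lambda>t. H (t, \<omega>)) \<in> borel_measurable borel" if "\<omega> \<in> space M" for \<omega>
    proof -
      have "H \<in> borel_measurable (borel \<Otimes>\<^sub>M M)"
        using borel_measurable_integrable[OF iH] by (simp add: L_def)
      then show ?thesis using that by (intro measurable_Pair1) auto
    qed
    have eq: "\<bar>x i t \<omega> - population_mean N x t \<omega>\<bar>\<^sup>2 + r * \<bar>u i t \<omega>\<bar>\<^sup>2 = H (t, \<omega>)" if "0 \<le> t" for t \<omega>
    proof -
      have "(\<Sum>j=1..N. x j t \<omega>) = x i t \<omega> + (\<Sum>j\<in>J. x j t \<omega>)"
        using i unfolding J_def by (intro sum.remove) auto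
      also have "(\<Sum>j\<in>J. x j t \<omega>) = (\<Sum>j\<in>J. X j t \<omega>) + real (N - 1) * c"
        using that cJ by (simp add: X_def sum_subtractf)
      also have "(\<Sum>j\<in>J. X j t \<omega>) = real (N - 1) * m (t, \<omega>)"
        using N by (simp add: m_def)
      finally have S: "(\<Sum>j=1..N. x j t \<omega>) = x i t \<omega> + real (N - 1) * (m (t, \<omega>) + c)"
        by (simp add: algebra_simps)
      have "x i t \<omega> - population_mean N x t \<omega> = (1 - 1 / real N) * (X i t \<omega> - m (t, \<omega>))"
        unfolding population_mean_def S using N that
        by (simp add: X_def field_simps of_nat_diff)
      then show ?thesis using that by (simp add: H_def q_def power_mult_distrib U_def)
    qed
    have "cost M \<rho> r N i x u = (\<integral>\<omega>. (\<integral>t. H (t, \<omega>) \<partial>discounted \<rho>) \<partial>M)"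
      unfolding cost_def
    proof (intro Lint_cong refl)
      fix \<omega> assume \<omega>: "\<omega> \<in> space M"
      have "(\<integral>t. H (t, \<omega>) \<partial>discounted \<rho>) = (\<integral>t. discount \<rho> t * H (t, \<omega>) \<partial>lborel)"
        by (rule integral_weighted) (use mH[OF \<omega>] in auto)
      also have "\<dots> = (LBINT t:{0..}. exp (- \<rho> * t) *
        (\<bar>x i t \<omega> - population_mean N x t \<omega>\<bar>\<^sup>2 + r * \<bar>u i t \<omega>\<bar>\<^sup>2))"
        unfolding set_lebesgue_integral_def
        by (intro Lint_cong refl) (simp add: eq[symmetric] indicator_def)
      finally show "(LBINT t:{0..}. exp (- \<rho> * t) *
        (\<bar>x i t \<omega> - population_mean N x t \<omega>\<bar>\<^sup>2 + r * \<bar>u i t \<omega>\<bar>\<^sup>2)) = (\<integral>t. H (t, \<omega>) \<partial>discounted \<rho>)" ..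
    qed
    also have "\<dots> = (\<integral>z. H z \<partial>L)"
      using integral_weighted_snd(1)[OF w iH[unfolded L_def]] by (simp add: L_def)
    also have "\<dots> = q * (\<integral>z. (case_prod (X i) z - m z)\<^sup>2 \<partial>L) + r * Vu"
      unfolding H_def[abs_def] Vu_def using sq_int_power2[OF Dsq] sq_int_power2[OF Usq] by simp
    also have "(\<integral>z. (case_prod (X i) z - m z)\<^sup>2 \<partial>L) = Vx - 2 * Vc + Vm"
      using integral_sq_add[OF Xi msq, of 1 "-1"] by (simp add: Vx_def Vc_def Vm_def)
    finally show ?thesis by (simp add: q_def)
  qed
  moreover have "riccati_p \<rho> r' * a \<le> Vx + r' * Vu" if "solvable \<rho> r'" for r'
  proof -
    have "Vx + r' * Vu = riccati_p \<rho> r' * a + (riccati_p \<rho> r' + r') *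
      (\<integral>z. (case_prod (U i) z + gain \<rho> r' * case_prod (X i) z)\<^sup>2 \<partial>L)"
      using completed_square[OF p[OF i] that Usq[unfolded L_def]]
      unfolding L_def[symmetric] Vx_def Vu_def a_def .
    then show ?thesis using riccati_add_pos[OF that] by simp
  qed
  moreover have "Vx + r * Vu = riccati_p \<rho> r * a \<and> Vx = a / d" if f: "uses_feedback M \<rho> r c (x i) (u i)"
  proof
    have "(\<integral>z. (case_prod (U i) z + k * case_prod (X i) z)\<^sup>2 \<partial>L) = (\<integral>z. 0 \<partial>L)"
      using UX[OF _ i f] by (intro Lint_cong refl) (auto simp: L_def space_pair_measure)
    then have z: "(\<integral>z. (case_prod (U i) z + k * case_prod (X i) z)\<^sup>2 \<partial>L) = 0" by simp
    show "Vx + r * Vu = riccati_p \<rho> r * a"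
      using completed_square[OF p[OF i] s Usq[unfolded L_def]]
      unfolding L_def[symmetric] k_def[symmetric] z Vx_def Vu_def a_def by simp
    show "Vx = a / d" using Xj(2)[OF i f] by (simp add: Vx_def a_def)
  qed
  ultimately show thesis using nonneg CS that by blast
qed

end

section \<open>Equilibrium estimates\<close>

text \<open>The weight matters: with \<open>\<delta> = sqrt N\<close> and
  \<open>B = O(1 / N)\<close>, the second summand is \<open>O(1 / sqrt N)\<close> and the first a
  fraction \<open>1 / sqrt N\<close> of \<open>A\<close>.\<close>

lemma amgm_weighted:
  fixes A B \<delta> :: real
  assumes "0 \<le> A" "0 \<le> B" "0 < \<delta>"
  shows "2 * (sqrt A * sqrt B) \<le> A / \<delta> + \<delta> * B"
proof -
  have "sqrt A * sqrt B = sqrt (A / \<delta>) * sqrt (\<delta> * B)"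
    using assms by (simp add: real_sqrt_mult[symmetric])
  also have "\<dots> \<le> (A / \<delta> + \<delta> * B) / 2"
    using arith_geo_mean_sqrt[of "A / \<delta>" "\<delta> * B"] assms
    unfolding real_sqrt_mult[of "A / \<delta>" "\<delta> * B"] by simp
  finally show ?thesis by simp
qed

text \<open>\<open>Vx\<close> has no upper bound here, so the cross term is charged to a small
  fraction of \<open>Vx\<close>. The reduced form \<open>e * Vx + r * Vu\<close> is a convex
  combination of the forms with coefficients 1 and \<open>\<alpha>\<close> in front of
  \<open>Vx\<close>. The first is at least \<open>b\<close>, the second nonnegative, and the loss is
  the weight \<open>\<mu>\<close> of the second times \<open>b\<close>.\<close>

lemma cost_lower_bound:
  fixes n :: real
  assumes n: "1 \<le> n" and V: "0 \<le> Vx" "0 \<le> Vm" "\<bar>Vc\<bar> \<le> sqrt Vx * sqrt Vm" "Vm \<le> B / n" and B: "0 \<le> B"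
    and \<alpha>: "\<alpha> < 1" "3 / sqrt n \<le> 1 - \<alpha>"
    and low: "b \<le> Vx + r * Vu" "0 \<le> \<alpha> * Vx + r * Vu" and b: "b \<le> b0" "0 \<le> b"
  shows "b - (3 * b0 / (1 - \<alpha>) + B) / sqrt n \<le> (1 - 1 / n)\<^sup>2 * (Vx - 2 * Vc + Vm) + r * Vu"
proof -
  define s where "s = sqrt n"
  have s: "1 \<le> s" "n = s\<^sup>2" using n by (auto simp: s_def)
  define q where "q = (1 - 1 / n)\<^sup>2"
  have n1: "0 \<le> 1 - 1 / n" "1 - 1 / n \<le> 1" using n by (auto simp: field_simps)
  have q: "0 \<le> q" "q \<le> 1" using n1 by (auto simp: q_def power_le_one)
  have q2: "1 - 2 / n \<le> q" by (simp add: q_def power2_eq_square algebra_simps)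
  \<comment> \<open>What remains of the coefficient of \<open>Vx\<close>: the factor
    \<open>q\<close> loses at most \<open>2 / n \<le> 2 / s\<close>, the cross term at most another
    \<open>1 / s\<close>.\<close>
  define e where "e = q * (1 - 1 / s)"
  have s1: "0 \<le> 1 / s" "1 / s \<le> 1" "1 / n \<le> 1 / s"
    using s by (auto simp: power2_eq_square field_simps)
  have e: "1 - 3 / s \<le> e" "e \<le> 1"
  proof -
    have "e = q - q * (1 / s)" by (simp add: e_def algebra_simps)
    moreover have "q * (1 / s) \<le> 1 / s" "0 \<le> q * (1 / s)" using q s1 mult_right_mono[of q 1 "1 / s"] by auto
    moreover from calculation show "e \<le> 1" using q(2) by linarith
    ultimately show "1 - 3 / s \<le> e" using q2 s1 by auto
  qed
  have "2 * \<bar>Vc\<bar> \<le> Vx / s + s * Vm" using amgm_weighted[OF V(1,2), of s] V(3) s(1) by linarith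
  then have "(1 - 1 / s) * Vx - s * Vm \<le> Vx - 2 * Vc + Vm" using V(2) by (simp add: algebra_simps)
  then have "q * ((1 - 1 / s) * Vx - s * Vm) \<le> q * (Vx - 2 * Vc + Vm)" using q(1) by (rule mult_left_mono)
  moreover have "q * (s * Vm) \<le> B / s"
  proof -
    have "q * (s * Vm) \<le> s * Vm" using q V(2) s(1) by (simp add: mult_left_le_one_le)
    also have "\<dots> \<le> s * (B / n)" using V(4) s(1) by (intro mult_left_mono) auto
    also have "\<dots> = B / s" using s by (simp add: power2_eq_square)
    finally show ?thesis .
  qed
  ultimately have main: "e * Vx - B / s \<le> q * (Vx - 2 * Vc + Vm)" by (simp add: e_def algebra_simps)
  \<comment> \<open>The solution of \<open>e = (1 - \<mu>) + \<mu> * \<alpha>\<close>. It lies below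
    1 or equals it because \<open>1 - e \<le> 3 / s \<le> 1 - \<alpha>\<close>.\<close>
  define \<mu> where "\<mu> = (1 - e) / (1 - \<alpha>)"
  have \<mu>: "0 \<le> \<mu>" "\<mu> \<le> 1"
    using e \<alpha> by (auto simp: \<mu>_def s_def[symmetric] divide_le_eq_1)
  have \<mu>3: "\<mu> \<le> (3 / s) / (1 - \<alpha>)"
    unfolding \<mu>_def by (rule divide_right_mono) (use e \<alpha> in auto)
  have ml: "\<mu> * (1 - \<alpha>) = 1 - e" using \<alpha>(1) by (simp add: \<mu>_def)
  have "e * Vx + r * Vu = Vx + r * Vu - (\<mu> * (1 - \<alpha>)) * Vx" unfolding ml by (simp add: algebra_simps)
  also have "\<dots> = (1 - \<mu>) * (Vx + r * Vu) + \<mu> * (\<alpha> * Vx + r * Vu)" by (simp add: algebra_simps)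
  also have "\<dots> \<ge> (1 - \<mu>) * b + 0"
    using \<mu> low by (intro add_mono mult_left_mono mult_nonneg_nonneg) auto
  finally have "b - \<mu> * b \<le> e * Vx + r * Vu" by (simp add: algebra_simps)
  moreover have "\<mu> * b \<le> (3 / s) / (1 - \<alpha>) * b0"
    by (rule mult_mono[OF \<mu>3 b(1) order_trans[OF \<mu>(1) \<mu>3] b(2)])
  moreover have "(3 / s) / (1 - \<alpha>) * b0 = (3 * b0 / (1 - \<alpha>)) / s" by simp
  ultimately have "b - (3 * b0 / (1 - \<alpha>)) / s - B / s \<le> q * (Vx - 2 * Vc + Vm) + r * Vu"
    using main by linarith
  then show ?thesis by (simp add: s_def[symmetric] q_def[symmetric] add_divide_distrib)
qed

text \<open>Under the feedback law \<open>Vx\<close> is bounded, so the cross term may be estimated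
  directly. The three errors \<open>Vx / s\<close>, \<open>s * Vm\<close> and \<open>Vm\<close> are
  each at most \<open>B / s\<close>.\<close>

lemma cost_upper_bound:
  fixes n :: real
  assumes n: "1 \<le> n" and V: "0 \<le> Vx" "0 \<le> Vm" "\<bar>Vc\<bar> \<le> sqrt Vx * sqrt Vm" "Vm \<le> B / n" "Vx \<le> B"
    and eq: "Vx + r * Vu = b"
  shows "(1 - 1 / n)\<^sup>2 * (Vx - 2 * Vc + Vm) + r * Vu \<le> b + 3 * B / sqrt n"
proof -
  define s where "s = sqrt n"
  have s: "1 \<le> s" "n = s\<^sup>2" using n by (auto simp: s_def)
  define q where "q = (1 - 1 / n)\<^sup>2"
  have n1: "0 \<le> 1 - 1 / n" "1 - 1 / n \<le> 1" using n by (auto simp: field_simps)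
  have q: "0 \<le> q" "q \<le> 1" using n1 by (auto simp: q_def power_le_one)
  have "2 * \<bar>Vc\<bar> \<le> Vx + Vm" using amgm_weighted[OF V(1,2), of 1] V(3) by linarith
  then have "0 \<le> Vx - 2 * Vc + Vm" by linarith
  then have "q * (Vx - 2 * Vc + Vm) \<le> Vx - 2 * Vc + Vm" using q by (simp add: mult_left_le_one_le)
  moreover have "2 * \<bar>Vc\<bar> \<le> Vx / s + s * Vm" using amgm_weighted[OF V(1,2), of s] V(3) s(1) by linarith
  moreover have "Vx / s \<le> B / s" using V(5) s(1) by (simp add: divide_right_mono)
  moreover have "s * Vm \<le> B / s"
  proof -
    have "s * Vm \<le> s * (B / n)" using V(4) s(1) by (intro mult_left_mono) auto
    also have "\<dots> = B / s" using s by (simp add: power2_eq_square)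
    finally show ?thesis .
  qed
  moreover have "Vm \<le> s * Vm" using V(2) s(1) by (simp add: mult_le_cancel_right1)
  ultimately have "q * (Vx - 2 * Vc + Vm) + r * Vu \<le> b + 3 * (B / s)" using eq by linarith
  then show ?thesis by (simp add: s_def q_def)
qed

section \<open>Cost bounds for the game, uniform over runs and filtrations\<close>

locale mean_field_game = prob_space M for M :: "'w measure" +
  fixes x0 :: "nat \<Rightarrow> 'w \<Rightarrow> real" and W :: "nat \<Rightarrow> 'w process" and \<rho> r c c0 :: real
  assumes solvable: "solvable \<rho> r"
    and brownian: "independent_brownian_motions M W"
    and A1: "assumption_A1 M x0 W c c0"
begin

lemma initial_sq: "1 \<le> j \<Longrightarrow> sq_int M (x0 j)"
  using A1 by (auto simp: assumption_A1_def sq_int_def dest: borel_measurable_integrable)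

lemma initial_mean: "1 \<le> j \<Longrightarrow> (\<integral>\<omega>. x0 j \<omega> \<partial>M) = c"
  using A1 by (auto simp: assumption_A1_def)

lemma initial_variance:
  assumes j: "1 \<le> j"
  shows "(\<integral>\<omega>. (x0 j \<omega> - c)\<^sup>2 \<partial>M) = (\<integral>\<omega>. \<bar>x0 j \<omega>\<bar>\<^sup>2 \<partial>M) - c\<^sup>2"
    and "(\<integral>\<omega>. (x0 j \<omega> - c)\<^sup>2 \<partial>M) \<le> c0"
proof -
  show eq: "(\<integral>\<omega>. (x0 j \<omega> - c)\<^sup>2 \<partial>M) = (\<integral>\<omega>. \<bar>x0 j \<omega>\<bar>\<^sup>2 \<partial>M) - c\<^sup>2"
    using integral_sq_add[OF initial_sq[OF j] sq_int_const, of 1 "-1" c] initial_mean[OF j] prob_space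
    by (simp add: power2_eq_square)
  \<comment> \<open>The maximum is bounded by \<open>c0\<close> for every population size; size
    \<open>j\<close> already contains agent \<open>j\<close>.\<close>
  have "(\<integral>\<omega>. \<bar>x0 j \<omega>\<bar>\<^sup>2 \<partial>M) \<le> (MAX i\<in>{1..j}. \<integral>\<omega>. \<bar>x0 i \<omega>\<bar>\<^sup>2 \<partial>M)"
    using j by (intro Max_ge) auto
  also have "\<dots> < c0" using A1 j unfolding assumption_A1_def by blast
  finally show "(\<integral>\<omega>. (x0 j \<omega> - c)\<^sup>2 \<partial>M) \<le> c0"
    unfolding eq using zero_le_power2[of c] by linarith
qed

lemma initial_uncorrelated:
  assumes "1 \<le> j" "1 \<le> l" "j \<noteq> l"
  shows "(\<integral>\<omega>. (x0 j \<omega> - c) * (x0 l \<omega> - c) \<partial>M) = 0"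
proof -
  have "indep_vars (\<lambda>_. borel) x0 {1..}" using A1 by (simp add: assumption_A1_def)
  then have "indep_vars (\<lambda>_. borel) x0 {j, l}" by (rule indep_vars_subset) (use assms in auto)
  then have "indep_vars (\<lambda>_. borel) (\<lambda>i \<omega>. x0 i \<omega> - c) {j, l}"
    by (rule indep_vars_compose2[where Y = "\<lambda>_ y. y - c"]) simp
  moreover have int: "integrable M (\<lambda>\<omega>. x0 i \<omega> - c)" if "1 \<le> i" for i
    using sq_int_integrable[OF initial_sq[OF that]] by simp
  ultimately have "(\<integral>\<omega>. (\<Prod>i\<in>{j, l}. x0 i \<omega> - c) \<partial>M) = (\<Prod>i\<in>{j, l}. \<integral>\<omega>. x0 i \<omega> - c \<partial>M)"
    using assms by (intro indep_vars_lebesgue_integral) auto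
  moreover have "(\<integral>\<omega>. x0 i \<omega> - c \<partial>M) = 0" if "1 \<le> i" for i
    using sq_int_integrable[OF initial_sq[OF that]] initial_mean[OF that] prob_space by simp
  ultimately show ?thesis using assms by simp
qed

text \<open>\<open>N\<close> times the bound for \<open>Vm\<close>. The same constant also dominates
  the state energy of an agent that uses the feedback law.\<close>

definition variance_bound :: real where
  "variance_bound = 2 * c0 / (\<rho> - ((gain \<rho> r)\<^sup>2 - 2 * gain \<rho> r))"

lemma c0_nonneg: "0 \<le> c0"
  using initial_variance(2)[of 1] by (rule order_trans[rotated]) simp_all

lemma variance_bound_nonneg: "0 \<le> variance_bound"
  using riccati_stable[OF solvable] c0_nonneg by (simp add: variance_bound_def)

text \<open>The only access to the stochastic calculus: a run brings its own filtration and hence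
  its own instance of \<open>agent_system\<close>.\<close>

lemma trajectoryE:
  assumes "trajectory M x0 W N x u"
  obtains G where "agent_system M x0 W N G"
    "\<And>j. j \<in> {1..N} \<Longrightarrow> sde_solution M G (W j) (x0 j) (x j) (u j)"
proof -
  obtain G where G: "compatible_filtration M x0 W N G"
    "\<forall>i\<in>{1..N}. sde_solution M G (W i) (x0 i) (x i) (u i)"
    using assms unfolding trajectory_def by blast
  have "agent_system M x0 W N G"
    using G(1) brownian prob_space_axioms by (intro agent_system.intro agent_system_axioms.intro)
  then show thesis using G(2) that by blast
qed

lemma deviation_decomposition:
  assumes dev: "(x, u) \<in> deviations M x0 W \<rho> r c N i" and N: "2 \<le> N" and i: "i \<in> {1..N}"
  defines "a \<equiv> \<integral>\<omega>. (x0 i \<omega> - c)\<^sup>2 \<partial>M"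
  obtains Vx Vu Vm Vc where
    "cost M \<rho> r N i x u = (1 - 1 / real N)\<^sup>2 * (Vx - 2 * Vc + Vm) + r * Vu"
    "0 \<le> Vx" "0 \<le> Vm" "Vm \<le> variance_bound / real N" "\<bar>Vc\<bar> \<le> sqrt Vx * sqrt Vm"
    "\<And>r'. solvable \<rho> r' \<Longrightarrow> riccati_p \<rho> r' * a \<le> Vx + r' * Vu"
    "uses_feedback M \<rho> r c (x i) (u i) \<Longrightarrow> Vx + r * Vu = riccati_p \<rho> r * a \<and> Vx \<le> variance_bound"
proof -
  have tr: "trajectory M x0 W N x u"
    and fb: "\<And>j. j \<in> {1..N} \<Longrightarrow> j \<noteq> i \<Longrightarrow> uses_feedback M \<rho> r c (x j) (u j)"
    and fin: "(\<integral>\<^sup>+\<omega>. (\<integral>\<^sup>+t\<in>{0..}. ennreal (exp (- \<rho> * t) * \<bar>u i t \<omega>\<bar>\<^sup>2) \<partial>lborel) \<partial>M) < \<infinity>"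
    using dev by (auto simp: deviations_def centralized_controls_def)
  obtain G where G: "agent_system M x0 W N G"
    and sde: "\<And>j. j \<in> {1..N} \<Longrightarrow> sde_solution M G (W j) (x0 j) (x j) (u j)"
    using trajectoryE[OF tr] by blast
  have d: "0 < \<rho> - ((gain \<rho> r)\<^sup>2 - 2 * gain \<rho> r)" using riccati_stable[OF solvable] by simp
  show thesis
  proof (rule agent_system.cost_decomposition[OF G solvable N i sde fb fin initial_sq initial_variance(2) initial_uncorrelated])
    fix Vx Vu Vm Vc
    assume cost: "cost M \<rho> r N i x u = (1 - 1 / real N)\<^sup>2 * (Vx - 2 * Vc + Vm) + r * Vu"
      and V: "0 \<le> Vx" "0 \<le> Vu" "0 \<le> Vm"
      and Vm: "Vm \<le> 2 * c0 / ((\<rho> - ((gain \<rho> r)\<^sup>2 - 2 * gain \<rho> r)) * real N)"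
      and Vc: "\<bar>Vc\<bar> \<le> sqrt Vx * sqrt Vm"
      and low: "\<And>r'. solvable \<rho> r' \<Longrightarrow> riccati_p \<rho> r' * (\<integral>\<omega>. (x0 i \<omega> - c)\<^sup>2 \<partial>M) \<le> Vx + r' * Vu"
      and eq: "uses_feedback M \<rho> r c (x i) (u i) \<Longrightarrow> Vx + r * Vu = riccati_p \<rho> r * (\<integral>\<omega>. (x0 i \<omega> - c)\<^sup>2 \<partial>M)
        \<and> Vx = (\<integral>\<omega>. (x0 i \<omega> - c)\<^sup>2 \<partial>M) / (\<rho> - ((gain \<rho> r)\<^sup>2 - 2 * gain \<rho> r))"
    have "(\<integral>\<omega>. (x0 i \<omega> - c)\<^sup>2 \<partial>M) / (\<rho> - ((gain \<rho> r)\<^sup>2 - 2 * gain \<rho> r)) \<le> variance_bound"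
      unfolding variance_bound_def using initial_variance(2)[of i] c0_nonneg d i
      by (intro divide_right_mono) auto
    then show thesis
      using that[OF cost V(1) V(3) _ Vc] low eq Vm by (auto simp: variance_bound_def a_def)
  qed auto
qed

lemma deviation_cost_lower:
  assumes dev: "(x, u) \<in> deviations M x0 W \<rho> r c N i" and N: "2 \<le> N" and i: "i \<in> {1..N}"
    and \<alpha>: "0 < \<alpha>" "\<alpha> < 1" "solvable \<rho> (r / \<alpha>)" "3 / sqrt (real N) \<le> 1 - \<alpha>"
  shows "riccati_p \<rho> r * (\<integral>\<omega>. (x0 i \<omega> - c)\<^sup>2 \<partial>M)
      - (3 * (riccati_p \<rho> r * c0) / (1 - \<alpha>) + variance_bound) / sqrt (real N) \<le> cost M \<rho> r N i x u"
proof (rule deviation_decomposition[OF dev N i])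
  fix Vx Vu Vm Vc
  define a where "a = (\<integral>\<omega>. (x0 i \<omega> - c)\<^sup>2 \<partial>M)"
  assume cost: "cost M \<rho> r N i x u = (1 - 1 / real N)\<^sup>2 * (Vx - 2 * Vc + Vm) + r * Vu"
    and V: "0 \<le> Vx" "0 \<le> Vm" "Vm \<le> variance_bound / real N" "\<bar>Vc\<bar> \<le> sqrt Vx * sqrt Vm"
    and low: "\<And>r'. solvable \<rho> r' \<Longrightarrow> riccati_p \<rho> r' * (\<integral>\<omega>. (x0 i \<omega> - c)\<^sup>2 \<partial>M) \<le> Vx + r' * Vu"
  have a: "0 \<le> a" by (simp add: a_def)
  \<comment> \<open>The completed square at \<open>r / \<alpha>\<close>, multiplied by
    \<open>\<alpha>\<close>, is the second form required by \<open>cost_lower_bound\<close>.\<close>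
  have "0 \<le> riccati_p \<rho> (r / \<alpha>) * a" using riccati_pos[OF \<alpha>(3)] a by simp
  also have "\<dots> \<le> Vx + (r / \<alpha>) * Vu" using low[OF \<alpha>(3)] by (simp add: a_def)
  finally have "0 \<le> \<alpha> * (Vx + (r / \<alpha>) * Vu)" using \<alpha>(1) by simp
  then have "0 \<le> \<alpha> * Vx + r * Vu" using \<alpha>(1) by (simp add: distrib_left)
  moreover have "riccati_p \<rho> r * a \<le> riccati_p \<rho> r * c0" "0 \<le> riccati_p \<rho> r * a"
    using riccati_pos[OF solvable] initial_variance(2)[of i] i a by (auto simp: a_def)
  ultimately show ?thesis
    unfolding cost using V variance_bound_nonneg \<alpha> low[OF solvable] N
    by (intro cost_lower_bound) (auto simp: a_def)
qed

lemma feedback_cost_upper: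
  assumes dev: "(x, u) \<in> deviations M x0 W \<rho> r c N i" and N: "2 \<le> N" and i: "i \<in> {1..N}"
    and fb: "uses_feedback M \<rho> r c (x i) (u i)"
  shows "cost M \<rho> r N i x u \<le> riccati_p \<rho> r * (\<integral>\<omega>. (x0 i \<omega> - c)\<^sup>2 \<partial>M) + 3 * variance_bound / sqrt (real N)"
proof (rule deviation_decomposition[OF dev N i])
  fix Vx Vu Vm Vc
  assume cost: "cost M \<rho> r N i x u = (1 - 1 / real N)\<^sup>2 * (Vx - 2 * Vc + Vm) + r * Vu"
    and V: "0 \<le> Vx" "0 \<le> Vm" "Vm \<le> variance_bound / real N" "\<bar>Vc\<bar> \<le> sqrt Vx * sqrt Vm"
    and eq: "uses_feedback M \<rho> r c (x i) (u i) \<Longrightarrow>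
      Vx + r * Vu = riccati_p \<rho> r * (\<integral>\<omega>. (x0 i \<omega> - c)\<^sup>2 \<partial>M) \<and> Vx \<le> variance_bound"
  show ?thesis
    unfolding cost using V eq[OF fb] N by (intro cost_upper_bound) auto
qed

text \<open>The feedback law is a function of the current own state, hence admissible. This yields
  the upper inequality for the infimum, and it makes the lower bound for deviations apply to the
  equilibrium cost.\<close>

lemma equilibrium_is_deviation:
  assumes tr: "trajectory M x0 W N x u" and i: "i \<in> {1..N}"
    and fb: "\<And>j. j \<in> {1..N} \<Longrightarrow> uses_feedback M \<rho> r c (x j) (u j)"
  shows "(x, u) \<in> deviations M x0 W \<rho> r c N i"
proof -
  obtain G where G: "agent_system M x0 W N G"
    and sde: "\<And>j. j \<in> {1..N} \<Longrightarrow> sde_solution M G (W j) (x0 j) (x j) (u j)"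
    using trajectoryE[OF tr] by blast
  have "u i \<in> centralized_controls M \<rho> N x"
    unfolding centralized_controls_def
  proof (intro CollectI conjI allI impI)
    show "(\<integral>\<^sup>+\<omega>. (\<integral>\<^sup>+t\<in>{0..}. ennreal (exp (- \<rho> * t) * \<bar>u i t \<omega>\<bar>\<^sup>2) \<partial>lborel) \<partial>M) < \<infinity>"
      using i by (intro agent_system.feedback_control_finite[where x = x and u = u, OF G solvable i _ sde[OF i] fb[OF i]] initial_sq) auto
    fix t :: real assume t: "0 \<le> t"
    let ?S = "sigma (space M) (\<Union>j\<in>{1..N}. sets (gen M (x j) {0..t}))"
    have sub: "(\<Union>j\<in>{1..N}. sets (gen M (x j) {0..t})) \<subseteq> Pow (space M)"
    proof
      fix A assume "A \<in> (\<Union>j\<in>{1..N}. sets (gen M (x j) {0..t}))"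
      then obtain j where "A \<in> sets (gen M (x j) {0..t})" by blast
      from sets.sets_into_space[OF this] show "A \<in> Pow (space M)" by simp
    qed
    have sp: "space ?S = space M" by (rule space_measure_of[OF sub])
    have "x i t \<in> borel_measurable ?S"
    proof (rule measurableI)
      fix A :: "real set" assume "A \<in> sets borel"
      then have "x i t -` A \<inter> space M \<in> sets (gen M (x i) {0..t})"
        using measurable_sets[OF measurable_gen[of t "{0..t}" "x i" M], of A] t by simp
      then show "x i t -` A \<inter> space ?S \<in> sets ?S"
        unfolding sp using i sub by (intro in_measure_of) auto
    qed simp
    then have "(\<lambda>\<omega>. feedback \<rho> r c (x i t \<omega>)) \<in> borel_measurable ?S"
      unfolding feedback_def by measurable
    then show "u i t \<in> borel_measurable ?S"
      using fb[OF i] t sp by (subst measurable_cong) (auto simp: uses_feedback_def)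
  qed
  then show ?thesis using tr fb by (auto simp: deviations_def)
qed

end

theorem theorem4p6:
  fixes M :: "'w measure"
    and x0 :: "nat \<Rightarrow> 'w \<Rightarrow> real"
    and W :: "nat \<Rightarrow> 'w process"
    and \<rho> r xbar0 c0 :: real
    and \<Theta> :: "'p::euclidean_space set"
    and \<theta> :: "nat \<Rightarrow> 'p"
    and F :: "'p measure"
    and xhat uhat :: "nat \<Rightarrow> nat \<Rightarrow> 'w process"
  assumes "prob_space M"
    and "\<rho> > 0"
    and "r > (2 * sqrt (\<rho> + 1) - (\<rho> + 2)) / \<rho>\<^sup>2"
    and "independent_brownian_motions M W"
    and "assumption_A1 M x0 W xbar0 c0"
    \<comment> \<open>agent parameters and the weak limit of their empirical distributions\<close>
    and "\<And>i. i \<ge> 1 \<Longrightarrow> \<theta> i \<in> \<Theta>"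
    and "prob_space F" and "sets F = sets (restrict_space borel \<Theta>)"
    and "weak_limit \<Theta> (empirical_distribution \<Theta> \<theta>) F"
    \<comment> \<open>states and controls of the \<open>N\<close>-agent system when all agents use the feedback law\<close>
    and "\<And>N. N \<ge> 1 \<Longrightarrow> trajectory M x0 W N (xhat N) (uhat N)"
    and "\<And>N i. 1 \<le> i \<Longrightarrow> i \<le> N \<Longrightarrow> uses_feedback M \<rho> r xbar0 (xhat N i) (uhat N i)"
  \<comment> \<open>\<open>\<epsilon> = O(\<dots>)\<close> is asymptotic in \<open>N\<close>; for \<open>N = 1\<close> and \<open>r < 0\<close> the infimum is \<open>-\<infinity>\<close>\<close>
  shows
    "(\<exists>\<epsilon> :: nat \<Rightarrow> real.
        \<epsilon> \<in> O(\<lambda>N. mean_field_error \<rho> (\<lambda>_ _. xbar0) (empirical_distribution \<Theta> \<theta> N) F + 1 / sqrt (real N)) \<and>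
        (\<forall>\<^sub>F N in sequentially. \<forall>i\<in>{1..N}.
           ereal (cost M \<rho> r N i (xhat N) (uhat N)) - ereal (\<epsilon> N)
             \<le> (INF (x, u)\<in>deviations M x0 W \<rho> r xbar0 N i. ereal (cost M \<rho> r N i x u)) \<and>
           (INF (x, u)\<in>deviations M x0 W \<rho> r xbar0 N i. ereal (cost M \<rho> r N i x u))
             \<le> ereal (cost M \<rho> r N i (xhat N) (uhat N)))) \<and>
     (\<forall>i\<ge>1. (\<lambda>N. cost M \<rho> r N i (xhat N) (uhat N))
        \<longlonglongrightarrow> riccati_p \<rho> r * ((\<integral>\<omega>. \<bar>x0 i \<omega>\<bar>\<^sup>2 \<partial>M) - xbar0\<^sup>2))"
proof -
  interpret mean_field_game M x0 W \<rho> r xbar0 c0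
    using assms(1-5)
    by (intro mean_field_game.intro mean_field_game_axioms.intro) (auto simp: solvable_def)
  obtain \<alpha> where \<alpha>: "0 < \<alpha>" "\<alpha> < 1" "solvable \<rho> (r / \<alpha>)"
    using solvable_margin[OF solvable] by blast
  define p where "p = riccati_p \<rho> r"
  define a where "a i = (\<integral>\<omega>. (x0 i \<omega> - xbar0)\<^sup>2 \<partial>M)" for i
  define J where "J N i = cost M \<rho> r N i (xhat N) (uhat N)" for N i
  define C1 where "C1 = 3 * (p * c0) / (1 - \<alpha>) + variance_bound"
  define C2 where "C2 = 3 * variance_bound"
  \<comment> \<open>Relative to \<open>p * a i\<close>, a deviation can save at most the
    \<open>C1\<close> term and the equilibrium can lose at most the \<open>C2\<close> term; the gain
    from deviating is bounded by their sum.\<close>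
  define \<epsilon> where "\<epsilon> N = (C1 + C2) / sqrt (real N)" for N
  have C: "0 \<le> C1" "0 \<le> C2"
    using variance_bound_nonneg c0_nonneg riccati_pos[OF solvable] \<alpha> by (auto simp: C1_def C2_def p_def)
  have "(\<lambda>N. 3 / sqrt (real N)) \<longlonglongrightarrow> 0" by real_asymp
  then have "\<forall>\<^sub>F N in sequentially. 3 / sqrt (real N) < 1 - \<alpha>"
    using \<alpha>(2) by (intro order_tendstoD(2)) auto
  \<comment> \<open>Both thresholds, other agents to average over and a mixing weight of at most 1,
    are uniform in the agent and in the deviation.\<close>
  then have large: "\<forall>\<^sub>F N in sequentially. 2 \<le> N \<and> 3 / sqrt (real N) \<le> 1 - \<alpha>"
    using eventually_ge_at_top[of 2] by eventually_elim simp
  have hat: "(xhat N, uhat N) \<in> deviations M x0 W \<rho> r xbar0 N i" if "i \<in> {1..N}" for N i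
    using that assms(10,11) by (intro equilibrium_is_deviation) auto
  have lower: "p * a i - C1 / sqrt (real N) \<le> cost M \<rho> r N i x u"
    if "2 \<le> N" "3 / sqrt (real N) \<le> 1 - \<alpha>" "i \<in> {1..N}" "(x, u) \<in> deviations M x0 W \<rho> r xbar0 N i" for N i x u
    using deviation_cost_lower[OF that(4,1,3) \<alpha> that(2)] by (simp add: p_def a_def C1_def)
  have upper: "J N i \<le> p * a i + C2 / sqrt (real N)" if "2 \<le> N" "i \<in> {1..N}" for N i
    using feedback_cost_upper[OF hat[OF that(2)] that] assms(11)[of i N] that
    by (simp add: p_def a_def C2_def J_def)
  have "\<epsilon> \<in> O(\<lambda>N. mean_field_error \<rho> (\<lambda>_ _. xbar0) (empirical_distribution \<Theta> \<theta> N) F + 1 / sqrt (real N))"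
  proof (rule bigoI[of _ "C1 + C2"], intro always_eventually allI)
    fix N
    have "0 \<le> mean_field_error \<rho> (\<lambda>_ _. xbar0) (empirical_distribution \<Theta> \<theta> N) F"
      unfolding mean_field_error_def set_lebesgue_integral_def by simp
    then have "1 / sqrt (real N) \<le>
      norm (mean_field_error \<rho> (\<lambda>_ _. xbar0) (empirical_distribution \<Theta> \<theta> N) F + 1 / sqrt (real N))"
      by simp
    then have "(C1 + C2) * (1 / sqrt (real N)) \<le> (C1 + C2) *
      norm (mean_field_error \<rho> (\<lambda>_ _. xbar0) (empirical_distribution \<Theta> \<theta> N) F + 1 / sqrt (real N))"
      using C by (intro mult_left_mono) auto
    then show "norm (\<epsilon> N) \<le> (C1 + C2) *
      norm (mean_field_error \<rho> (\<lambda>_ _. xbar0) (empirical_distribution \<Theta> \<theta> N) F + 1 / sqrt (real N))"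
      using C by (simp add: \<epsilon>_def)
  qed
  moreover have "\<forall>\<^sub>F N in sequentially. \<forall>i\<in>{1..N}.
      ereal (J N i) - ereal (\<epsilon> N) \<le> (INF (x, u)\<in>deviations M x0 W \<rho> r xbar0 N i. ereal (cost M \<rho> r N i x u)) \<and>
      (INF (x, u)\<in>deviations M x0 W \<rho> r xbar0 N i. ereal (cost M \<rho> r N i x u)) \<le> ereal (J N i)"
    using large
  proof eventually_elim
    case (elim N)
    show ?case
    proof (intro ballI conjI)
      fix i assume i: "i \<in> {1..N}"
      show "ereal (J N i) - ereal (\<epsilon> N) \<le> (INF (x, u)\<in>deviations M x0 W \<rho> r xbar0 N i. ereal (cost M \<rho> r N i x u))"
      proof (rule INF_greatest, clarify)
        fix x u assume "(x, u) \<in> deviations M x0 W \<rho> r xbar0 N i"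
        then have "J N i - \<epsilon> N \<le> cost M \<rho> r N i x u"
          using lower[of N i x u] upper[of N i] elim i by (simp add: \<epsilon>_def add_divide_distrib)
        then show "ereal (J N i) - ereal (\<epsilon> N) \<le> ereal (cost M \<rho> r N i x u)" by simp
      qed
      show "(INF (x, u)\<in>deviations M x0 W \<rho> r xbar0 N i. ereal (cost M \<rho> r N i x u)) \<le> ereal (J N i)"
        by (rule INF_lower2[OF hat[OF i]]) (simp add: J_def)
    qed
  qed
  \<comment> \<open>Both bounds squeeze the equilibrium cost onto \<open>p\<close> times the initial
    variance. Agent \<open>i\<close> is present only from \<open>N = i\<close> on.\<close>
  moreover have "(\<lambda>N. J N i) \<longlonglongrightarrow> p * ((\<integral>\<omega>. \<bar>x0 i \<omega>\<bar>\<^sup>2 \<partial>M) - xbar0\<^sup>2)" if i: "1 \<le> i" for i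
    unfolding initial_variance(1)[OF i, symmetric] a_def[symmetric]
  proof (rule real_tendsto_sandwich)
    show "\<forall>\<^sub>F N in sequentially. p * a i - C1 / sqrt (real N) \<le> J N i"
      using large eventually_ge_at_top[of i]
    proof eventually_elim
      case (elim N)
      then show ?case unfolding J_def using i by (intro lower hat) auto
    qed
    show "\<forall>\<^sub>F N in sequentially. J N i \<le> p * a i + C2 / sqrt (real N)"
      using large eventually_ge_at_top[of i]
    proof eventually_elim
      case (elim N)
      then show ?case using i by (intro upper) auto
    qed
    have z: "(\<lambda>N. C / sqrt (real N)) \<longlonglongrightarrow> 0" for C :: real by real_asymp
    show "(\<lambda>N. p * a i - C1 / sqrt (real N)) \<longlonglongrightarrow> p * a i"
      using tendsto_diff[OF tendsto_const z, of "p * a i" C1] by simp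
    show "(\<lambda>N. p * a i + C2 / sqrt (real N)) \<longlonglongrightarrow> p * a i"
      using tendsto_add[OF tendsto_const z, of "p * a i" C2] by simp
  qed
  ultimately show ?thesis unfolding J_def p_def by blast
qed

end
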